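(* Let $p$ be a prime and let $G$ be a finite normally monomial $p$-group with cyclic center. Suppose $A$ is an abelian normal subgroup of maximum order in $G$. Then \[ (\max\mathrm{cd}(G))\,|Z(G)| \text{ divides } c(G)\quad\text{and}\quad c(G)\text{ divides } (\max\mathrm{cd}(G))\exp(A). \]
   Context: A finite group $G$ is called normally monomial if every complex irreducible character of $G$ is induced from a linear character of a normal subgroup of $G$. $\exp(A)$ is the exponent of $A$; $Z(G)$ is the center of $G$; $\mathrm{cd}(G)=\{\chi(1)\mid \chi\in\mathrm{Irr}(G)\}$ is the set of degrees of irreducible complex characters of $G$. A quasi-permutation matrix is a square matrix over $\mathbb{C}$ with non-negative integral trace. $c(G)$ denotes the minimal degree of a faithful representation of $G$ by complex quasi-permutation matrices, i.e. the least $n$ such that there is an injective homomorphism $G\to \mathrm{GL}_n(\mathbb{C})$ all of whose image elements have non-negative integer trace. *)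

theory Defs
  imports
    "Jordan_Normal_Form.VS_Connect"
    "HOL-Algebra.Multiplicative_Group"
    "HOL-Algebra.Elementary_Groups"
begin

definition center :: "('a, 'b) monoid_scheme \<Rightarrow> 'a set" where
  "center G = {z \<in> carrier G. \<forall>g\<in>carrier G. z \<otimes>\<^bsub>G\<^esub> g = g \<otimes>\<^bsub>G\<^esub> z}"

definition group_exponent :: "('a, 'b) monoid_scheme \<Rightarrow> nat" where
  "group_exponent G = Lcm (group.ord G ` carrier G)"

definition GL :: "nat \<Rightarrow> complex mat monoid" where
  "GL n = units_of (ring_mat TYPE(complex) n ())"

definition mat_trace :: "complex mat \<Rightarrow> complex" where
  "mat_trace M = (\<Sum>i<dim_row M. M $$ (i, i))"

text \<open>The degree of a representation is required to be positive. Without this, the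
  \<open>0 \<times> 0\<close> matrices would be a faithful representation of the trivial group.\<close>

definition representation :: "('a, 'b) monoid_scheme \<Rightarrow> nat \<Rightarrow> ('a \<Rightarrow> complex mat) \<Rightarrow> bool" where
  "representation G n \<rho> \<longleftrightarrow> 0 < n \<and> \<rho> \<in> hom G (GL n)"

definition irreducible_representation ::
    "('a, 'b) monoid_scheme \<Rightarrow> nat \<Rightarrow> ('a \<Rightarrow> complex mat) \<Rightarrow> bool" where
  "irreducible_representation G n \<rho> \<longleftrightarrow>
     representation G n \<rho> \<and>
     (\<forall>W. VectorSpace.subspace class_ring W (module_vec TYPE(complex) n) \<longrightarrow>
          (\<forall>g\<in>carrier G. \<forall>w\<in>W. \<rho> g *\<^sub>v w \<in> W) \<longrightarrow>
          W = {0\<^sub>v n} \<or> W = carrier_vec n)"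

text \<open>Class functions are restricted to the carrier (and \<open>undefined\<close> outside it), so that
  two characters that agree on the group are equal.\<close>

definition character :: "('a, 'b) monoid_scheme \<Rightarrow> ('a \<Rightarrow> complex mat) \<Rightarrow> 'a \<Rightarrow> complex" where
  "character G \<rho> = (\<lambda>g\<in>carrier G. mat_trace (\<rho> g))"

definition Irr :: "('a, 'b) monoid_scheme \<Rightarrow> ('a \<Rightarrow> complex) set" where
  "Irr G = {\<chi>. \<exists>n \<rho>. irreducible_representation G n \<rho> \<and> \<chi> = character G \<rho>}"

definition linear_characters :: "('a, 'b) monoid_scheme \<Rightarrow> ('a \<Rightarrow> complex) set" where
  "linear_characters G = {\<chi>. \<exists>\<rho>. representation G 1 \<rho> \<and> \<chi> = character G \<rho>}"

definition cd :: "('a, 'b) monoid_scheme \<Rightarrow> nat set" where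
  "cd G = {d. \<exists>\<chi>\<in>Irr G. \<chi> \<one>\<^bsub>G\<^esub> = of_nat d}"

definition induced ::
    "('a, 'b) monoid_scheme \<Rightarrow> 'a set \<Rightarrow> ('a \<Rightarrow> complex) \<Rightarrow> 'a \<Rightarrow> complex" where
  "induced G H \<phi> = (\<lambda>g\<in>carrier G.
     (\<Sum>x | x \<in> carrier G \<and> inv\<^bsub>G\<^esub> x \<otimes>\<^bsub>G\<^esub> g \<otimes>\<^bsub>G\<^esub> x \<in> H.
        \<phi> (inv\<^bsub>G\<^esub> x \<otimes>\<^bsub>G\<^esub> g \<otimes>\<^bsub>G\<^esub> x)) / of_nat (card H))"

definition normally_monomial :: "('a, 'b) monoid_scheme \<Rightarrow> bool" where
  "normally_monomial G \<longleftrightarrow> group G \<and> finite (carrier G) \<and>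
     (\<forall>\<chi>\<in>Irr G. \<exists>N \<phi>. N \<lhd> G \<and> \<phi> \<in> linear_characters (G\<lparr>carrier := N\<rparr>) \<and> \<chi> = induced G N \<phi>)"

definition quasi_permutation_matrix :: "nat \<Rightarrow> complex mat \<Rightarrow> bool" where
  "quasi_permutation_matrix n M \<longleftrightarrow> M \<in> carrier_mat n n \<and> mat_trace M \<in> \<nat>"

definition quasi_perm_degree :: "('a, 'b) monoid_scheme \<Rightarrow> nat" where
  "quasi_perm_degree G = (LEAST n. \<exists>\<rho>. representation G n \<rho> \<and> inj_on \<rho> (carrier G) \<and>
     (\<forall>g\<in>carrier G. quasi_permutation_matrix n (\<rho> g)))"

definition abelian_normal_subgroup :: "'a set \<Rightarrow> ('a, 'b) monoid_scheme \<Rightarrow> bool" where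
  "abelian_normal_subgroup A G \<longleftrightarrow> A \<lhd> G \<and> comm_group (G\<lparr>carrier := A\<rparr>)"

end

theory Submission
  imports Defs "Jordan_Normal_Form.Char_Poly" "HOL-Number_Theory.Cong"
begin

text \<open>Let \<open>z\<close> be an element of order \<open>p\<close> in the cyclic center \<open>Z\<close>. A nontrivial normal subgroup of a
\<open>p\<close>-group meets the center, hence contains \<open>z\<close>; so a representation of \<open>G\<close> is faithful as soon as it
is nontrivial at \<open>z\<close>. If an irreducible character \<open>\<chi>\<close> is nontrivial at \<open>z\<close> and is induced from a linear
character of a normal subgroup \<open>N\<close>, then \<open>\<chi>\<close> takes the value \<open>\<chi>(1)\<close> at every commutator of \<open>N\<close>.
By faithfulness \<open>N\<close> is abelian, and \<open>\<chi>(1) = |G:N| \<ge> |G:A|\<close>. Conversely every irreducible degree is at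
most \<open>|G:A|\<close>, because \<open>A\<close> fixes a line. Hence the largest degree is \<open>|G:A|\<close>, and it is the degree of every
irreducible representation that is nontrivial at \<open>z\<close>
(\<open>normally_monomial_faithful_degree\<close>, \<open>irreducible_degree_le_index\<close>, \<open>irreducible_degree\<close>).

Take a faithful representation of least degree \<open>n\<close> among those whose traces are non-negative integers.
On \<open>A\<close> its trace is a sum of \<open>n\<close> linear characters, one of which, \<open>\<mu>\<close>, is nontrivial at \<open>z\<close>. The
multiplicities of these characters do not change under conjugation by \<open>G\<close>, nor, since the trace is integral,
under \<open>\<nu> \<mapsto> \<nu>^s\<close> with \<open>s\<close> prime to \<open>p\<close> (\<open>multiplicity_char_power\<close>). So all members of the set \<open>O\<close> of the
characters \<open>(g\<mu>)^s\<close> occur, and they are all nontrivial at \<open>z\<close>. The stabilizer in \<open>G\<close> of a member \<open>\<nu>\<close> is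
exactly \<open>A\<close>: an element outside \<open>A\<close> that fixes \<open>\<nu>\<close> would have an eigenvector in the \<open>\<nu>\<close>-eigenspace of \<open>A\<close>,
and the translates of that line would span a representation of degree smaller than \<open>|G:A|\<close>
(\<open>stabilizer_of_eigencharacter\<close>).

Let \<open>p^f\<close> be the order of \<open>\<mu>\<close> and \<open>h\<close> the number of classes \<open>{\<nu>^s | s prime to p}\<close> in \<open>O\<close> (\<open>orb\<close> and
\<open>num_classes\<close> in the locale \<open>char_orbit\<close>), so that
\<open>|O| = h p^(f-1) (p-1)\<close>. Then the least degree is \<open>n = h p^f\<close>. For the lower bound sum the trace over the group
generated by \<open>z\<close>: the sum is \<open>p\<close> times the number of constituents that are trivial at \<open>z\<close>, which is at most
\<open>p (n - |O|)\<close>, and it is at least the term \<open>n\<close> of the identity (\<open>quasi_permutation_constituent\<close>). For the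
upper bound, since \<open>A\<close> is the stabilizer of each member of \<open>O\<close>, there is a representation by monomial matrices
on a basis indexed by \<open>O\<close> whose trace is the sum of the members of \<open>O\<close> on \<open>A\<close> and zero elsewhere. Every class
contributes a Ramanujan sum, an integer not less than \<open>-p^(f-1)\<close>, so adding \<open>h p^(f-1)\<close> trivial summands makes
all traces non-negative integers (\<open>orbit_quasi_permutation_representation\<close>).

It remains to compare \<open>h p^f\<close> with the two bounds. The classes form a single \<open>G\<close>-orbit on which \<open>A\<close> acts
trivially, so \<open>h\<close> divides \<open>|G:A|\<close>, and \<open>\<mu>\<close> has a value of order \<open>p^f\<close>, so \<open>p^f\<close> divides \<open>exp A\<close>.
Evaluating the members of \<open>O\<close> at a generator of \<open>Z\<close> gives all powers of a primitive \<open>|Z|\<close>-th root of unity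
with exponents prime to \<open>p\<close>, each at least \<open>|G:A|\<close> times; hence \<open>h p^f \<ge> |G:A| |Z|\<close>, and both sides are powers
of \<open>p\<close>. In the trivial group there is no element \<open>z\<close>, but all quantities are \<open>1\<close>.\<close>

section \<open>Column spaces of injective matrices\<close>

text \<open>Injectivity expresses that the columns are linearly independent: subspaces of \<open>\<complex>\<^sup>n\<close> are handled below as
column spaces, and their bases as injective matrices.\<close>

definition injective_mat :: "complex mat \<Rightarrow> bool" where
  "injective_mat C \<longleftrightarrow> (\<forall>v\<in>carrier_vec (dim_col C). C *\<^sub>v v = 0\<^sub>v (dim_row C) \<longrightarrow> v = 0\<^sub>v (dim_col C))"

lemma injective_matD:
  assumes "injective_mat C" "C \<in> carrier_mat n k" "v \<in> carrier_vec k" "C *\<^sub>v v = 0\<^sub>v n"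
  shows "v = 0\<^sub>v k"
  using assms unfolding injective_mat_def by auto

lemma injective_mat_cancel:
  assumes "injective_mat C" "C \<in> carrier_mat n k" "v \<in> carrier_vec k" "w \<in> carrier_vec k"
    "C *\<^sub>v v = C *\<^sub>v w"
  shows "v = w"
proof -
  have "C *\<^sub>v (v - w) = 0\<^sub>v n"
    using assms mult_minus_distrib_mat_vec[of C n k v w] by (intro eq_vecI) auto
  then have "v - w = 0\<^sub>v k" using injective_matD[OF assms(1,2)] assms(3,4) by auto
  then have "(v - w) $ i = 0" if "i < k" for i using that by simp
  then show ?thesis using assms(3,4) by (intro eq_vecI) auto
qed

lemma mat_eq_by_vec:
  assumes "(M :: complex mat) \<in> carrier_mat n k" "N \<in> carrier_mat n k"
    "\<And>v. v \<in> carrier_vec k \<Longrightarrow> M *\<^sub>v v = N *\<^sub>v v"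
  shows "M = N"
proof (rule eq_matI)
  fix i j assume ij: "i < dim_row N" "j < dim_col N"
  have "M *\<^sub>v unit_vec k j = N *\<^sub>v unit_vec k j" using assms by auto
  then have "(M *\<^sub>v unit_vec k j) $ i = (N *\<^sub>v unit_vec k j) $ i" by simp
  then show "M $$ (i,j) = N $$ (i,j)" using ij assms(1,2) by auto
qed (use assms in auto)

lemma injective_mat_cancel_mat:
  assumes "injective_mat C" "C \<in> carrier_mat n k" "S \<in> carrier_mat k m" "T \<in> carrier_mat k m"
    "C * S = C * T"
  shows "S = T"
proof (rule mat_eq_by_vec[OF assms(3,4)])
  fix v :: "complex vec" assume v: "v \<in> carrier_vec m"
  have "C *\<^sub>v (S *\<^sub>v v) = C *\<^sub>v (T *\<^sub>v v)"
    using assms v by (metis assoc_mult_mat_vec)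
  then show "S *\<^sub>v v = T *\<^sub>v v"
    using injective_mat_cancel[OF assms(1,2)] assms(3,4) v by auto
qed

lemma injective_mat_mult:
  assumes "injective_mat C" "C \<in> carrier_mat n k" "injective_mat D" "D \<in> carrier_mat k m"
  shows "injective_mat (C * D)"
  unfolding injective_mat_def
proof (intro ballI impI)
  fix v assume v: "v \<in> carrier_vec (dim_col (C * D))" "C * D *\<^sub>v v = 0\<^sub>v (dim_row (C * D))"
  have vm: "v \<in> carrier_vec m" using v assms by auto
  have "C *\<^sub>v (D *\<^sub>v v) = 0\<^sub>v n" using v(2) assms(2,4) vm by (metis assoc_mult_mat_vec carrier_matD(1) index_mult_mat(2))
  then have "D *\<^sub>v v = 0\<^sub>v k" using injective_matD[OF assms(1,2)] assms(4) vm by auto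
  then show "v = 0\<^sub>v (dim_col (C * D))" using injective_matD[OF assms(3,4) vm] assms by auto
qed

lemma injective_mat_left_factor:
  assumes "injective_mat (C * D)" "C \<in> carrier_mat n k" "D \<in> carrier_mat k m"
  shows "injective_mat D"
  unfolding injective_mat_def
proof (intro ballI impI)
  fix v assume v: "v \<in> carrier_vec (dim_col D)" "D *\<^sub>v v = 0\<^sub>v (dim_row D)"
  have vm: "v \<in> carrier_vec m" using v assms by auto
  have "C * D *\<^sub>v v = C *\<^sub>v (D *\<^sub>v v)" using assms vm by auto
  also have "\<dots> = 0\<^sub>v n" using v assms by auto
  finally show "v = 0\<^sub>v (dim_col D)"
    using injective_matD[OF assms(1), of n m v] assms vm by auto
qed

text \<open>With more columns than rows, zero rows could be added to make the matrix square. The result is not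
surjective, hence singular, and a vector in its kernel is one in the kernel of \<open>C\<close>.\<close>

lemma injective_mat_dim_le:
  assumes C: "C \<in> carrier_mat n k" and inj: "injective_mat C"
  shows "k \<le> n"
proof (rule ccontr)
  assume "\<not> k \<le> n"
  then have nk: "n < k" by simp
  define E where "E = mat k k (\<lambda>(i,j). if i < n then C $$ (i,j) else 0)"
  have E: "E \<in> carrier_mat k k" by (simp add: E_def)
  have "row E n = 0\<^sub>v k" using nk by (intro eq_vecI) (auto simp: E_def)
  then have "E *\<^sub>v v \<noteq> unit_vec k n" if "v \<in> carrier_vec k" for v
  proof -
    have "(E *\<^sub>v v) $ n = 0" using \<open>row E n = 0\<^sub>v k\<close> nk E that by simp
    moreover have "unit_vec k n $ n = (1::complex)" using nk by simp
    ultimately show ?thesis by auto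
  qed
  moreover have "det E = 0"
  proof (rule ccontr)
    assume "det E \<noteq> 0"
    then obtain F where F: "F \<in> carrier_mat k k" "E * F = 1\<^sub>m k"
      using det_non_zero_imp_unit[OF E] unfolding Units_def ring_mat_def by auto
    have "E *\<^sub>v (F *\<^sub>v unit_vec k n) = unit_vec k n"
      using F E by (metis assoc_mult_mat_vec one_mult_mat_vec unit_vec_carrier)
    then show False using \<open>\<And>v. v \<in> carrier_vec k \<Longrightarrow> E *\<^sub>v v \<noteq> unit_vec k n\<close> F
      by (meson mult_mat_vec_carrier unit_vec_carrier)
  qed
  ultimately obtain v where v: "v \<in> carrier_vec k" "v \<noteq> 0\<^sub>v k" "E *\<^sub>v v = 0\<^sub>v k"
    using det_0_iff_vec_prod_zero[OF E] by auto
  have "C *\<^sub>v v = 0\<^sub>v n"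
  proof (rule eq_vecI)
    fix i assume "i < dim_vec (0\<^sub>v n :: complex vec)"
    then have i: "i < n" by simp
    have "row C i = row E i" using i nk C by (intro eq_vecI) (auto simp: E_def)
    then have "(C *\<^sub>v v) $ i = (E *\<^sub>v v) $ i" using i nk C E by simp
    then show "(C *\<^sub>v v) $ i = 0\<^sub>v n $ i" using v(3) i nk by simp
  qed (use C in auto)
  then show False using injective_matD[OF inj C v(1)] v(2) by simp
qed

definition append_col :: "complex mat \<Rightarrow> complex vec \<Rightarrow> complex mat" where
  "append_col C w = mat (dim_row C) (Suc (dim_col C)) (\<lambda>(i,j). if j < dim_col C then C $$ (i,j) else w $ i)"

lemma append_col_carrier: "C \<in> carrier_mat n k \<Longrightarrow> append_col C w \<in> carrier_mat n (Suc k)"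
  by (auto simp: append_col_def)

lemma append_col_mult:
  assumes "C \<in> carrier_mat n k" "w \<in> carrier_vec n" "v \<in> carrier_vec (Suc k)"
  shows "append_col C w *\<^sub>v v = C *\<^sub>v (vec k (\<lambda>j. v $ j)) + (v $ k) \<cdot>\<^sub>v w"
proof (rule eq_vecI)
  fix i assume "i < dim_vec (C *\<^sub>v (vec k (\<lambda>j. v $ j)) + (v $ k) \<cdot>\<^sub>v w)"
  then have i: "i < n" using assms by auto
  have "(append_col C w *\<^sub>v v) $ i = (\<Sum>j<Suc k. (if j < k then C $$ (i,j) else w $ i) * v $ j)"
    using assms i by (auto simp: append_col_def scalar_prod_def atLeast0LessThan intro!: sum.cong)
  also have "\<dots> = (\<Sum>j<k. C $$ (i,j) * v $ j) + w $ i * v $ k" by simp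
  finally show "(append_col C w *\<^sub>v v) $ i = (C *\<^sub>v (vec k (\<lambda>j. v $ j)) + (v $ k) \<cdot>\<^sub>v w) $ i"
    using assms i by (auto simp: scalar_prod_def atLeast0LessThan mult.commute)
qed (use assms in \<open>auto simp: append_col_def\<close>)

lemma append_col_injective:
  assumes C: "C \<in> carrier_mat n k" and w: "w \<in> carrier_vec n" and inj: "injective_mat C"
    and nr: "\<And>x. x \<in> carrier_vec k \<Longrightarrow> w \<noteq> C *\<^sub>v x"
  shows "injective_mat (append_col C w)"
  unfolding injective_mat_def
proof (intro ballI impI)
  fix v assume "v \<in> carrier_vec (dim_col (append_col C w))"
    and *: "append_col C w *\<^sub>v v = 0\<^sub>v (dim_row (append_col C w))"
  then have v: "v \<in> carrier_vec (Suc k)" using C by (auto simp: append_col_def)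
  define v' where "v' = vec k (\<lambda>j. v $ j)"
  have v': "v' \<in> carrier_vec k" by (simp add: v'_def)
  have eq: "C *\<^sub>v v' + (v $ k) \<cdot>\<^sub>v w = 0\<^sub>v n"
    using * append_col_mult[OF C w v] C by (simp add: v'_def append_col_def)
  have vk: "v $ k = 0"
  proof (rule ccontr)
    assume nz: "v $ k \<noteq> 0"
    have "w = C *\<^sub>v ((- 1 / v $ k) \<cdot>\<^sub>v v')"
    proof (rule eq_vecI)
      fix i assume "i < dim_vec (C *\<^sub>v ((- 1 / v $ k) \<cdot>\<^sub>v v'))"
      then have i: "i < n" using C by simp
      have "(C *\<^sub>v v') $ i + v $ k * w $ i = 0"
        using arg_cong[OF eq, of "\<lambda>u. u $ i"] i C w by simp
      then have "v $ k * w $ i = - (C *\<^sub>v v') $ i"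
        by (metis add.commute eq_neg_iff_add_eq_0)
      moreover have "w $ i = (v $ k * w $ i) / v $ k" using nz by simp
      ultimately have "w $ i = (- 1 / v $ k) * (C *\<^sub>v v') $ i" by simp
      moreover have "(C *\<^sub>v ((- 1 / v $ k) \<cdot>\<^sub>v v')) $ i = (- 1 / v $ k) * (C *\<^sub>v v') $ i"
        using mult_mat_vec[OF C v'] i C v' by auto
      ultimately show "w $ i = (C *\<^sub>v ((- 1 / v $ k) \<cdot>\<^sub>v v')) $ i"
        by simp
    qed (use C w in auto)
    then show False using nr v' by (metis smult_carrier_vec)
  qed
  then have "(C *\<^sub>v v') $ i = 0" if "i < n" for i
    using arg_cong[OF eq, of "\<lambda>u. u $ i"] that C w by simp
  then have "C *\<^sub>v v' = 0\<^sub>v n" using C by (intro eq_vecI) auto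
  then have "v' = 0\<^sub>v k" using injective_matD[OF inj C v'] by simp
  then have "v $ j = 0" if "j < k" for j
    using that unfolding v'_def by (metis index_vec index_zero_vec(1))
  with vk have "v = 0\<^sub>v (Suc k)" using v by (intro eq_vecI) (auto simp: less_Suc_eq)
  then show "v = 0\<^sub>v (dim_col (append_col C w))" using C by (simp add: append_col_def)
qed

lemma col_append_col:
  assumes "C \<in> carrier_mat n k" "w \<in> carrier_vec n" "j < Suc k"
  shows "col (append_col C w) j = (if j < k then col C j else w)"
  using assms by (intro eq_vecI) (auto simp: append_col_def)

text \<open>A vector of \<open>Q\<close> outside the column space could be appended as a further column, so a choice with the
largest number of columns works. The set \<open>Q\<close> is arbitrary because the lemma provides both bases of subspaces
and bases that consist of eigenvectors.\<close>

lemma exists_maximal_independent: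
  assumes Q: "Q \<subseteq> carrier_vec n"
  shows "\<exists>k C. k \<le> n \<and> C \<in> carrier_mat n k \<and> injective_mat C \<and> (\<forall>j<k. col C j \<in> Q) \<and>
    (\<forall>w\<in>Q. \<exists>x\<in>carrier_vec k. w = C *\<^sub>v x)"
proof -
  define P where "P k \<longleftrightarrow> (\<exists>C. C \<in> carrier_mat n k \<and> injective_mat C \<and> (\<forall>j<k. col C j \<in> Q))" for k
  have "P 0" unfolding P_def by (intro exI[of _ "0\<^sub>m n 0"]) (auto simp: injective_mat_def)
  moreover have bnd: "\<And>k. P k \<Longrightarrow> k \<le> n" unfolding P_def using injective_mat_dim_le by blast
  ultimately obtain k where k: "P k" "\<And>j. P j \<Longrightarrow> j \<le> k"
    using Nat.ex_has_greatest_nat[of P 0 n] by blast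
  then obtain C where C: "C \<in> carrier_mat n k" "injective_mat C" "\<forall>j<k. col C j \<in> Q"
    unfolding P_def by blast
  have "\<exists>x\<in>carrier_vec k. w = C *\<^sub>v x" if w: "w \<in> Q" for w
  proof (rule ccontr)
    assume "\<not> ?thesis"
    then have "injective_mat (append_col C w)"
      using append_col_injective[OF C(1) _ C(2)] w Q by blast
    moreover have "\<forall>j<Suc k. col (append_col C w) j \<in> Q"
      using col_append_col[OF C(1)] w Q C(3) by auto
    ultimately have "P (Suc k)" unfolding P_def using append_col_carrier[OF C(1)] by blast
    then show False using k(2) by fastforce
  qed
  then show ?thesis using C bnd[OF k(1)] by blast
qed

lemma square_injective_mat_inverse:
  assumes C: "C \<in> carrier_mat n n" and "injective_mat C"
  shows "\<exists>D\<in>carrier_mat n n. C * D = 1\<^sub>m n \<and> D * C = 1\<^sub>m n"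
proof -
  have "det C \<noteq> 0"
    using det_0_iff_vec_prod_zero[OF C] injective_matD[OF assms(2) C] by auto
  then show ?thesis
    using det_non_zero_imp_unit[OF C] unfolding Units_def ring_mat_def by auto
qed

lemma surjective_mat_dim_le:
  assumes C: "(C :: complex mat) \<in> carrier_mat n k"
    and surj: "\<And>w. w \<in> carrier_vec n \<Longrightarrow> \<exists>x\<in>carrier_vec k. w = C *\<^sub>v x"
  shows "n \<le> k"
proof -
  have "\<forall>i. \<exists>x\<in>carrier_vec k. unit_vec n i = C *\<^sub>v x" using surj by auto
  then obtain x where x: "\<And>i. x i \<in> carrier_vec k" "\<And>i. unit_vec n i = C *\<^sub>v x i" by metis
  define E where "E = mat k n (\<lambda>(i,j). x j $ i)"
  have E: "E \<in> carrier_mat k n" by (simp add: E_def)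
  have "C * E = 1\<^sub>m n"
  proof (rule eq_matI)
    fix i j assume "i < dim_row (1\<^sub>m n :: complex mat)" "j < dim_col (1\<^sub>m n :: complex mat)"
    then have ij: "i < n" "j < n" by auto
    have "col E j = x j" using ij x(1)[of j] by (intro eq_vecI) (auto simp: E_def)
    then have "(C * E) $$ (i,j) = (C *\<^sub>v x j) $ i" using ij C E by auto
    also have "\<dots> = unit_vec n j $ i" using x(2) by metis
    finally show "(C * E) $$ (i,j) = 1\<^sub>m n $$ (i,j)" using ij by auto
  qed (use C E in auto)
  moreover have "injective_mat (1\<^sub>m n)" by (auto simp: injective_mat_def)
  ultimately have "injective_mat E" using injective_mat_left_factor[OF _ C E] by simp
  then show ?thesis using injective_mat_dim_le[OF E] by blast
qed

lemma mat_factor_through_columns: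
  assumes C: "(C :: complex mat) \<in> carrier_mat n k" and D: "D \<in> carrier_mat n m"
    and cols: "\<And>j. j < m \<Longrightarrow> \<exists>x\<in>carrier_vec k. col D j = C *\<^sub>v x"
  shows "\<exists>E\<in>carrier_mat k m. D = C * E"
proof -
  have "\<forall>j. \<exists>x. j < m \<longrightarrow> x\<in>carrier_vec k \<and> col D j = C *\<^sub>v x" using cols by blast
  then obtain x where x: "\<And>j. j < m \<Longrightarrow> x j \<in> carrier_vec k" "\<And>j. j < m \<Longrightarrow> col D j = C *\<^sub>v x j" by metis
  define E where "E = mat k m (\<lambda>(i,j). x j $ i)"
  have E: "E \<in> carrier_mat k m" by (simp add: E_def)
  have "D = C * E"
  proof (rule eq_matI)
    fix i j assume "i < dim_row (C * E)" "j < dim_col (C * E)"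
    then have ij: "i < n" "j < m" using C E by auto
    have "col E j = x j" using ij x(1)[of j] by (intro eq_vecI) (auto simp: E_def)
    then have "(C * E) $$ (i,j) = (C *\<^sub>v x j) $ i" using ij C E by auto
    also have "\<dots> = col D j $ i" using x(2) ij by metis
    finally show "D $$ (i,j) = (C * E) $$ (i,j)" using ij D by auto
  qed (use C D E in auto)
  then show ?thesis using E by blast
qed

section \<open>Traces and eigenbases\<close>

lemma mat_trace_mult_comm:
  assumes "A \<in> carrier_mat n m" "B \<in> carrier_mat m n"
  shows "mat_trace (A * B) = mat_trace (B * A)"
proof -
  have "mat_trace (A * B) = (\<Sum>i<n. \<Sum>j<m. A $$ (i,j) * B $$ (j,i))"
    using assms by (auto simp: mat_trace_def scalar_prod_def atLeast0LessThan intro!: sum.cong)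
  also have "\<dots> = (\<Sum>j<m. \<Sum>i<n. B $$ (j,i) * A $$ (i,j))"
    by (subst sum.swap) (simp add: mult.commute)
  also have "\<dots> = mat_trace (B * A)"
    using assms by (auto simp: mat_trace_def scalar_prod_def atLeast0LessThan intro!: sum.cong)
  finally show ?thesis .
qed

lemma mat_trace_eigenbasis:
  assumes M: "M \<in> carrier_mat n n" and P: "P \<in> carrier_mat n n" "injective_mat P"
    and e: "\<And>j. j < n \<Longrightarrow> M *\<^sub>v col P j = e j \<cdot>\<^sub>v col P j"
  shows "mat_trace M = (\<Sum>j<n. e j)"
proof -
  obtain D where D: "D \<in> carrier_mat n n" "P * D = 1\<^sub>m n" "D * P = 1\<^sub>m n"
    using square_injective_mat_inverse[OF P] by blast
  define E where "E = mat n n (\<lambda>(i,j). if i = j then e j else 0)"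
  have E: "E \<in> carrier_mat n n" by (simp add: E_def)
  have "M * P = P * E"
  proof (rule eq_matI)
    fix i j assume "i < dim_row (P * E)" "j < dim_col (P * E)"
    then have ij: "i < n" "j < n" using P E by auto
    have "(P * E) $$ (i,j) = (\<Sum>k<n. P $$ (i,k) * (if k = j then e j else 0))"
      using ij P E by (auto simp: E_def scalar_prod_def atLeast0LessThan intro!: sum.cong)
    also have "\<dots> = P $$ (i,j) * e j" using ij by (simp add: if_distrib cong: if_cong)
    also have "\<dots> = (M *\<^sub>v col P j) $ i" using e[OF ij(2)] ij P by (simp add: mult.commute)
    also have "\<dots> = (M * P) $$ (i,j)" using ij M P by simp
    finally show "(M * P) $$ (i,j) = (P * E) $$ (i,j)" by simp
  qed (use M P E in auto)
  then have "D * (M * P) = E"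
    using D P E by (metis assoc_mult_mat left_mult_one_mat)
  moreover have "mat_trace (D * (M * P)) = mat_trace (M * P * D)"
    using M P D by (intro mat_trace_mult_comm) auto
  moreover have "M * P * D = M" using M P D by (metis assoc_mult_mat right_mult_one_mat)
  ultimately have "mat_trace M = mat_trace E" by simp
  also have "\<dots> = (\<Sum>j<n. e j)" by (auto simp: mat_trace_def E_def intro!: sum.cong)
  finally show ?thesis .
qed

section \<open>Roots of unity of prime power order\<close>

lemma exists_primitive_root_of_unity:
  assumes "N > 0"
  obtains \<omega> :: complex where "\<omega> ^ N = 1" "\<And>i. 0 < i \<Longrightarrow> i < N \<Longrightarrow> \<omega> ^ i \<noteq> 1"
    "\<And>x. x ^ N = 1 \<Longrightarrow> \<exists>j<N. x = \<omega> ^ j"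
proof -
  define \<omega> where "\<omega> = cis (2 * pi / N)"
  have pw: "\<omega> ^ i = cis (2 * pi * real i / real N)" for i
    unfolding \<omega>_def by (simp add: DeMoivre mult.commute)
  have b: "bij_betw (\<lambda>k. \<omega> ^ k) {..<N} {z. z ^ N = 1}"
    using bij_betw_roots_unity[OF assms] by (simp add: pw)
  have "\<omega> ^ N = 1" using assms pw[of N] by simp
  moreover have "\<omega> ^ i \<noteq> 1" if "0 < i" "i < N" for i
  proof
    assume "\<omega> ^ i = 1"
    then have "i = 0" using b that assms
      by (auto simp: bij_betw_def inj_on_def dest!: bspec[where x = i] bspec[where x = 0])
    then show False using that by simp
  qed
  moreover have "\<exists>j<N. x = \<omega> ^ j" if "x ^ N = 1" for x
    using b that by (auto simp: bij_betw_def image_def set_eq_iff)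
  ultimately show thesis by (rule that)
qed

lemma root_of_unity_power_sum:
  fixes x :: complex
  assumes "x ^ N = 1"
  shows "(\<Sum>j<N. x ^ j) = (if x = 1 then of_nat N else 0)"
  using assms geometric_sum[of x N] by auto

lemma root_of_unity_power_mod:
  assumes "(x :: complex) ^ N = 1"
  shows "x ^ (k mod N) = x ^ k"
  by (metis (no_types, lifting) assms div_mult_mod_eq mult.commute mult_1 power_add power_mult power_one)

lemma root_of_unity_norm:
  assumes "(x :: complex) ^ N = 1" "N > 0"
  shows "cmod x = 1"
  using assms by (metis norm_one norm_power power_eq_1_iff norm_ge_zero not_gr_zero)

lemma sum_unit_complex_eq_card:
  fixes e :: "'a \<Rightarrow> complex"
  assumes "finite S" "\<And>j. j \<in> S \<Longrightarrow> cmod (e j) = 1" "(\<Sum>j\<in>S. e j) = of_nat (card S)" "j \<in> S"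
  shows "e j = 1"
proof -
  have le: "Re (e j) \<le> 1" if "j \<in> S" for j using assms(2)[OF that] complex_Re_le_cmod[of "e j"] by simp
  have "(\<Sum>j\<in>S. 1 - Re (e j)) = 0"
    using arg_cong[OF assms(3), of Re] by (simp add: sum_subtractf)
  then have "1 - Re (e j) = 0"
    using sum_nonneg_eq_0_iff[OF assms(1), of "\<lambda>j. 1 - Re (e j)"] le assms(4) by auto
  then have "Re (e j) = 1" by simp
  moreover have "Im (e j) = 0" using assms(2)[OF assms(4)] \<open>Re (e j) = 1\<close>
    by (simp add: cmod_def)
  ultimately show ?thesis by (simp add: complex_eq_iff)
qed

lemma power_eq_1_coprime:
  fixes w :: complex
  assumes "w ^ p = 1" "w ^ s = 1" "coprime s p"
  shows "w = 1"
proof -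
  obtain c where c: "[s * c = 1] (mod p)" using cong_solve_coprime_nat[OF assms(3)] by auto
  have pm: "w ^ (k mod p) = w ^ k" for k
    by (rule root_of_unity_power_mod[OF assms(1)])
  have "w = w ^ 1" by simp
  also have "\<dots> = w ^ (s * c)" using pm[of 1] pm[of "s * c"] c by (simp add: cong_def)
  also have "\<dots> = 1" using assms(2) by (simp add: power_mult)
  finally show ?thesis .
qed

text \<open>The hypotheses say that the order of \<open>w\<close> divides \<open>p^f\<close> but not \<open>p^(f-1)\<close>; a power of \<open>p\<close> with
this property is \<open>p^f\<close> itself.\<close>

lemma primitive_prime_power_root:
  fixes w :: complex
  assumes p: "prime p" and f: "0 < f" and w: "w ^ (p ^ f) = 1" "w ^ (p ^ (f - 1)) \<noteq> 1"
  shows "w ^ d = 1 \<longleftrightarrow> p ^ f dvd d"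
proof
  assume d: "w ^ d = 1"
  show "p ^ f dvd d"
  proof (rule ccontr)
    assume nd: "\<not> p ^ f dvd d"
    then have "d \<noteq> 0" by (metis dvd_0_right)
    define t where "t = multiplicity p d"
    obtain b where b: "d = p ^ t * b" "\<not> p dvd b"
      using multiplicity_decompose'[of d p] \<open>d \<noteq> 0\<close> prime_gt_1_nat[OF p] unfolding t_def
      by (metis nat_dvd_1_iff_1 nat_neq_iff)
    have tf: "t < f" using nd b(1) by (metis dvd_mult2 le_imp_power_dvd not_less)
    have e: "p ^ (f - 1) * b = d * p ^ (f - 1 - t)"
      using tf b(1) by (simp add: power_add[symmetric] mult.commute mult.left_commute)
    have "(w ^ (p ^ (f - 1))) ^ b = 1"
      using d by (simp only: power_mult[symmetric] e) (simp add: power_mult)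
    moreover have "(w ^ (p ^ (f - 1))) ^ p = 1"
      using w(1) f by (simp only: power_mult[symmetric] power_Suc2[symmetric] Suc_diff_1)
    moreover have "coprime b p" using b(2) p by (metis coprime_commute prime_imp_coprime_nat)
    ultimately show False using power_eq_1_coprime w(2) by blast
  qed
next
  assume "p ^ f dvd d"
  then show "w ^ d = 1" using w(1) by (auto simp: dvd_def power_mult)
qed

lemma primitive_prime_power_root_inj:
  fixes w :: complex
  assumes p: "prime p" "0 < f" "w ^ (p ^ f) = 1" "w ^ (p ^ (f - 1)) \<noteq> 1"
  shows "inj_on (\<lambda>s. w ^ s) {..<p ^ f}"
proof (rule linorder_inj_onI)
  fix i j assume ij: "i < j" "i \<in> {..<p ^ f}" "j \<in> {..<p ^ f}"
  have w0: "w \<noteq> 0" using p(3) prime_gt_0_nat[OF p(1)] by (metis power_0_left power_not_zero zero_neq_one not_gr_zero)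
  show "w ^ i \<noteq> w ^ j"
  proof
    assume "w ^ i = w ^ j"
    also have "w ^ j = w ^ i * w ^ (j - i)" using ij(1) by (simp add: power_add[symmetric])
    finally have "w ^ (j - i) = 1" using w0 by simp
    then have "p ^ f dvd j - i" using primitive_prime_power_root[OF p] by simp
    then have "p ^ f \<le> j - i" using ij(1) by (intro dvd_imp_le) auto
    then show False using ij by simp
  qed
qed auto

definition prime_power_units :: "nat \<Rightarrow> nat \<Rightarrow> nat set" where
  "prime_power_units p k = {s. s < p ^ k \<and> coprime s p}"

text \<open>The exponents below \<open>p^f\<close> that are not prime to \<open>p\<close> are the multiples of \<open>p\<close>, so the sum is the
difference of two complete geometric sums, one in \<open>w\<close> and one in \<open>w^p\<close>.\<close>

lemma ramanujan_sum_prime_power: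
  fixes w :: complex
  assumes p: "prime p" and f: "0 < f" and w: "w ^ (p ^ f) = 1"
  shows "(\<Sum>s\<in>prime_power_units p f. w ^ s) =
    (if w = 1 then of_nat (p ^ f) else 0) - (if w ^ p = 1 then of_nat (p ^ (f - 1)) else 0)"
proof -
  have p0: "p > 0" using prime_gt_0_nat[OF p] .
  have cop: "coprime s p \<longleftrightarrow> \<not> p dvd s" for s
    using p by (metis coprime_commute coprime_absorb_left prime_imp_coprime_nat not_prime_unit)
  have pf: "p ^ f = p * p ^ (f - 1)" using f by (metis Suc_diff_1 power_Suc)
  have eq: "{..<p ^ f} = prime_power_units p f \<union> (\<lambda>j. p * j) ` {..<p ^ (f - 1)}"
  proof (intro equalityI subsetI)
    fix s assume s: "s \<in> {..<p ^ f}"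
    show "s \<in> prime_power_units p f \<union> (\<lambda>j. p * j) ` {..<p ^ (f - 1)}"
    proof (cases "p dvd s")
      case True
      then obtain j where "s = p * j" by (auto simp: dvd_def)
      then show ?thesis using s pf p0 by auto
    qed (use s cop in \<open>auto simp: prime_power_units_def\<close>)
  qed (use pf p0 in \<open>auto simp: prime_power_units_def\<close>)
  have "(\<Sum>s<p ^ f. w ^ s) = (\<Sum>s\<in>prime_power_units p f. w ^ s) + (\<Sum>s\<in>(\<lambda>j. p * j) ` {..<p ^ (f - 1)}. w ^ s)"
    unfolding eq by (rule sum.union_disjoint) (auto simp: prime_power_units_def cop)
  also have "(\<Sum>s\<in>(\<lambda>j. p * j) ` {..<p ^ (f - 1)}. w ^ s) = (\<Sum>j<p ^ (f - 1). (w ^ p) ^ j)"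
    using p0 by (subst sum.reindex) (auto simp: inj_on_def power_mult)
  also have "\<dots> = (if w ^ p = 1 then of_nat (p ^ (f - 1)) else 0)"
    using w pf by (intro root_of_unity_power_sum) (simp add: power_mult[symmetric])
  finally show ?thesis using root_of_unity_power_sum[OF w] by simp
qed

lemma card_prime_power_units:
  assumes p: "prime p" and f: "0 < f"
  shows "card (prime_power_units p f) = p ^ (f - 1) * (p - 1)" "finite (prime_power_units p f)"
proof -
  show "finite (prime_power_units p f)" by (simp add: prime_power_units_def)
  have le: "p ^ (f - 1) \<le> p ^ f" using prime_gt_1_nat[OF p] by (intro power_increasing) auto
  have "(of_nat (card (prime_power_units p f)) :: complex) = of_nat (p ^ f) - of_nat (p ^ (f - 1))"
    using ramanujan_sum_prime_power[OF p f, of 1] by simp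
  then have "(of_nat (card (prime_power_units p f)) :: complex) = of_nat (p ^ f - p ^ (f - 1))"
    using le by (simp add: of_nat_diff)
  then have "card (prime_power_units p f) = p ^ f - p ^ (f - 1)" by (simp only: of_nat_eq_iff)
  also have "p ^ f = p ^ (f - 1) * p" using f by (metis Suc_diff_1 power_Suc2)
  also have "p ^ (f - 1) * p - p ^ (f - 1) = p ^ (f - 1) * (p - 1)" by (simp add: diff_mult_distrib2)
  finally show "card (prime_power_units p f) = p ^ (f - 1) * (p - 1)" .
qed

section \<open>Galois invariance of integral sums of roots of unity\<close>

lemma integer_matrix_eigenvalue_algebraic_int:
  fixes M :: "int mat" and x :: complex
  assumes M: "M \<in> carrier_mat n n" and v: "v \<in> carrier_vec n" "v \<noteq> 0\<^sub>v n"
    and ev: "map_mat of_int M *\<^sub>v v = x \<cdot>\<^sub>v v"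
  shows "algebraic_int x"
proof -
  have Mc: "map_mat of_int M \<in> carrier_mat n n" using M by simp
  have "eigenvalue (map_mat of_int M) x"
    unfolding eigenvalue_def eigenvector_def using Mc v ev by auto
  then have "poly (char_poly (map_mat of_int M)) x = 0"
    by (rule iffD1[OF eigenvalue_root_char_poly[OF Mc]])
  then have "poly (map_poly of_int (char_poly M)) x = 0"
    by (simp add: of_int_hom.char_poly_hom[OF M])
  moreover have "lead_coeff (char_poly M) = 1" using degree_monic_char_poly[OF M] by simp
  ultimately show ?thesis by (auto simp: algebraic_int_altdef_ipoly)
qed

text \<open>Multiplication by \<open>f(\<zeta>)\<close> acts on the powers \<open>1, \<zeta>, \<dots>, \<zeta>^(N-1)\<close> through the circulant matrix built from
the coefficients of \<open>f\<close>, so \<open>f(\<zeta>)\<close> is an eigenvalue of an integral matrix.\<close>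

lemma integer_poly_root_of_unity_algebraic_int:
  fixes \<zeta> :: complex and f :: "int poly"
  assumes N: "N > 0" and z: "\<zeta> ^ N = 1"
  shows "algebraic_int (poly (map_poly of_int f) \<zeta>)"
proof (rule integer_matrix_eigenvalue_algebraic_int)
  define M where "M = mat N N (\<lambda>(i,j). \<Sum>k | k \<le> Polynomial.degree f \<and> (k + i) mod N = j. Polynomial.coeff f k)"
  show "M \<in> carrier_mat N N" by (simp add: M_def)
  define v where "v = vec N (\<lambda>i. \<zeta> ^ i)"
  show "v \<in> carrier_vec N" by (simp add: v_def)
  have "v $ 0 = 1" using N by (simp add: v_def)
  then show "v \<noteq> 0\<^sub>v N" using N by auto
  have zm: "\<zeta> ^ (m mod N) = \<zeta> ^ m" for m
    by (rule root_of_unity_power_mod[OF z])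
  show "map_mat of_int M *\<^sub>v v = poly (map_poly of_int f) \<zeta> \<cdot>\<^sub>v v"
  proof (rule eq_vecI)
    fix i assume "i < dim_vec (poly (map_poly of_int f) \<zeta> \<cdot>\<^sub>v v)"
    then have i: "i < N" by (simp add: v_def)
    have "(map_mat of_int M *\<^sub>v v) $ i =
      (\<Sum>j<N. \<Sum>k\<in>{k\<in>{..Polynomial.degree f}. (k + i) mod N = j}. of_int (Polynomial.coeff f k) * \<zeta> ^ ((k + i) mod N))"
      using i by (auto simp: M_def v_def scalar_prod_def atLeast0LessThan sum_distrib_right intro!: sum.cong)
    also have "\<dots> = (\<Sum>k\<le>Polynomial.degree f. of_int (Polynomial.coeff f k) * \<zeta> ^ ((k + i) mod N))"
      using N by (intro sum.group) auto
    also have "\<dots> = (\<Sum>k\<le>Polynomial.degree f. of_int (Polynomial.coeff f k) * \<zeta> ^ k) * \<zeta> ^ i"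
      by (simp only: zm power_add sum_distrib_right mult.assoc)
    also have "(\<Sum>k\<le>Polynomial.degree f. of_int (Polynomial.coeff f k) * \<zeta> ^ k) = poly (map_poly of_int f) \<zeta>"
      by (simp add: poly_altdef)
    finally show "(map_mat of_int M *\<^sub>v v) $ i = (poly (map_poly of_int f) \<zeta> \<cdot>\<^sub>v v) $ i"
      using i by (simp add: v_def)
  qed (simp add: M_def v_def)
qed

lemma prime_dvd_binomial_power:
  fixes x y :: "'a :: comm_ring_1"
  assumes q: "prime q"
  shows "of_nat q dvd (x + y) ^ q - x ^ q - y ^ q"
proof -
  have q2: "q \<ge> 2" using q prime_ge_2_nat by blast
  have "(x + y) ^ q = (\<Sum>k\<le>q. of_nat (q choose k) * x ^ k * y ^ (q - k))" by (rule binomial_ring)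
  also have "{..q} = insert 0 (insert q {0<..<q})" using q2 by auto
  also have "(\<Sum>k\<in>\<dots>. of_nat (q choose k) * x ^ k * y ^ (q - k)) =
      y ^ q + x ^ q + (\<Sum>k\<in>{0<..<q}. of_nat (q choose k) * x ^ k * y ^ (q - k))"
    using q2 by simp
  finally have "(x + y) ^ q - x ^ q - y ^ q = (\<Sum>k\<in>{0<..<q}. of_nat (q choose k) * x ^ k * y ^ (q - k))"
    by (simp add: algebra_simps)
  also have "of_nat q dvd \<dots>"
  proof (rule dvd_sum)
    fix k assume "k \<in> {0<..<q}"
    then have "q dvd (q choose k)" using q by (intro dvd_choose_prime) auto
    then have "(of_nat q :: 'a) dvd of_nat (q choose k)" by (metis dvd_def of_nat_mult)
    then show "of_nat q dvd of_nat (q choose k) * x ^ k * y ^ (q - k)" by (simp add: dvd_mult2)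
  qed
  finally show ?thesis .
qed

text \<open>The Frobenius congruence is stated as a divisibility in an arbitrary commutative ring in order to apply it
to polynomials over the integers.\<close>

lemma prime_dvd_sum_power:
  fixes x :: "'b \<Rightarrow> 'a :: comm_ring_1"
  assumes q: "prime q" and "finite S"
  shows "of_nat q dvd (\<Sum>i\<in>S. x i) ^ q - (\<Sum>i\<in>S. x i ^ q)"
  using assms(2)
proof (induction S rule: finite_induct)
  case empty
  then show ?case using prime_gt_0_nat[OF q] by (simp add: zero_power)
next
  case (insert i S)
  have "of_nat q dvd ((x i + (\<Sum>i\<in>S. x i)) ^ q - x i ^ q - (\<Sum>i\<in>S. x i) ^ q)
      + ((\<Sum>i\<in>S. x i) ^ q - (\<Sum>i\<in>S. x i ^ q))"
    using prime_dvd_binomial_power[OF q] insert.IH by (rule dvd_add)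
  then show ?case using insert.hyps by (simp add: algebra_simps)
qed

text \<open>Write \<open>\<chi> i = \<zeta>^(e i)\<close>. The polynomials \<open>(\<Sum>i. X^(e i))^q\<close> and \<open>\<Sum>i. X^(q e i)\<close> agree modulo \<open>q\<close>, so their values
\<open>k^q\<close> and \<open>l\<close> at \<open>\<zeta>\<close> differ by \<open>q\<close> times an algebraic integer. That algebraic integer is rational, hence
an integer.\<close>

lemma integral_power_sums_frobenius:
  fixes \<chi> :: "'b \<Rightarrow> complex"
  assumes S: "finite S" and N: "N > 0" and \<chi>: "\<And>i. i \<in> S \<Longrightarrow> \<chi> i ^ N = 1"
    and q: "prime q" and k: "(\<Sum>i\<in>S. \<chi> i) = of_int k" and l: "(\<Sum>i\<in>S. \<chi> i ^ q) = of_int l"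
  shows "int q dvd k ^ q - l"
proof -
  obtain \<zeta> :: complex where z: "\<zeta> ^ N = 1" and roots: "\<And>x. x ^ N = 1 \<Longrightarrow> \<exists>j<N. x = \<zeta> ^ j"
    using exists_primitive_root_of_unity[OF N] by metis
  have "\<exists>e. \<chi> i = \<zeta> ^ e" if "i \<in> S" for i using roots[OF \<chi>[OF that]] by blast
  then obtain e where e: "\<And>i. i \<in> S \<Longrightarrow> \<chi> i = \<zeta> ^ e i" by metis
  interpret h: comm_ring_hom "\<lambda>f. poly (map_poly of_int f) \<zeta> :: complex"
    by unfold_locales (auto simp: of_int_poly_hom.hom_mult of_int_poly_hom.hom_add)
  define x :: "'b \<Rightarrow> int poly" where "x i = Polynomial.monom 1 (e i)" for i
  have ev: "poly (map_poly of_int (x i)) \<zeta> = \<chi> i" if "i \<in> S" for i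
    using e[OF that] by (simp add: x_def map_poly_monom poly_monom)
  obtain f where f: "(\<Sum>i\<in>S. x i) ^ q - (\<Sum>i\<in>S. x i ^ q) = of_nat q * f"
    using prime_dvd_sum_power[OF q S, of x] by (auto simp: dvd_def)
  have "of_int (k ^ q - l) = of_nat q * poly (map_poly of_int f) \<zeta>"
    using arg_cong[OF f, of "\<lambda>f. poly (map_poly of_int f) \<zeta>"] ev k l
    by (simp add: h.hom_minus h.hom_power h.hom_sum h.hom_mult h.hom_of_nat del: of_int_diff of_int_power) simp
  then have fz: "poly (map_poly of_int f) \<zeta> = of_int (k ^ q - l) / of_nat q"
    using prime_gt_0_nat[OF q] by (simp add: field_simps)
  then have "poly (map_poly of_int f) \<zeta> \<in> \<rat>" by simp
  then have "poly (map_poly of_int f) \<zeta> \<in> \<int>"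
    using rational_algebraic_int_is_int integer_poly_root_of_unity_algebraic_int[OF N z] by blast
  then obtain m where "of_int (k ^ q - l) / of_nat q = (of_int m :: complex)" using fz by (auto elim: Ints_cases)
  then have "of_int (k ^ q - l) = (of_int (m * int q) :: complex)"
    using prime_gt_0_nat[OF q] by (simp add: field_simps)
  then have "k ^ q - l = m * int q" by (simp only: of_int_eq_iff)
  then show ?thesis by simp
qed

text \<open>Both sums are congruent modulo \<open>q\<close> by the Frobenius congruence and Fermat's theorem, and they lie between
\<open>0\<close> and \<open>card S\<close>.\<close>

lemma integral_power_sums_large_prime:
  fixes \<chi> :: "'b \<Rightarrow> complex"
  assumes S: "finite S" and N: "N > 0" and \<chi>: "\<And>i. i \<in> S \<Longrightarrow> \<chi> i ^ N = 1"
    and int: "\<And>j. (\<Sum>i\<in>S. \<chi> i ^ j) \<in> \<nat>" and q: "prime q" "q > 2 * card S"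
  shows "(\<Sum>i\<in>S. \<chi> i ^ q) = (\<Sum>i\<in>S. \<chi> i)"
proof -
  obtain k l where kn: "(\<Sum>i\<in>S. \<chi> i) = of_nat k" and ln: "(\<Sum>i\<in>S. \<chi> i ^ q) = of_nat l"
    using int[of 1] int[of q] by (auto elim!: Nats_cases)
  have n1: "cmod (\<chi> i) = 1" if "i \<in> S" for i
    using root_of_unity_norm[OF \<chi>[OF that] N] .
  have "cmod (of_nat k) \<le> (\<Sum>i\<in>S. 1)" unfolding kn[symmetric] using n1 by (intro sum_norm_le) auto
  then have kb: "k \<le> card S" by simp
  have "cmod (of_nat l) \<le> (\<Sum>i\<in>S. 1)" unfolding ln[symmetric] using n1 by (intro sum_norm_le) (auto simp: norm_power)
  then have lb: "l \<le> card S" by simp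
  have "of_nat q dvd (\<Sum>i<k. 1 :: int) ^ q - (\<Sum>i<k. 1 ^ q)"
    by (rule prime_dvd_sum_power[OF q(1)]) simp
  then have "int q dvd int k ^ q - int k" by simp
  moreover have "int q dvd int k ^ q - int l"
    using integral_power_sums_frobenius[OF S N \<chi> q(1), where k = "int k" and l = "int l"] kn ln by simp
  ultimately have "int q dvd (int k ^ q - int l) - (int k ^ q - int k)" by (rule dvd_diff[rotated])
  then have "int q dvd int k - int l" by simp
  moreover have "\<bar>int k - int l\<bar> < int q" using kb lb q(2) by linarith
  ultimately have "k = l" using dvd_imp_le_int[of "int k - int l" "int q"] by fastforce
  then show ?thesis using kn ln by simp
qed

text \<open>Dirichlet's theorem would give a large prime in the residue class of \<open>s\<close>. A product of large primes is
sufficient for what follows, and it is found by elementary means.\<close>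

lemma coprime_representative_large_primes:
  fixes s N B :: nat
  assumes "coprime s N"
  obtains t where "[t = s] (mod N)" "t > 0" "\<And>q. prime q \<Longrightarrow> q dvd t \<Longrightarrow> q > B"
proof -
  \<comment> \<open>\<open>D\<close> is chosen such that every prime up to \<open>B\<close> divides at most one of \<open>s\<close> and \<open>N * D\<close>, and every one that does not divide \<open>s\<close> divides \<open>D\<close>.\<close>
  define D where "D = (\<Prod>q | prime q \<and> q \<le> B \<and> \<not> q dvd s. q)"
  have fin: "finite {q. prime q \<and> q \<le> B \<and> \<not> q dvd s}" by simp
  define t where "t = s + N * D"
  have "[t = s] (mod N)" by (simp add: t_def cong_def)
  moreover have Dpos: "D > 0" unfolding D_def by (intro prod_pos) (auto dest: prime_gt_0_nat)
  moreover have "t > 0"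
  proof (cases "s = 0")
    case True
    then have "N = 1" using assms by simp
    then show ?thesis using Dpos by (simp add: t_def)
  qed (simp add: t_def)
  moreover have "q > B" if q: "prime q" "q dvd t" for q
  proof (rule ccontr)
    assume "\<not> q > B"
    then have qB: "q \<le> B" by simp
    show False
    proof (cases "q dvd s")
      case True
      then have "q dvd N * D" using q(2) by (simp add: t_def dvd_add_right_iff)
      moreover have "\<not> q dvd N" using True assms q(1) by (metis coprime_common_divisor_nat not_prime_1)
      ultimately have "q dvd D" using q(1) prime_dvd_mult_iff by blast
      then obtain r where "prime r" "\<not> r dvd s" "q dvd r"
        unfolding D_def using q(1) fin by (auto simp: prime_dvd_prod_iff)
      then show False using True q(1) primes_dvd_imp_eq by blast
    next
      case False
      then have "q dvd D" unfolding D_def using q(1) qB fin by (intro dvd_prodI) auto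
      then have "q dvd s" using q(2) by (metis dvd_add_left_iff dvd_mult t_def)
      then show False using False by simp
    qed
  qed
  ultimately show thesis using that by blast
qed

text \<open>Galois theory would obtain this from the automorphism \<open>\<zeta> \<mapsto> \<zeta>^s\<close> of the cyclotomic field. Here \<open>s\<close> is
replaced by a product of large primes in its residue class, and these are treated one at a time.\<close>

lemma integral_power_sums_coprime:
  fixes \<chi> :: "'b \<Rightarrow> complex"
  assumes S: "finite S" and N: "N > 0" and \<chi>: "\<And>i. i \<in> S \<Longrightarrow> \<chi> i ^ N = 1"
    and int: "\<And>j. (\<Sum>i\<in>S. \<chi> i ^ j) \<in> \<nat>" and s: "coprime s N"
  shows "(\<Sum>i\<in>S. \<chi> i ^ s) = (\<Sum>i\<in>S. \<chi> i)"
proof -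
  obtain t where t: "[t = s] (mod N)" "t > 0" "\<And>q. prime q \<Longrightarrow> q dvd t \<Longrightarrow> q > 2 * card S"
    using coprime_representative_large_primes[OF s] by blast
  have large: "(\<Sum>i\<in>S. \<psi> i ^ u) = (\<Sum>i\<in>S. \<psi> i)"
    if "u > 0" "\<And>q. prime q \<Longrightarrow> q dvd u \<Longrightarrow> q > 2 * card S"
      "\<And>i. i \<in> S \<Longrightarrow> \<psi> i ^ N = 1" "\<And>j. (\<Sum>i\<in>S. \<psi> i ^ j) \<in> \<nat>" for u and \<psi> :: "'b \<Rightarrow> complex"
    using that
  proof (induction u arbitrary: \<psi> rule: prime_divisors_induct)
    case zero
    then show ?case by simp
  next
    case (unit u)
    then show ?case by simp
  next
    case (factor q u)
    have "(\<Sum>i\<in>S. \<psi> i ^ (q * u)) = (\<Sum>i\<in>S. (\<psi> i ^ q) ^ u)" by (simp add: power_mult)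
    also have "\<dots> = (\<Sum>i\<in>S. \<psi> i ^ q)"
    proof (rule factor.IH)
      show "u > 0" using factor.prems by simp
      show "(\<psi> i ^ q) ^ N = 1" if "i \<in> S" for i
        using factor.prems(3)[OF that] by (metis mult.commute power_mult power_one)
      show "(\<Sum>i\<in>S. (\<psi> i ^ q) ^ j) \<in> \<nat>" for j
        using factor.prems(4)[of "q * j"] by (simp add: power_mult)
    qed (use factor.prems in auto)
    also have "\<dots> = (\<Sum>i\<in>S. \<psi> i)"
      using factor by (intro integral_power_sums_large_prime[OF S N]) auto
    finally show ?case .
  qed
  have pm: "\<chi> i ^ (m mod N) = \<chi> i ^ m" if "i \<in> S" for m i
    by (rule root_of_unity_power_mod[OF \<chi>[OF that]])
  have "\<chi> i ^ s = \<chi> i ^ t" if "i \<in> S" for i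
    using pm[OF that, of s] pm[OF that, of t] t(1) by (simp add: cong_def)
  then have "(\<Sum>i\<in>S. \<chi> i ^ s) = (\<Sum>i\<in>S. \<chi> i ^ t)" by simp
  also have "\<dots> = (\<Sum>i\<in>S. \<chi> i)" using t \<chi> int by (intro large) auto
  finally show ?thesis .
qed

section \<open>Simultaneous diagonalization of commuting matrices of finite order\<close>

text \<open>The closure conditions are written out for \<open>\<complex>\<^sup>n\<close>; \<open>linear_subspace_iff_subspace\<close> identifies them with the notion
of subspace that defines irreducibility.\<close>

definition linear_subspace :: "nat \<Rightarrow> complex vec set \<Rightarrow> bool" where
  "linear_subspace n W \<longleftrightarrow> W \<subseteq> carrier_vec n \<and> 0\<^sub>v n \<in> W \<and>
     (\<forall>x\<in>W. \<forall>y\<in>W. x + y \<in> W) \<and> (\<forall>c. \<forall>x\<in>W. c \<cdot>\<^sub>v x \<in> W)"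

lemma linear_subspace_range:
  assumes "C \<in> carrier_mat n k"
  shows "linear_subspace n {C *\<^sub>v x |x. x \<in> carrier_vec k}"
  unfolding linear_subspace_def
proof (intro conjI ballI allI)
  show "0\<^sub>v n \<in> {C *\<^sub>v x |x. x \<in> carrier_vec k}"
    using assms by (auto intro!: exI[of _ "0\<^sub>v k"])
next
  fix x y assume "x \<in> {C *\<^sub>v x |x. x \<in> carrier_vec k}" "y \<in> {C *\<^sub>v x |x. x \<in> carrier_vec k}"
  then obtain a b where "a \<in> carrier_vec k" "b \<in> carrier_vec k" "x = C *\<^sub>v a" "y = C *\<^sub>v b" by auto
  then show "x + y \<in> {C *\<^sub>v x |x. x \<in> carrier_vec k}"
    using assms mult_add_distrib_mat_vec[OF assms, of a b] by (auto intro!: exI[of _ "a + b"])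
next
  fix c x assume "x \<in> {C *\<^sub>v x |x. x \<in> carrier_vec k}"
  then obtain a where "a \<in> carrier_vec k" "x = C *\<^sub>v a" by auto
  then show "c \<cdot>\<^sub>v x \<in> {C *\<^sub>v x |x. x \<in> carrier_vec k}"
    using mult_mat_vec[OF assms, of a c] by (auto intro!: exI[of _ "c \<cdot>\<^sub>v a"])
qed (use assms in auto)

lemma linear_subspace_sum:
  assumes W: "linear_subspace n W" and "finite S" and "\<And>j. j \<in> S \<Longrightarrow> f j \<in> W"
  shows "vec n (\<lambda>i. \<Sum>j\<in>S. f j $ i) \<in> W"
  using assms(2,3)
proof (induction S rule: finite_induct)
  case empty
  have "vec n (\<lambda>i. \<Sum>j\<in>{}. f j $ i) = 0\<^sub>v n" by auto
  then show ?case using W unfolding linear_subspace_def by metis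
next
  case (insert j S)
  have "f j \<in> carrier_vec n" using W insert.prems unfolding linear_subspace_def by auto
  then have "vec n (\<lambda>i. \<Sum>j\<in>insert j S. f j $ i) = f j + vec n (\<lambda>i. \<Sum>j\<in>S. f j $ i)"
    using insert.hyps by (intro eq_vecI) auto
  then show ?case using W insert unfolding linear_subspace_def by auto
qed

lemma mult_mat_vec_sum:
  assumes M: "(M :: complex mat) \<in> carrier_mat m n" and f: "\<And>j. j \<in> S \<Longrightarrow> f j \<in> carrier_vec n"
  shows "M *\<^sub>v vec n (\<lambda>i. \<Sum>j\<in>S. f j $ i) = vec m (\<lambda>i. \<Sum>j\<in>S. (M *\<^sub>v f j) $ i)"
proof (rule eq_vecI)
  fix i assume "i < dim_vec (vec m (\<lambda>i. \<Sum>j\<in>S. (M *\<^sub>v f j) $ i))"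
  then have i: "i < m" by simp
  have "(M *\<^sub>v vec n (\<lambda>i. \<Sum>j\<in>S. f j $ i)) $ i = (\<Sum>k<n. \<Sum>j\<in>S. M $$ (i,k) * f j $ k)"
    using i M by (auto simp: scalar_prod_def atLeast0LessThan sum_distrib_left intro!: sum.cong)
  also have "\<dots> = (\<Sum>j\<in>S. \<Sum>k<n. M $$ (i,k) * f j $ k)" by (rule sum.swap)
  also have "\<dots> = (\<Sum>j\<in>S. (M *\<^sub>v f j) $ i)"
    using i M carrier_vecD[OF f] by (auto simp: scalar_prod_def atLeast0LessThan intro!: sum.cong)
  finally show "(M *\<^sub>v vec n (\<lambda>i. \<Sum>j\<in>S. f j $ i)) $ i = vec m (\<lambda>i. \<Sum>j\<in>S. (M *\<^sub>v f j) $ i) $ i"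
    using i by simp
qed (use M in auto)

lemma pow_mat_Suc_left:
  assumes "(M :: complex mat) \<in> carrier_mat n n"
  shows "M ^\<^sub>m Suc i = M * M ^\<^sub>m i"
proof (induction i)
  case (Suc i)
  have "M ^\<^sub>m Suc (Suc i) = M * M ^\<^sub>m i * M" using Suc by simp
  also have "\<dots> = M * M ^\<^sub>m Suc i" using assms by (simp add: assoc_mult_mat[of _ n n _ n _ n])
  finally show ?case .
qed (use assms in auto)

text \<open>The components are the discrete Fourier transform of the periodic sequence \<open>v, M v, M\<^sup>2 v, \<dots>\<close>. They are
linear combinations of this sequence and thus stay in every \<open>M\<close>-stable subspace that contains \<open>v\<close>; for joint
eigenspaces of matrices that commute with \<open>M\<close> this gives common eigenvectors.\<close>

lemma finite_order_eigenvector_decomposition: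
  assumes M: "M \<in> carrier_mat n n" "M ^\<^sub>m N = 1\<^sub>m n" "N > 0"
    and W: "linear_subspace n W" "\<And>x. x \<in> W \<Longrightarrow> M *\<^sub>v x \<in> W" and v: "v \<in> W"
  obtains w :: "nat \<Rightarrow> complex vec" where "\<And>j. w j \<in> W" "\<And>j. \<exists>c. M *\<^sub>v w j = c \<cdot>\<^sub>v w j"
    "v = vec n (\<lambda>i. \<Sum>j<N. w j $ i)"
proof -
  obtain \<omega> :: complex where \<omega>: "\<omega> ^ N = 1" "\<And>i. 0 < i \<Longrightarrow> i < N \<Longrightarrow> \<omega> ^ i \<noteq> 1"
    using exists_primitive_root_of_unity[OF M(3)] by metis
  have vn: "v \<in> carrier_vec n" using W v unfolding linear_subspace_def by auto
  define x where "x i = M ^\<^sub>m i *\<^sub>v v" for i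
  have x0: "x 0 = v" using M(1) vn by (simp add: x_def)
  have xN: "x N = v" using M vn by (simp add: x_def)
  have xS: "x (Suc i) = M *\<^sub>v x i" for i
  proof -
    have "M ^\<^sub>m Suc i = M * M ^\<^sub>m i" by (rule pow_mat_Suc_left[OF M(1)])
    then show ?thesis using M(1) vn by (simp add: x_def assoc_mult_mat_vec[of _ n n _ n])
  qed
  have xW: "x i \<in> W" for i by (induction i) (auto simp: x0 xS v W(2))
  then have xn: "x i \<in> carrier_vec n" for i using W(1) unfolding linear_subspace_def by auto
  have xd: "dim_vec (x i) = n" for i using xn[of i] by auto
  have \<omega>0: "\<omega> \<noteq> 0" using \<omega>(1) M(3) by (metis power_0_left zero_neq_one not_gr_zero)
  define \<eta> where "\<eta> = inverse \<omega>"
  have \<eta>: "\<eta> ^ N = 1" "\<omega> * \<eta> = 1" using \<omega>(1) \<omega>0 by (simp_all add: \<eta>_def power_inverse)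
  define w where "w j = vec n (\<lambda>i. \<Sum>k<N. ((\<eta> ^ j) ^ k / of_nat N \<cdot>\<^sub>v x k) $ i)" for j
  have wW: "w j \<in> W" for j
    unfolding w_def using W xW by (intro linear_subspace_sum) (auto simp: linear_subspace_def)
  have "M *\<^sub>v w j = \<omega> ^ j \<cdot>\<^sub>v w j" for j
  proof (rule eq_vecI)
    fix i assume "i < dim_vec (\<omega> ^ j \<cdot>\<^sub>v w j)"
    then have i: "i < n" by (simp add: w_def)
    define g where "g k = (\<eta> ^ j) ^ k / of_nat N * x k $ i" for k
    have tele: "(\<Sum>k<m. g (Suc k)) = (\<Sum>k<m. g k) + g m - g 0" for m by (induction m) auto
    have e1: "\<omega> ^ j * \<eta> ^ j = 1" using \<eta>(2) by (metis power_mult_distrib power_one)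
    have "(M *\<^sub>v w j) $ i = (\<Sum>k<N. (M *\<^sub>v ((\<eta> ^ j) ^ k / of_nat N \<cdot>\<^sub>v x k)) $ i)"
      unfolding w_def using mult_mat_vec_sum[OF M(1), of "{..<N}" "\<lambda>k. (\<eta> ^ j) ^ k / of_nat N \<cdot>\<^sub>v x k"] xn i by simp
    also have "\<dots> = (\<Sum>k<N. (\<eta> ^ j) ^ k / of_nat N * x (Suc k) $ i)"
      using i mult_mat_vec[OF M(1) xn] M(1) xn by (simp add: xS)
    also have "\<dots> = (\<Sum>k<N. \<omega> ^ j * g (Suc k))"
      using e1 by (intro sum.cong) (auto simp: g_def mult.assoc[symmetric])
    also have "\<dots> = \<omega> ^ j * (\<Sum>k<N. g (Suc k))" by (simp add: sum_distrib_left)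
    also have "(\<Sum>k<N. g (Suc k)) = (\<Sum>k<N. g k) + g N - g 0"
      by (rule tele)
    also have "g N = g 0" using \<eta>(1) x0 xN by (simp add: g_def) (metis mult.commute power_mult power_one)
    finally show "(M *\<^sub>v w j) $ i = (\<omega> ^ j \<cdot>\<^sub>v w j) $ i"
      using i xd by (simp add: w_def g_def)
  qed (use M(1) in \<open>auto simp: w_def\<close>)
  moreover have "v = vec n (\<lambda>i. \<Sum>j<N. w j $ i)"
  proof (rule eq_vecI)
    fix i assume "i < dim_vec (vec n (\<lambda>i. \<Sum>j<N. w j $ i))"
    then have i: "i < n" by simp
    have "(\<Sum>j<N. w j $ i) = (\<Sum>j<N. \<Sum>k<N. (\<eta> ^ k) ^ j / of_nat N * x k $ i)"
      using i xd by (auto simp: w_def power_mult[symmetric] intro!: sum.cong) (metis mult.commute)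
    also have "\<dots> = (\<Sum>k<N. \<Sum>j<N. (\<eta> ^ k) ^ j / of_nat N * x k $ i)" by (rule sum.swap)
    also have "\<dots> = (\<Sum>k<N. (if k = 0 then x k $ i else 0))"
    proof (intro sum.cong refl)
      fix k assume k: "k \<in> {..<N}"
      have "(\<eta> ^ k) ^ N = 1" using \<eta>(1) by (metis mult.commute power_mult power_one)
      moreover have "\<eta> ^ k = 1 \<longleftrightarrow> k = 0"
        using \<omega>(2)[of k] k by (auto simp: \<eta>_def power_inverse)
      ultimately have "(\<Sum>j<N. (\<eta> ^ k) ^ j) = (if k = 0 then of_nat N else 0)"
        using root_of_unity_power_sum[of "\<eta> ^ k" N] by simp
      then show "(\<Sum>j<N. (\<eta> ^ k) ^ j / of_nat N * x k $ i) = (if k = 0 then x k $ i else 0)"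
        using M(3) by (simp add: sum_distrib_right[symmetric] sum_divide_distrib[symmetric])
    qed
    also have "\<dots> = v $ i" using M(3) x0 by simp
    finally show "v $ i = vec n (\<lambda>i. \<Sum>j<N. w j $ i) $ i" using i by simp
  qed (use vn in auto)
  ultimately show thesis using that[of w] wW by blast
qed

text \<open>When \<open>M\<close> is added to \<open>F\<close>, a common eigenvector of \<open>F\<close> lies in a joint eigenspace of \<open>F\<close>. That eigenspace is
\<open>M\<close>-stable, so the vector is a sum of eigenvectors of \<open>M\<close> from the same eigenspace.\<close>

lemma common_eigenvectors_span:
  assumes "finite F" "F \<subseteq> carrier_mat n n" and comm: "\<And>L M. L \<in> F \<Longrightarrow> M \<in> F \<Longrightarrow> L * M = M * L"
    and N: "N > 0" "\<And>M. M \<in> F \<Longrightarrow> M ^\<^sub>m N = 1\<^sub>m n"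
    and R: "linear_subspace n R" "{w \<in> carrier_vec n. \<forall>M\<in>F. \<exists>c. M *\<^sub>v w = c \<cdot>\<^sub>v w} \<subseteq> R"
  shows "carrier_vec n \<subseteq> R"
  using assms(1,2) comm N(2) R(2)
proof (induction F rule: finite_induct)
  case empty
  then show ?case by auto
next
  case (insert M F)
  have "w \<in> R" if w: "w \<in> carrier_vec n" "\<forall>L\<in>F. \<exists>c. L *\<^sub>v w = c \<cdot>\<^sub>v w" for w
  proof -
    from w(2) obtain e where e: "\<And>L. L \<in> F \<Longrightarrow> L *\<^sub>v w = e L \<cdot>\<^sub>v w" by metis
    define W where "W = {x \<in> carrier_vec n. \<forall>L\<in>F. L *\<^sub>v x = e L \<cdot>\<^sub>v x}"
    have M: "M \<in> carrier_mat n n" and F: "\<And>L. L \<in> F \<Longrightarrow> L \<in> carrier_mat n n" using insert.prems by auto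
    have W: "linear_subspace n W"
      unfolding linear_subspace_def
    proof (intro conjI ballI allI)
      fix x y assume "x \<in> W" "y \<in> W"
      then show "x + y \<in> W"
        using F by (auto simp: W_def mult_add_distrib_mat_vec[of _ n n] smult_add_distrib_vec[of _ n])
    next
      fix c x assume "x \<in> W"
      then show "c \<cdot>\<^sub>v x \<in> W"
        using F by (auto simp: W_def mult_mat_vec[of _ n n] smult_smult_assoc mult.commute)
    next
      show "0\<^sub>v n \<in> W"
      proof -
        have "L *\<^sub>v 0\<^sub>v n = e L \<cdot>\<^sub>v 0\<^sub>v n" if "L \<in> F" for L
          using F[OF that] by (intro eq_vecI) auto
        then show ?thesis by (simp add: W_def)
      qed
    qed (auto simp: W_def)
    have st: "M *\<^sub>v x \<in> W" if "x \<in> W" for x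
      unfolding W_def
    proof (intro CollectI conjI ballI)
      have x: "x \<in> carrier_vec n" using that by (simp add: W_def)
      then show "M *\<^sub>v x \<in> carrier_vec n" using M by simp
      fix L assume L: "L \<in> F"
      have "L *\<^sub>v (M *\<^sub>v x) = (L * M) *\<^sub>v x" using F[OF L] M x by simp
      also have "L * M = M * L" using insert.prems(2) L by auto
      also have "(M * L) *\<^sub>v x = M *\<^sub>v (L *\<^sub>v x)" using F[OF L] M x by simp
      also have "L *\<^sub>v x = e L \<cdot>\<^sub>v x" using that L by (simp add: W_def)
      finally show "L *\<^sub>v (M *\<^sub>v x) = e L \<cdot>\<^sub>v (M *\<^sub>v x)" using mult_mat_vec[OF M x] by simp
    qed
    have "w \<in> W" using w e by (simp add: W_def)
    then obtain u :: "nat \<Rightarrow> complex vec" where u: "\<And>j. u j \<in> W" "\<And>j. \<exists>c. M *\<^sub>v u j = c \<cdot>\<^sub>v u j"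
      "w = vec n (\<lambda>i. \<Sum>j<N. u j $ i)"
      using finite_order_eigenvector_decomposition[OF M _ N(1) W st] insert.prems(3) by (metis insertI1)
    have "u j \<in> R" for j
      using insert.prems(4) u(1)[of j] u(2)[of j] by (auto simp: W_def)
    then show "w \<in> R" unfolding u(3) by (intro linear_subspace_sum[OF R(1)]) auto
  qed
  then show ?case using insert.IH insert.prems by (auto simp: subset_iff)
qed

lemma simultaneous_diagonalization:
  assumes "finite F" "F \<subseteq> carrier_mat n n" and "\<And>L M. L \<in> F \<Longrightarrow> M \<in> F \<Longrightarrow> L * M = M * L"
    and "N > 0" "\<And>M. M \<in> F \<Longrightarrow> M ^\<^sub>m N = 1\<^sub>m n"
  obtains P e where "P \<in> carrier_mat n n" "injective_mat P"
    "\<And>M j. M \<in> F \<Longrightarrow> j < n \<Longrightarrow> M *\<^sub>v col P j = e M j \<cdot>\<^sub>v col P j"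
proof -
  define Q where "Q = {w \<in> carrier_vec n. \<forall>M\<in>F. \<exists>c. M *\<^sub>v w = c \<cdot>\<^sub>v w}"
  have "Q \<subseteq> carrier_vec n" by (auto simp: Q_def)
  from exists_maximal_independent[OF this] obtain k C where C: "k \<le> n" "C \<in> carrier_mat n k"
    "injective_mat C" "\<forall>j<k. col C j \<in> Q" "\<forall>w\<in>Q. \<exists>x\<in>carrier_vec k. w = C *\<^sub>v x" by blast
  have "carrier_vec n \<subseteq> {C *\<^sub>v x |x. x \<in> carrier_vec k}"
    using C(5) unfolding Q_def
    by (intro common_eigenvectors_span[OF assms linear_subspace_range[OF C(2)]]) auto
  then have "n \<le> k" using C(2) by (intro surjective_mat_dim_le[of C]) auto
  then have k: "k = n" using C(1) by simp
  have "\<forall>M j. \<exists>c. M \<in> F \<longrightarrow> j < n \<longrightarrow> M *\<^sub>v col C j = c \<cdot>\<^sub>v col C j"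
    using C(4) k by (auto simp: Q_def)
  then obtain e where "\<And>M j. M \<in> F \<Longrightarrow> j < n \<Longrightarrow> M *\<^sub>v col C j = e M j \<cdot>\<^sub>v col C j" by metis
  then show thesis using that C k by blast
qed

lemma injective_mat_col_nonzero:
  assumes "P \<in> carrier_mat n k" "injective_mat P" "j < k"
  shows "col P j \<noteq> 0\<^sub>v n"
proof
  assume "col P j = 0\<^sub>v n"
  moreover have "P *\<^sub>v unit_vec k j = col P j" using assms by (intro eq_vecI) auto
  ultimately have "P *\<^sub>v unit_vec k j = 0\<^sub>v n" by simp
  then have "unit_vec k j = (0\<^sub>v k :: complex vec)" using injective_matD[OF assms(2,1)] by auto
  then have "unit_vec k j $ j = (0::complex)" using assms(3) by simp
  then show False using assms(3) by simp
qed

lemma eigenvalue_of_finite_order: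
  assumes M: "M \<in> carrier_mat n n" "M ^\<^sub>m N = 1\<^sub>m n" and v: "v \<in> carrier_vec n" "v \<noteq> 0\<^sub>v n"
    and e: "M *\<^sub>v v = e \<cdot>\<^sub>v v"
  shows "(e :: complex) ^ N = 1"
proof -
  have "eigenvector M v e" using M v e by (simp add: eigenvector_def)
  then have "M ^\<^sub>m N *\<^sub>v v = e ^ N \<cdot>\<^sub>v v" by (rule eigenvector_pow[OF M(1)])
  then have eq: "v = e ^ N \<cdot>\<^sub>v v" using M v by simp
  obtain i where i: "i < n" "v $ i \<noteq> 0"
    using v by (metis carrier_vecD eq_vecI index_zero_vec(1) index_zero_vec(2))
  have "v $ i = e ^ N * v $ i" using arg_cong[OF eq, of "\<lambda>w. w $ i"] i v by simp
  then show ?thesis using i by simp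
qed

text \<open>The eigenvalues are roots of unity. Their sum can only be the degree if all of them are \<open>1\<close>, and a
diagonalizable matrix with this spectrum is the identity.\<close>

lemma finite_order_trace_eq_degree:
  assumes M: "M \<in> carrier_mat n n" "M ^\<^sub>m N = 1\<^sub>m n" "N > 0" and tr: "mat_trace M = of_nat n"
  shows "M = 1\<^sub>m n"
proof -
  obtain P e where P: "P \<in> carrier_mat n n" "injective_mat P"
    "\<And>L j. L \<in> {M} \<Longrightarrow> j < n \<Longrightarrow> L *\<^sub>v col P j = e L j \<cdot>\<^sub>v col P j"
    by (rule simultaneous_diagonalization[of "{M}" n N]) (use M in auto)
  have pe: "M *\<^sub>v col P j = e M j \<cdot>\<^sub>v col P j" if "j < n" for j using P(3) that by simp
  have "cmod (e M j) = 1" if j: "j < n" for j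
    using eigenvalue_of_finite_order[OF M(1,2) _ injective_mat_col_nonzero[OF P(1,2) j] pe[OF j]]
      P(1) M(3) root_of_unity_norm by auto
  moreover have "(\<Sum>j<n. e M j) = of_nat (card {..<n})"
    using mat_trace_eigenbasis[OF M(1) P(1,2) pe] tr by simp
  ultimately have e1: "e M j = 1" if "j < n" for j
    using sum_unit_complex_eq_card[of "{..<n}" "e M" j] that by auto
  have "M * P = 1\<^sub>m n * P"
  proof (rule eq_matI)
    fix i j assume "i < dim_row (1\<^sub>m n * P)" "j < dim_col (1\<^sub>m n * P)"
    then have ij: "i < n" "j < n" using P(1) by auto
    have "(M * P) $$ (i,j) = (M *\<^sub>v col P j) $ i" using ij M(1) P(1) by simp
    also have "M *\<^sub>v col P j = e M j \<cdot>\<^sub>v col P j" by (rule pe[OF ij(2)])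
    also have "\<dots> $ i = P $$ (i,j)" using e1[OF ij(2)] ij P(1) by simp
    finally show "(M * P) $$ (i,j) = (1\<^sub>m n * P) $$ (i,j)" using P(1) ij by simp
  qed (use M P in auto)
  then have MP: "M * P = P" using P(1) by simp
  obtain D where D: "D \<in> carrier_mat n n" "P * D = 1\<^sub>m n"
    using square_injective_mat_inverse[OF P(1,2)] by blast
  have "M * P * D = M * (P * D)" by (rule assoc_mult_mat[OF M(1) P(1) D(1)])
  then show ?thesis using MP D(2) M(1) by simp
qed

section \<open>Subrepresentations and irreducible constituents\<close>

lemma linear_subspace_iff_subspace:
  "linear_subspace n W \<longleftrightarrow> VectorSpace.subspace class_ring W (module_vec TYPE(complex) n)"
proof
  assume "linear_subspace n W"
  then show "VectorSpace.subspace class_ring W (module_vec TYPE(complex) n)"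
    unfolding linear_subspace_def
    by (intro subspace.intro vec_vs submodule.intro vec_module)
      (auto simp: module_vec_simps)
next
  assume *: "VectorSpace.subspace class_ring W (module_vec TYPE(complex) n)"
  then interpret submodule class_ring W "module_vec TYPE(complex) n" by (rule subspace.submod)
  show "linear_subspace n W"
    unfolding linear_subspace_def
    using subset m_closed zero_closed smult_closed by (auto simp: module_vec_simps)
qed

locale finite_group = group G for G (structure) +
  assumes fin: "finite (carrier G)"
begin

text \<open>The fibers of \<open>F\<close> are the left cosets of \<open>H\<close>. This form of the orbit-stabilizer theorem needs only a function
on \<open>G\<close> and avoids setting up an action on a set.\<close>

lemma card_image_of_cosets:
  assumes H: "subgroup H G"
    and F: "\<And>g h. g \<in> carrier G \<Longrightarrow> h \<in> carrier G \<Longrightarrow> F g = F h \<longleftrightarrow> inv g \<otimes> h \<in> H"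
  shows "card (F ` carrier G) * card H = card (carrier G)"
proof -
  have "card (carrier G) = (\<Sum>y\<in>F ` carrier G. card {g \<in> carrier G. F g = y})"
    using fin sum.group[of "carrier G" "F ` carrier G" F "\<lambda>_. 1::nat"] by simp
  also have "\<dots> = (\<Sum>y\<in>F ` carrier G. card H)"
  proof (intro sum.cong refl)
    fix y assume "y \<in> F ` carrier G"
    then obtain g where g: "g \<in> carrier G" "y = F g" by auto
    have "bij_betw (\<lambda>h. g \<otimes> h) H {h \<in> carrier G. F h = y}"
    proof (rule bij_betwI[where g = "\<lambda>h. inv g \<otimes> h"])
      show "(\<otimes>) g \<in> H \<rightarrow> {h \<in> carrier G. F h = y}"
      proof
        fix h assume h: "h \<in> H"
        then have hc: "h \<in> carrier G" by (rule subgroup.mem_carrier[OF H])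
        have "inv g \<otimes> (g \<otimes> h) = h" using g hc by (simp add: m_assoc[symmetric])
        then have "F g = F (g \<otimes> h)" using g(1) hc h by (intro iffD2[OF F]) simp_all
        then show "g \<otimes> h \<in> {h \<in> carrier G. F h = y}" using g hc by auto
      qed
      show "(\<otimes>) (inv g) \<in> {h \<in> carrier G. F h = y} \<rightarrow> H"
      proof
        fix h assume "h \<in> {h \<in> carrier G. F h = y}"
        then have "h \<in> carrier G" "F g = F h" using g(2) by auto
        then show "inv g \<otimes> h \<in> H" using F[OF g(1)] by blast
      qed
      show "inv g \<otimes> (g \<otimes> h) = h" if "h \<in> H" for h
        using subgroup.mem_carrier[OF H that] g(1) by (simp add: m_assoc[symmetric])
      show "g \<otimes> (inv g \<otimes> h) = h" if "h \<in> {h \<in> carrier G. F h = y}" for h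
        using that g(1) by (simp add: m_assoc[symmetric])
    qed
    then show "card {g \<in> carrier G. F g = y} = card H" by (metis bij_betw_same_card)
  qed
  finally show ?thesis by simp
qed

lemma representation_carrier:
  assumes "representation G n \<rho>" "g \<in> carrier G"
  shows "\<rho> g \<in> carrier_mat n n"
  using assms by (auto simp: representation_def hom_def GL_def units_of_def Units_def ring_mat_def Pi_iff)

lemma representation_mult:
  assumes "representation G n \<rho>" "g \<in> carrier G" "h \<in> carrier G"
  shows "\<rho> (g \<otimes> h) = \<rho> g * \<rho> h"
  using assms by (auto simp: representation_def hom_def GL_def units_of_def ring_mat_def)

lemma representation_one:
  assumes "representation G n \<rho>"
  shows "\<rho> \<one> = 1\<^sub>m n"
proof -
  obtain N where N: "N \<in> carrier_mat n n" "N * \<rho> \<one> = 1\<^sub>m n"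
    using assms one_closed
    by (auto simp: representation_def hom_def GL_def units_of_def Units_def ring_mat_def Pi_iff)
  have r: "\<rho> \<one> \<in> carrier_mat n n" using representation_carrier[OF assms] by simp
  have "\<rho> \<one> * \<rho> \<one> = \<rho> \<one>" using representation_mult[OF assms, of \<one> \<one>] by simp
  then have "N * \<rho> \<one> * \<rho> \<one> = N * \<rho> \<one>" using N r by (metis assoc_mult_mat)
  then show ?thesis using N r by simp
qed

lemma representationI:
  assumes "n > 0" "\<And>g. g \<in> carrier G \<Longrightarrow> \<rho> g \<in> carrier_mat n n" "\<rho> \<one> = 1\<^sub>m n"
    and m: "\<And>g h. g \<in> carrier G \<Longrightarrow> h \<in> carrier G \<Longrightarrow> \<rho> (g \<otimes> h) = \<rho> g * \<rho> h"
  shows "representation G n \<rho>"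
proof -
  have "\<rho> g \<in> Units (ring_mat TYPE(complex) n ())" if g: "g \<in> carrier G" for g
  proof -
    have "\<rho> g * \<rho> (inv g) = 1\<^sub>m n" "\<rho> (inv g) * \<rho> g = 1\<^sub>m n"
      using m[of g "inv g"] m[of "inv g" g] g assms(3) by auto
    then show ?thesis using assms(2) g unfolding Units_def ring_mat_def by auto
  qed
  then show ?thesis
    using assms by (auto simp: representation_def hom_def GL_def units_of_def ring_mat_def)
qed

lemma representation_pow:
  assumes "representation G n \<rho>" "g \<in> carrier G"
  shows "\<rho> (g [^] (k::nat)) = \<rho> g ^\<^sub>m k"
  using assms representation_carrier[OF assms]
  by (induction k) (auto simp: representation_one representation_mult)

lemma representation_finite_order:
  assumes "representation G n \<rho>" "g \<in> carrier G"
  shows "\<rho> g ^\<^sub>m card (carrier G) = 1\<^sub>m n"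
  using representation_pow[OF assms, of "card (carrier G)"] pow_order_eq_1[OF assms(2)]
    representation_one[OF assms(1)] by (simp add: Coset.order_def)

lemma card_carrier_pos: "card (carrier G) > 0"
  using fin by (simp add: card_gt_0_iff) (use one_closed in blast)

text \<open>The columns of \<open>C\<close> are a basis of \<open>W\<close>, and \<open>\<sigma>\<close> is the action on \<open>W\<close> in the corresponding coordinates.\<close>

lemma subrepresentation_exists:
  assumes rep: "representation G n \<rho>" and W: "linear_subspace n W" "W \<noteq> {0\<^sub>v n}"
    and inv: "\<And>g w. g \<in> carrier G \<Longrightarrow> w \<in> W \<Longrightarrow> \<rho> g *\<^sub>v w \<in> W"
  obtains k C \<sigma> where "0 < k" "k \<le> n" "C \<in> carrier_mat n k" "injective_mat C" "representation G k \<sigma>"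
    "\<forall>g\<in>carrier G. \<rho> g * C = C * \<sigma> g" "W = {C *\<^sub>v x |x. x \<in> carrier_vec k}"
proof -
  have "W \<subseteq> carrier_vec n" using W by (auto simp: linear_subspace_def)
  from exists_maximal_independent[OF this] obtain k C where C: "k \<le> n" "C \<in> carrier_mat n k"
    "injective_mat C" "\<forall>j<k. col C j \<in> W" "\<forall>w\<in>W. \<exists>x\<in>carrier_vec k. w = C *\<^sub>v x" by blast
  have cols: "C *\<^sub>v x \<in> W" if "x \<in> carrier_vec k" for x
  proof -
    have "C *\<^sub>v x = vec n (\<lambda>i. \<Sum>j<k. (x $ j \<cdot>\<^sub>v col C j) $ i)"
      using C(2) that by (intro eq_vecI) (auto simp: scalar_prod_def atLeast0LessThan mult.commute intro!: sum.cong)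
    also have "\<dots> \<in> W"
      using C(4) W(1) by (intro linear_subspace_sum) (auto simp: linear_subspace_def)
    finally show ?thesis .
  qed
  then have WC: "W = {C *\<^sub>v x |x. x \<in> carrier_vec k}" using C(5) by blast
  have k: "0 < k"
  proof (rule ccontr)
    assume "\<not> 0 < k"
    then have "C *\<^sub>v x = 0\<^sub>v n" if "x \<in> carrier_vec k" for x
      using C(2) that by (intro eq_vecI) (auto simp: scalar_prod_def)
    then have "W \<subseteq> {0\<^sub>v n}" using WC by auto
    then show False using W by (auto simp: linear_subspace_def)
  qed
  have "\<exists>S\<in>carrier_mat k k. \<rho> g * C = C * S" if g: "g \<in> carrier G" for g
  proof (rule mat_factor_through_columns[OF C(2)])
    have r: "\<rho> g \<in> carrier_mat n n" using representation_carrier[OF rep g] .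
    then show "\<rho> g * C \<in> carrier_mat n k" using C(2) by simp
    fix j assume j: "j < k"
    have "col (\<rho> g * C) j = \<rho> g *\<^sub>v col C j" using r C(2) j by (intro eq_vecI) auto
    also have "\<dots> \<in> W" using inv g C(4) j by blast
    finally show "\<exists>x\<in>carrier_vec k. col (\<rho> g * C) j = C *\<^sub>v x" using C(5) by blast
  qed
  then obtain \<sigma> where \<sigma>: "\<And>g. g \<in> carrier G \<Longrightarrow> \<sigma> g \<in> carrier_mat k k"
    "\<And>g. g \<in> carrier G \<Longrightarrow> \<rho> g * C = C * \<sigma> g" by metis
  have "representation G k \<sigma>"
  proof (rule representationI[OF k \<sigma>(1)])
    have "C * \<sigma> \<one> = C * 1\<^sub>m k"
      using \<sigma>(2)[OF one_closed] representation_one[OF rep] C(2)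
      by (metis left_mult_one_mat right_mult_one_mat)
    then show "\<sigma> \<one> = 1\<^sub>m k"
      by (rule injective_mat_cancel_mat[OF C(3,2) \<sigma>(1)[OF one_closed] one_carrier_mat])
    fix g h assume gh: "g \<in> carrier G" "h \<in> carrier G"
    note rc = representation_carrier[OF rep gh(1)] representation_carrier[OF rep gh(2)]
    have "C * \<sigma> (g \<otimes> h) = \<rho> g * \<rho> h * C"
      using \<sigma>(2)[of "g \<otimes> h"] gh representation_mult[OF rep gh] by simp
    also have "\<dots> = \<rho> g * (C * \<sigma> h)" using rc C(2) \<sigma>(2)[OF gh(2)] by simp
    also have "\<dots> = C * \<sigma> g * \<sigma> h" using rc C(2) \<sigma>(1)[OF gh(2)] \<sigma>(2)[OF gh(1)]
      by (metis assoc_mult_mat)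
    also have "\<dots> = C * (\<sigma> g * \<sigma> h)" using C(2) \<sigma>(1)[OF gh(1)] \<sigma>(1)[OF gh(2)] by simp
    finally show "\<sigma> (g \<otimes> h) = \<sigma> g * \<sigma> h"
      by (rule injective_mat_cancel_mat[OF C(3,2) \<sigma>(1)[OF m_closed[OF gh]]
            mult_carrier_mat[OF \<sigma>(1)[OF gh(1)] \<sigma>(1)[OF gh(2)]]])
  qed
  then show thesis using that k C WC \<sigma> by blast
qed

text \<open>A proper nonzero invariant subspace of the source of an injective intertwiner gives an injective intertwiner of smaller
degree. So one of least positive degree starts from an irreducible representation.\<close>

lemma irreducible_constituent:
  assumes "representation G n \<rho>"
  obtains k C \<sigma> where "k \<le> n" "C \<in> carrier_mat n k" "injective_mat C"
    "irreducible_representation G k \<sigma>" "\<forall>g\<in>carrier G. \<rho> g * C = C * \<sigma> g"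
proof -
  define P where "P k \<longleftrightarrow> (\<exists>C \<sigma>. C \<in> carrier_mat n k \<and> injective_mat C \<and> representation G k \<sigma> \<and>
    (\<forall>g\<in>carrier G. \<rho> g * C = C * \<sigma> g))" for k
  have "\<rho> g * 1\<^sub>m n = 1\<^sub>m n * \<rho> g" if "g \<in> carrier G" for g
    using representation_carrier[OF assms that] by (metis left_mult_one_mat right_mult_one_mat)
  then have "P n" unfolding P_def
    using assms by (intro exI[of _ "1\<^sub>m n"] exI[of _ \<rho>]) (auto simp: injective_mat_def)
  define k where "k = (LEAST k. P k)"
  have k: "P k" "\<And>j. P j \<Longrightarrow> k \<le> j" "k \<le> n"
    using LeastI[of P n] Least_le[of P] \<open>P n\<close> by (auto simp: k_def)
  then obtain C \<sigma> where C: "C \<in> carrier_mat n k" "injective_mat C" "representation G k \<sigma>"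
    "\<And>g. g \<in> carrier G \<Longrightarrow> \<rho> g * C = C * \<sigma> g" unfolding P_def by blast
  have "W = {0\<^sub>v k} \<or> W = carrier_vec k"
    if W: "linear_subspace k W" "\<forall>g\<in>carrier G. \<forall>w\<in>W. \<sigma> g *\<^sub>v w \<in> W" for W
  proof (rule disjCI)
    assume Wn: "W \<noteq> carrier_vec k"
    show "W = {0\<^sub>v k}"
    proof (rule ccontr)
      assume nz: "W \<noteq> {0\<^sub>v k}"
      have Wi: "\<sigma> g *\<^sub>v w \<in> W" if "g \<in> carrier G" "w \<in> W" for g w using W(2) that by blast
      obtain j D \<tau> where "0 < j" and D: "j \<le> k" "D \<in> carrier_mat k j" "injective_mat D" "representation G j \<tau>"
        "\<forall>g\<in>carrier G. \<sigma> g * D = D * \<tau> g" "W = {D *\<^sub>v x |x. x \<in> carrier_vec j}"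
        by (rule subrepresentation_exists[OF C(3) W(1) nz Wi])
      have "\<rho> g * (C * D) = C * D * \<tau> g" if g: "g \<in> carrier G" for g
      proof -
        note cs = representation_carrier[OF assms g] representation_carrier[OF C(3) g]
          representation_carrier[OF D(4) g] C(1) D(2)
        have "\<rho> g * (C * D) = \<rho> g * C * D" using cs by simp
        also have "\<dots> = C * (\<sigma> g * D)" using cs C(4)[OF g] by simp
        also have "\<dots> = C * D * \<tau> g" using cs bspec[OF D(5) g] by simp
        finally show ?thesis .
      qed
      then have "P j" unfolding P_def using C D injective_mat_mult[OF C(2,1) D(3,2)]
        by (intro exI[of _ "C * D"] exI[of _ \<tau>]) auto
      then have jk: "j = k" using k(2) D(1) by fastforce
      then obtain E where E: "E \<in> carrier_mat k k" "D * E = 1\<^sub>m k"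
        using square_injective_mat_inverse[of D k] D by auto
      have "x \<in> W" if "x \<in> carrier_vec k" for x
      proof -
        have "x = D *\<^sub>v (E *\<^sub>v x)"
          using E D(2) jk that by (metis assoc_mult_mat_vec one_mult_mat_vec)
        moreover have "E *\<^sub>v x \<in> carrier_vec j" using E jk that by simp
        ultimately show ?thesis unfolding D(6) by blast
      qed
      then show False using Wn W(1) by (auto simp: linear_subspace_def)
    qed
  qed
  then have "irreducible_representation G k \<sigma>"
    unfolding irreducible_representation_def linear_subspace_iff_subspace[symmetric]
    using C(3) by blast
  then show thesis using that k(3) C by blast
qed

abbreviation line_stabilizer :: "('a \<Rightarrow> complex mat) \<Rightarrow> complex vec \<Rightarrow> 'a set" where
  "line_stabilizer \<rho> u \<equiv> {g \<in> carrier G. \<exists>c. \<rho> g *\<^sub>v u = c \<cdot>\<^sub>v u}"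

lemma line_stabilizer_subgroup:
  assumes rep: "representation G n \<rho>" and u: "u \<in> carrier_vec n" "u \<noteq> 0\<^sub>v n"
  shows "subgroup (line_stabilizer \<rho> u) G"
proof (rule subgroupI)
  show "line_stabilizer \<rho> u \<noteq> {}"
    using representation_one[OF rep] u by (auto intro!: exI[of _ \<one>] exI[of _ 1])
next
  fix g assume "g \<in> line_stabilizer \<rho> u"
  then obtain c where g: "g \<in> carrier G" "\<rho> g *\<^sub>v u = c \<cdot>\<^sub>v u" by auto
  note rc = representation_carrier[OF rep g(1)] representation_carrier[OF rep inv_closed[OF g(1)]]
  have "u = \<rho> (inv g \<otimes> g) *\<^sub>v u" using representation_one[OF rep] u g by simp
  also have "\<dots> = \<rho> (inv g) *\<^sub>v (c \<cdot>\<^sub>v u)"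
    using representation_mult[OF rep inv_closed[OF g(1)] g(1)] rc u g(2) by simp
  also have "\<dots> = c \<cdot>\<^sub>v (\<rho> (inv g) *\<^sub>v u)" using rc u mult_mat_vec by blast
  finally have eq: "u = c \<cdot>\<^sub>v (\<rho> (inv g) *\<^sub>v u)" .
  have "c \<noteq> 0"
  proof
    assume "c = 0"
    then have "u = 0\<^sub>v n" using eq rc u by (intro eq_vecI) (auto simp: vec_eq_iff)
    then show False using u by simp
  qed
  then have "\<rho> (inv g) *\<^sub>v u = (1 / c) \<cdot>\<^sub>v u"
    using arg_cong[OF eq, of "\<lambda>x. (1 / c) \<cdot>\<^sub>v x"] by (simp add: smult_smult_assoc)
  then show "inv g \<in> line_stabilizer \<rho> u" using g by auto
next
  fix g h assume "g \<in> line_stabilizer \<rho> u" "h \<in> line_stabilizer \<rho> u"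
  then obtain c d where g: "g \<in> carrier G" "\<rho> g *\<^sub>v u = c \<cdot>\<^sub>v u" and h: "h \<in> carrier G" "\<rho> h *\<^sub>v u = d \<cdot>\<^sub>v u" by auto
  note rc = representation_carrier[OF rep g(1)] representation_carrier[OF rep h(1)]
  have "\<rho> (g \<otimes> h) *\<^sub>v u = \<rho> g *\<^sub>v (d \<cdot>\<^sub>v u)"
    using representation_mult[OF rep g(1) h(1)] rc u h(2) by simp
  also have "\<dots> = (d * c) \<cdot>\<^sub>v u" using mult_mat_vec[OF rc(1) u(1)] g(2) by (simp add: smult_smult_assoc)
  finally show "g \<otimes> h \<in> line_stabilizer \<rho> u" using g h by auto
qed auto

text \<open>All upper bounds on degrees come from this lemma. The vectors \<open>\<rho> g u\<close> lie on \<open>|G:H|\<close> lines, where \<open>H\<close> is the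
stabilizer of the line through \<open>u\<close>. They span an invariant subspace of dimension at most \<open>|G:H|\<close>, on which a
central element acts by the same scalar as on \<open>u\<close>.\<close>

lemma irreducible_below_line_stabilizer:
  assumes rep: "representation G n \<rho>" and u: "u \<in> carrier_vec n" "u \<noteq> 0\<^sub>v n"
  obtains k C \<sigma> where "irreducible_representation G k \<sigma>"
    "k * card (line_stabilizer \<rho> u) \<le> card (carrier G)"
    "C \<in> carrier_mat n k" "injective_mat C" "\<forall>g\<in>carrier G. \<rho> g * C = C * \<sigma> g"
    "\<forall>z c. z \<in> center G \<longrightarrow> \<rho> z *\<^sub>v u = c \<cdot>\<^sub>v u \<longrightarrow> \<sigma> z = c \<cdot>\<^sub>m 1\<^sub>m k"
proof -
  define H where "H = line_stabilizer \<rho> u"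
  have H: "subgroup H G" unfolding H_def by (rule line_stabilizer_subgroup[OF assms])
  note rc = representation_carrier[OF rep]
  \<comment> \<open>\<open>L g\<close> is the line through \<open>\<rho> g u\<close> without the origin; the lines correspond to the left cosets of \<open>H\<close>.\<close>
  define L where "L g = {c \<cdot>\<^sub>v (\<rho> g *\<^sub>v u) |c. c \<noteq> 0}" for g
  have nz: "\<rho> g *\<^sub>v u \<noteq> 0\<^sub>v n" if g: "g \<in> carrier G" for g
  proof
    assume "\<rho> g *\<^sub>v u = 0\<^sub>v n"
    then have "\<rho> (inv g) *\<^sub>v (\<rho> g *\<^sub>v u) = 0\<^sub>v n" using rc[OF inv_closed[OF g]] by (intro eq_vecI) auto
    moreover have "\<rho> (inv g) *\<^sub>v (\<rho> g *\<^sub>v u) = \<rho> (inv g \<otimes> g) *\<^sub>v u"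
      using representation_mult[OF rep inv_closed[OF g] g] rc[OF g] rc[OF inv_closed[OF g]] u by simp
    ultimately show False using u g representation_one[OF rep] by simp
  qed
  have act: "\<rho> (g \<otimes> h) *\<^sub>v u = \<rho> g *\<^sub>v (\<rho> h *\<^sub>v u)" if "g \<in> carrier G" "h \<in> carrier G" for g h
    using representation_mult[OF rep that] rc[OF that(1)] rc[OF that(2)] u by simp
  have scal: "(\<exists>c. \<rho> h *\<^sub>v u = c \<cdot>\<^sub>v (\<rho> g *\<^sub>v u)) \<longleftrightarrow> inv g \<otimes> h \<in> H"
    if gh: "g \<in> carrier G" "h \<in> carrier G" for g h
  proof
    assume "\<exists>c. \<rho> h *\<^sub>v u = c \<cdot>\<^sub>v (\<rho> g *\<^sub>v u)"
    then obtain c where "\<rho> h *\<^sub>v u = c \<cdot>\<^sub>v (\<rho> g *\<^sub>v u)" by auto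
    then have "\<rho> (inv g \<otimes> h) *\<^sub>v u = \<rho> (inv g) *\<^sub>v (c \<cdot>\<^sub>v (\<rho> g *\<^sub>v u))" using act gh by simp
    also have "\<dots> = c \<cdot>\<^sub>v (\<rho> (inv g) *\<^sub>v (\<rho> g *\<^sub>v u))"
      using mult_mat_vec[OF rc[OF inv_closed[OF gh(1)]]] rc[OF gh(1)] u by (meson mult_mat_vec_carrier)
    also have "\<rho> (inv g) *\<^sub>v (\<rho> g *\<^sub>v u) = u"
      using act[of "inv g" g] gh u representation_one[OF rep] by simp
    finally show "inv g \<otimes> h \<in> H" using gh by (auto simp: H_def)
  next
    assume "inv g \<otimes> h \<in> H"
    then obtain c where "\<rho> (inv g \<otimes> h) *\<^sub>v u = c \<cdot>\<^sub>v u" by (auto simp: H_def)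
    then have "\<rho> (g \<otimes> (inv g \<otimes> h)) *\<^sub>v u = c \<cdot>\<^sub>v (\<rho> g *\<^sub>v u)"
      using act[of g "inv g \<otimes> h"] gh mult_mat_vec[OF rc[OF gh(1)] u(1)] by simp
    then show "\<exists>c. \<rho> h *\<^sub>v u = c \<cdot>\<^sub>v (\<rho> g *\<^sub>v u)" using gh by (auto simp: m_assoc[symmetric])
  qed
  have L: "L g = L h \<longleftrightarrow> inv g \<otimes> h \<in> H" if gh: "g \<in> carrier G" "h \<in> carrier G" for g h
  proof
    assume "L g = L h"
    moreover have "\<rho> h *\<^sub>v u \<in> L h" unfolding L_def by (auto intro!: exI[of _ 1])
    ultimately have "\<exists>c. \<rho> h *\<^sub>v u = c \<cdot>\<^sub>v (\<rho> g *\<^sub>v u)" unfolding L_def by auto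
    then show "inv g \<otimes> h \<in> H" using scal gh by simp
  next
    assume "inv g \<otimes> h \<in> H"
    then obtain c where c: "\<rho> h *\<^sub>v u = c \<cdot>\<^sub>v (\<rho> g *\<^sub>v u)" using scal gh by auto
    have "c \<noteq> 0"
    proof
      assume "c = 0"
      then have "\<rho> h *\<^sub>v u = 0\<^sub>v n" using c rc[OF gh(1)] u by (intro eq_vecI) auto
      then show False using nz gh by blast
    qed
    show "L g = L h"
    proof (intro equalityI subsetI)
      fix x assume "x \<in> L g"
      then obtain d where "d \<noteq> 0" "x = d \<cdot>\<^sub>v (\<rho> g *\<^sub>v u)" by (auto simp: L_def)
      then show "x \<in> L h" unfolding L_def c using \<open>c \<noteq> 0\<close>
        by (auto simp: smult_smult_assoc intro!: exI[of _ "d / c"])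
    next
      fix x assume "x \<in> L h"
      then show "x \<in> L g" unfolding L_def c using \<open>c \<noteq> 0\<close> by (auto simp: smult_smult_assoc)
    qed
  qed
  define m where "m = card (L ` carrier G)"
  have mH: "m * card H = card (carrier G)" unfolding m_def by (rule card_image_of_cosets[OF H L])
  obtain b where b: "bij_betw b {..<m} (L ` carrier G)"
    using ex_bij_betw_nat_finite[of "L ` carrier G"] fin by (auto simp: m_def atLeast0LessThan)
  have "b i \<in> L ` carrier G" if "i < m" for i using b that by (auto simp: bij_betw_def)
  then have "\<forall>i. \<exists>x. i < m \<longrightarrow> x \<in> carrier G \<and> b i = L x" by blast
  then obtain x where x: "\<And>i. i < m \<Longrightarrow> x i \<in> carrier G" "\<And>i. i < m \<Longrightarrow> b i = L (x i)" by metis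
  \<comment> \<open>One spanning vector is taken on each of the \<open>m\<close> lines.\<close>
  define D where "D = mat n m (\<lambda>(r,i). (\<rho> (x i) *\<^sub>v u) $ r)"
  have D: "D \<in> carrier_mat n m" by (simp add: D_def)
  have colD: "col D i = \<rho> (x i) *\<^sub>v u" if "i < m" for i
    using that rc[OF x(1)[OF that]] by (intro eq_vecI) (auto simp: D_def)
  have line: "\<exists>i<m. \<exists>c. \<rho> g *\<^sub>v u = c \<cdot>\<^sub>v col D i" if g: "g \<in> carrier G" for g
  proof -
    have "L g \<in> b ` {..<m}" using b g by (auto simp: bij_betw_def)
    then obtain i where i: "i < m" "L g = L (x i)" using x(2) by auto
    then have "\<exists>c. \<rho> g *\<^sub>v u = c \<cdot>\<^sub>v (\<rho> (x i) *\<^sub>v u)"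
      using L[of "x i" g] scal[of "x i" g] x(1) g by auto
    then show ?thesis using i(1) colD[OF i(1)] by metis
  qed
  have inD: "c \<cdot>\<^sub>v col D i = D *\<^sub>v (c \<cdot>\<^sub>v unit_vec m i)" if "i < m" for c i
    using that D by (intro eq_vecI) (auto simp: mult.commute)
  define W where "W = {D *\<^sub>v y |y. y \<in> carrier_vec m}"
  have W: "linear_subspace n W" unfolding W_def by (rule linear_subspace_range[OF D])
  have gW: "\<rho> g *\<^sub>v u \<in> W" if "g \<in> carrier G" for g
    using line[OF that] inD by (force simp: W_def)
  have "u \<in> W" using gW[of \<one>] representation_one[OF rep] u by simp
  then have Wnz: "W \<noteq> {0\<^sub>v n}" using u by auto
  have Winv: "\<rho> g *\<^sub>v w \<in> W" if g: "g \<in> carrier G" and w: "w \<in> W" for g w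
  proof -
    obtain y where y: "y \<in> carrier_vec m" "w = D *\<^sub>v y" using w by (auto simp: W_def)
    have "w = vec n (\<lambda>r. \<Sum>i<m. (y $ i \<cdot>\<^sub>v col D i) $ r)"
      unfolding y(2) using D y(1)
      by (intro eq_vecI) (auto simp: scalar_prod_def atLeast0LessThan mult.commute intro!: sum.cong)
    then have "\<rho> g *\<^sub>v w = vec n (\<lambda>r. \<Sum>i<m. (\<rho> g *\<^sub>v (y $ i \<cdot>\<^sub>v col D i)) $ r)"
      using mult_mat_vec_sum[OF rc[OF g], of "{..<m}" "\<lambda>i. y $ i \<cdot>\<^sub>v col D i"] D by auto
    also have "\<dots> \<in> W"
    proof (rule linear_subspace_sum[OF W])
      fix i assume i: "i \<in> {..<m}"
      have "\<rho> g *\<^sub>v (y $ i \<cdot>\<^sub>v col D i) = y $ i \<cdot>\<^sub>v (\<rho> (g \<otimes> x i) *\<^sub>v u)"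
        using mult_mat_vec[OF rc[OF g], of "\<rho> (x i) *\<^sub>v u" "y $ i"]
          mult_mat_vec_carrier[OF rc[OF x(1)] u(1)] act[OF g, of "x i"] x(1) i colD by auto
      moreover have "\<rho> (g \<otimes> x i) *\<^sub>v u \<in> W" using gW g x(1) i by auto
      ultimately show "\<rho> g *\<^sub>v (y $ i \<cdot>\<^sub>v col D i) \<in> W" using W by (simp add: linear_subspace_def)
    qed simp
    finally show ?thesis .
  qed
  obtain j C \<tau> where "0 < j" "j \<le> n" and C: "C \<in> carrier_mat n j" "injective_mat C" "representation G j \<tau>"
    "\<forall>g\<in>carrier G. \<rho> g * C = C * \<tau> g" "W = {C *\<^sub>v x |x. x \<in> carrier_vec j}"
    by (rule subrepresentation_exists[OF rep W Wnz Winv])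
  have "\<exists>E\<in>carrier_mat m j. C = D * E"
  proof (rule mat_factor_through_columns[OF D C(1)])
    fix i assume i: "i < j"
    have "col C i = C *\<^sub>v unit_vec j i" using C(1) i by (intro eq_vecI) auto
    then have "col C i \<in> W" unfolding C(5) by auto
    then show "\<exists>x\<in>carrier_vec m. col C i = D *\<^sub>v x" by (auto simp: W_def)
  qed
  then obtain E where E: "E \<in> carrier_mat m j" "C = D * E" by blast
  then have "injective_mat E" using injective_mat_left_factor[OF _ D] C(2) by blast
  then have jm: "j \<le> m" using injective_mat_dim_le E by blast
  have tz: "\<tau> z = c \<cdot>\<^sub>m 1\<^sub>m j" if z: "z \<in> center G" "\<rho> z *\<^sub>v u = c \<cdot>\<^sub>v u" for z c
  proof -
    have zc: "z \<in> carrier G" using z by (simp add: center_def)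
    have "\<rho> z * D = c \<cdot>\<^sub>m D"
    proof (rule eq_matI)
      fix r i assume "r < dim_row (c \<cdot>\<^sub>m D)" "i < dim_col (c \<cdot>\<^sub>m D)"
      then have ri: "r < n" "i < m" using D by auto
      have "(\<rho> z * D) $$ (r,i) = (\<rho> z *\<^sub>v col D i) $ r" using ri D rc[OF zc] by simp
      also have "\<rho> z *\<^sub>v col D i = \<rho> (z \<otimes> x i) *\<^sub>v u" using act[OF zc] x(1) ri colD by simp
      also have "\<dots> = \<rho> (x i \<otimes> z) *\<^sub>v u" using z(1) x(1) ri by (simp add: center_def)
      also have "\<dots> = c \<cdot>\<^sub>v col D i"
        using act[OF x(1) zc] ri z(2) mult_mat_vec[OF rc[OF x(1)] u(1)] colD by simp
      finally show "(\<rho> z * D) $$ (r,i) = (c \<cdot>\<^sub>m D) $$ (r,i)" using ri D by simp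
    qed (use D rc[OF zc] in auto)
    then have "C * \<tau> z = c \<cdot>\<^sub>m C" using bspec[OF C(4) zc] E D rc[OF zc]
      by (metis assoc_mult_mat mult_smult_assoc_mat)
    also have "\<dots> = C * (c \<cdot>\<^sub>m 1\<^sub>m j)" using mult_smult_distrib[OF C(1) one_carrier_mat] C(1) by simp
    finally show ?thesis
      by (rule injective_mat_cancel_mat[OF C(2,1) representation_carrier[OF C(3) zc]
            smult_carrier_mat[OF one_carrier_mat]])
  qed
  obtain k B \<sigma> where B: "k \<le> j" "B \<in> carrier_mat j k" "injective_mat B"
    "irreducible_representation G k \<sigma>" "\<forall>g\<in>carrier G. \<tau> g * B = B * \<sigma> g"
    by (rule irreducible_constituent[OF C(3)])
  have reps: "representation G k \<sigma>" using B(4) by (simp add: irreducible_representation_def)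
  show thesis
  proof (rule that[OF B(4), of "C * B"])
    show "k * card (line_stabilizer \<rho> u) \<le> card (carrier G)"
      using mH jm B(1) unfolding H_def[symmetric] by (metis le_trans mult_le_mono1)
    show "C * B \<in> carrier_mat n k" using C B by auto
    show "injective_mat (C * B)" using injective_mat_mult[OF C(2,1) B(3,2)] .
    show "\<forall>g\<in>carrier G. \<rho> g * (C * B) = C * B * \<sigma> g"
    proof
      fix g assume g: "g \<in> carrier G"
      note cs = rc[OF g] representation_carrier[OF C(3) g] representation_carrier[OF reps g] C(1) B(2)
      have "\<rho> g * (C * B) = \<rho> g * C * B" using cs by simp
      also have "\<dots> = C * (\<tau> g * B)" using cs bspec[OF C(4) g] by simp
      also have "\<dots> = C * B * \<sigma> g" using cs bspec[OF B(5) g] by simp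
      finally show "\<rho> g * (C * B) = C * B * \<sigma> g" .
    qed
    show "\<forall>z c. z \<in> center G \<longrightarrow> \<rho> z *\<^sub>v u = c \<cdot>\<^sub>v u \<longrightarrow> \<sigma> z = c \<cdot>\<^sub>m 1\<^sub>m k"
    proof (intro allI impI)
      fix z c assume z: "z \<in> center G" "\<rho> z *\<^sub>v u = c \<cdot>\<^sub>v u"
      have zc: "z \<in> carrier G" using z by (simp add: center_def)
      have "B * \<sigma> z = (c \<cdot>\<^sub>m 1\<^sub>m j) * B" using bspec[OF B(5) zc] tz[OF z] by simp
      also have "\<dots> = B * (c \<cdot>\<^sub>m 1\<^sub>m k)" using B(2) mult_smult_distrib[OF B(2) one_carrier_mat]
        mult_smult_assoc_mat[OF one_carrier_mat B(2)] by simp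
      finally show "\<sigma> z = c \<cdot>\<^sub>m 1\<^sub>m k"
        by (rule injective_mat_cancel_mat[OF B(3,2) representation_carrier[OF reps zc]
              smult_carrier_mat[OF one_carrier_mat]])
    qed
  qed
qed

section \<open>Degrees of irreducible representations\<close>

lemma abelian_normal_subgroupD:
  assumes "abelian_normal_subgroup B G"
  shows "subgroup B G" "B \<lhd> G" "\<And>x y. x \<in> B \<Longrightarrow> y \<in> B \<Longrightarrow> x \<otimes> y = y \<otimes> x" "B \<subseteq> carrier G"
    "finite B" "\<And>x g. x \<in> B \<Longrightarrow> g \<in> carrier G \<Longrightarrow> inv g \<otimes> x \<otimes> g \<in> B"
proof -
  show n: "B \<lhd> G" and s: "subgroup B G"
    using assms by (auto simp: abelian_normal_subgroup_def normal_imp_subgroup)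
  show "x \<otimes> y = y \<otimes> x" if "x \<in> B" "y \<in> B" for x y
  proof -
    interpret B: comm_group "G\<lparr>carrier := B\<rparr>" using assms by (simp add: abelian_normal_subgroup_def)
    show ?thesis using B.m_comm[of x y] that by simp
  qed
  show "B \<subseteq> carrier G" using subgroup.subset[OF s] .
  then show "finite B" using fin finite_subset by blast
  show "inv g \<otimes> x \<otimes> g \<in> B" if "x \<in> B" "g \<in> carrier G" for x g
    using normal.inv_op_closed1[OF n] that by blast
qed

lemma abelian_simultaneous_eigenbasis:
  assumes rep: "representation G n \<rho>" and B: "subgroup B G" "\<And>x y. x \<in> B \<Longrightarrow> y \<in> B \<Longrightarrow> x \<otimes> y = y \<otimes> x"
  obtains P e where "P \<in> carrier_mat n n" "injective_mat P"
    "\<forall>b\<in>B. \<forall>j<n. \<rho> b *\<^sub>v col P j = e b j \<cdot>\<^sub>v col P j"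
proof -
  have Bc: "b \<in> carrier G" if "b \<in> B" for b using B(1) that by (rule subgroup.mem_carrier)
  obtain P e where P: "P \<in> carrier_mat n n" "injective_mat P"
    "\<And>L j. L \<in> \<rho> ` B \<Longrightarrow> j < n \<Longrightarrow> L *\<^sub>v col P j = e L j \<cdot>\<^sub>v col P j"
  proof (rule simultaneous_diagonalization[of "\<rho> ` B" n "card (carrier G)"])
    show "finite (\<rho> ` B)" using subgroup.subset[OF B(1)] fin finite_subset by blast
    show "\<rho> ` B \<subseteq> carrier_mat n n" using representation_carrier[OF rep Bc] by auto
    show "card (carrier G) > 0" by (rule card_carrier_pos)
    show "M ^\<^sub>m card (carrier G) = 1\<^sub>m n" if "M \<in> \<rho> ` B" for M
      using that representation_finite_order[OF rep Bc] by auto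
    show "L * M = M * L" if "L \<in> \<rho> ` B" "M \<in> \<rho> ` B" for L M
    proof -
      obtain x y where "x \<in> B" "y \<in> B" "L = \<rho> x" "M = \<rho> y" using \<open>L \<in> \<rho> ` B\<close> \<open>M \<in> \<rho> ` B\<close> by auto
      then show ?thesis
        using representation_mult[OF rep Bc Bc, of x y] representation_mult[OF rep Bc Bc, of y x] B(2)[of x y] by simp
    qed
  qed blast
  then show thesis using that[of P "\<lambda>b. e (\<rho> b)"] by blast
qed

text \<open>The abelian subgroup has a common eigenvector, so it is contained in the stabilizer of a line. The
subrepresentation spanned by the translates of this line is everything.\<close>

lemma irreducible_degree_le_index:
  assumes irr: "irreducible_representation G n \<rho>" and B: "abelian_normal_subgroup B G"
  shows "n * card B \<le> card (carrier G)"
proof -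
  note Bs = abelian_normal_subgroupD[OF B]
  have rep: "representation G n \<rho>" using irr by (simp add: irreducible_representation_def)
  have n: "n > 0" using rep by (simp add: representation_def)
  obtain P e where P: "P \<in> carrier_mat n n" "injective_mat P"
    "\<forall>b\<in>B. \<forall>j<n. \<rho> b *\<^sub>v col P j = e b j \<cdot>\<^sub>v col P j"
    by (rule abelian_simultaneous_eigenbasis[OF rep Bs(1,3)])
  define u where "u = col P 0"
  have u: "u \<in> carrier_vec n" "u \<noteq> 0\<^sub>v n" using P n injective_mat_col_nonzero[OF P(1,2) n] by (auto simp: u_def)
  define H where "H = line_stabilizer \<rho> u"
  have "B \<subseteq> H" using P(3) n Bs(4) unfolding H_def u_def by blast
  moreover have "finite H" using fin by (simp add: H_def)
  ultimately have cB: "card B \<le> card H" by (intro card_mono)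
  obtain k C \<sigma> where k: "irreducible_representation G k \<sigma>" "k * card H \<le> card (carrier G)"
    "C \<in> carrier_mat n k" "injective_mat C" "\<forall>g\<in>carrier G. \<rho> g * C = C * \<sigma> g"
    by (rule irreducible_below_line_stabilizer[OF rep u, folded H_def])
  have reps: "representation G k \<sigma>" using k(1) by (simp add: irreducible_representation_def)
  then have k0: "k > 0" by (simp add: representation_def)
  define W where "W = {C *\<^sub>v x |x. x \<in> carrier_vec k}"
  have "\<rho> g *\<^sub>v w \<in> W" if g: "g \<in> carrier G" and w: "w \<in> W" for g w
  proof -
    obtain x where x: "x \<in> carrier_vec k" "w = C *\<^sub>v x" using w by (auto simp: W_def)
    have "\<rho> g *\<^sub>v w = (\<rho> g * C) *\<^sub>v x" using representation_carrier[OF rep g] k(3) x by simp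
    also have "\<dots> = C *\<^sub>v (\<sigma> g *\<^sub>v x)" using bspec[OF k(5) g] representation_carrier[OF reps g] k(3) x by simp
    finally show ?thesis using representation_carrier[OF reps g] x unfolding W_def by auto
  qed
  moreover have "VectorSpace.subspace class_ring W (module_vec TYPE(complex) n)"
    unfolding linear_subspace_iff_subspace[symmetric] W_def by (rule linear_subspace_range[OF k(3)])
  ultimately have "W = {0\<^sub>v n} \<or> W = carrier_vec n"
    using irr unfolding irreducible_representation_def by blast
  moreover have "W \<noteq> {0\<^sub>v n}"
  proof -
    have "C *\<^sub>v unit_vec k 0 = col C 0" using k(3) k0 by (intro eq_vecI) auto
    then have "col C 0 \<in> W" unfolding W_def by (metis (mono_tags, lifting) mem_Collect_eq unit_vec_carrier)
    then show ?thesis using injective_mat_col_nonzero[OF k(3,4) k0] by auto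
  qed
  ultimately have "W = carrier_vec n" by blast
  then have "n \<le> k" using k(3) unfolding W_def by (intro surjective_mat_dim_le[of C]) blast+
  then have "n * card B \<le> k * card H" using cB by (rule mult_le_mono)
  then show ?thesis using k(2) by simp
qed

lemma conjugation_identity:
  assumes "x \<in> carrier G" "a \<in> carrier G" "b \<in> carrier G"
  shows "inv x \<otimes> (a \<otimes> b) \<otimes> x = (inv x \<otimes> a \<otimes> x) \<otimes> (inv x \<otimes> b \<otimes> x)"
proof -
  have "(inv x \<otimes> a \<otimes> x) \<otimes> (inv x \<otimes> b \<otimes> x) = inv x \<otimes> a \<otimes> (x \<otimes> inv x) \<otimes> b \<otimes> x"
    using assms by (simp only: m_assoc m_closed inv_closed)
  then show ?thesis using assms by (simp add: m_assoc)
qed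

text \<open>Let \<open>\<phi>\<close> be the linear character of \<open>N\<close> that induces the character of \<open>\<sigma>\<close>. It is \<open>1\<close> at all conjugates of a
commutator \<open>c\<close> of \<open>N\<close>, so the trace of \<open>\<sigma> c\<close> is the degree of \<open>\<sigma>\<close>. Hence \<open>\<sigma> c\<close> is the identity, and \<open>c = 1\<close> because
\<open>\<sigma>\<close> is faithful.\<close>

lemma normally_monomial_faithful_degree:
  assumes nm: "normally_monomial G" and irr: "irreducible_representation G n \<sigma>" and inj: "inj_on \<sigma> (carrier G)"
  obtains N where "abelian_normal_subgroup N G" "n * card N = card (carrier G)"
proof -
  have rep: "representation G n \<sigma>" using irr by (simp add: irreducible_representation_def)
  have "character G \<sigma> \<in> Irr G" using irr by (auto simp: Irr_def)
  then obtain N \<phi> where N: "N \<lhd> G" "\<phi> \<in> linear_characters (G\<lparr>carrier := N\<rparr>)"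
    and ind: "character G \<sigma> = induced G N \<phi>"
    using nm unfolding normally_monomial_def by blast
  have sN: "subgroup N G" using N(1) by (rule normal_imp_subgroup)
  have Nc: "\<And>x. x \<in> N \<Longrightarrow> x \<in> carrier G" using subgroup.mem_carrier[OF sN] .
  have "finite_group (G\<lparr>carrier := N\<rparr>)"
    using subgroup_imp_group[OF sN] fin subgroup.subset[OF sN] finite_subset
    by (auto simp: finite_group_def finite_group_axioms_def)
  then interpret N: finite_group "G\<lparr>carrier := N\<rparr>" .
  obtain \<tau> where \<tau>: "representation (G\<lparr>carrier := N\<rparr>) 1 \<tau>" "\<phi> = character (G\<lparr>carrier := N\<rparr>) \<tau>"
    using N(2) by (auto simp: linear_characters_def)
  have \<tau>c: "\<tau> x \<in> carrier_mat 1 1" if "x \<in> N" for x using N.representation_carrier[OF \<tau>(1)] that by simp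
  have \<phi>: "\<phi> x = \<tau> x $$ (0,0)" if "x \<in> N" for x
    using that \<tau>c[OF that] by (simp add: \<tau>(2) character_def mat_trace_def)
  have \<phi>m: "\<phi> (x \<otimes> y) = \<phi> x * \<phi> y" if "x \<in> N" "y \<in> N" for x y
    using N.representation_mult[OF \<tau>(1), of x y] that \<tau>c[OF that(1)] \<tau>c[OF that(2)]
      subgroup.m_closed[OF sN that] by (simp add: \<phi> scalar_prod_def)
  have \<phi>1: "\<phi> \<one> = 1"
    using N.representation_one[OF \<tau>(1)] subgroup.one_closed[OF sN] by (simp add: \<phi>)
  have cN: "card N > 0" using N.card_carrier_pos by simp
  have Nconj: "inv x \<otimes> c \<otimes> x \<in> N" if "x \<in> carrier G" "c \<in> N" for x c
    using normal.inv_op_closed1[OF N(1)] that by blast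
  have val: "mat_trace (\<sigma> c) = (\<Sum>x\<in>carrier G. \<phi> (inv x \<otimes> c \<otimes> x)) / of_nat (card N)" if "c \<in> N" for c
  proof -
    have "{x. x \<in> carrier G \<and> inv x \<otimes> c \<otimes> x \<in> N} = carrier G" using Nconj that by auto
    then show ?thesis using fun_cong[OF ind, of c] Nc[OF that] by (simp add: character_def induced_def)
  qed
  have "mat_trace (\<sigma> \<one>) = of_nat n" using representation_one[OF rep] by (simp add: mat_trace_def)
  then have "of_nat n = (of_nat (card (carrier G)) / of_nat (card N) :: complex)"
    using val[OF subgroup.one_closed[OF sN]] \<phi>1 by simp
  then have deg: "n * card N = card (carrier G)"
    using cN by (simp add: field_simps flip: of_nat_mult)
  have "x \<otimes> y = y \<otimes> x" if xy: "x \<in> N" "y \<in> N" for x y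
  proof -
    define c where "c = x \<otimes> y \<otimes> (inv x \<otimes> inv y)"
    have xyc: "x \<in> carrier G" "y \<in> carrier G" using xy Nc by auto
    have ixy: "inv x \<in> N" "inv y \<in> N" using xy subgroup.m_inv_closed[OF sN] by auto
    have cN': "c \<in> N" using xy ixy subgroup.m_closed[OF sN] by (simp add: c_def)
    have "\<phi> (inv g \<otimes> c \<otimes> g) = 1" if g: "g \<in> carrier G" for g
    proof -
      let ?f = "\<lambda>a. inv g \<otimes> a \<otimes> g"
      have f: "?f (a \<otimes> b) = ?f a \<otimes> ?f b" if "a \<in> N" "b \<in> N" for a b
        using conjugation_identity[OF g] Nc that by blast
      have \<phi>f: "\<phi> (?f (a \<otimes> b)) = \<phi> (?f a) * \<phi> (?f b)" if "a \<in> N" "b \<in> N" for a b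
        using \<phi>m[OF Nconj Nconj] f that g by simp
      have i: "\<phi> (?f a) * \<phi> (?f (inv a)) = 1" if "a \<in> N" for a
        using \<phi>f[OF that subgroup.m_inv_closed[OF sN that]] Nc[OF that] g \<phi>1 by simp
      have "\<phi> (?f c) = (\<phi> (?f x) * \<phi> (?f y)) * (\<phi> (?f (inv x)) * \<phi> (?f (inv y)))"
        unfolding c_def using \<phi>f xy ixy subgroup.m_closed[OF sN] by simp
      also have "\<dots> = (\<phi> (?f x) * \<phi> (?f (inv x))) * (\<phi> (?f y) * \<phi> (?f (inv y)))" by (simp only: mult_ac)
      finally show ?thesis using i[OF xy(1)] i[OF xy(2)] by simp
    qed
    then have "mat_trace (\<sigma> c) = of_nat n"
      using val[OF cN'] cN by (simp add: deg[symmetric])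
    then have "\<sigma> c = 1\<^sub>m n"
      using finite_order_trace_eq_degree representation_carrier[OF rep] representation_finite_order[OF rep]
        Nc[OF cN'] card_carrier_pos by blast
    then have "\<sigma> c = \<sigma> \<one>" using representation_one[OF rep] by simp
    then have "c = \<one>" using inj Nc[OF cN'] by (auto dest: inj_onD)
    then have "x \<otimes> y = inv (inv x \<otimes> inv y)" unfolding c_def using xyc
      by (metis inv_closed inv_equality inv_inv m_closed)
    then show ?thesis using xyc by (simp add: inv_mult_group)
  qed
  then have "comm_group (G\<lparr>carrier := N\<rparr>)" by (intro N.group_comm_groupI) simp
  then show thesis using that deg N(1) by (auto simp: abelian_normal_subgroup_def)
qed

section \<open>Monomial representations\<close>

text \<open>The group permutes a basis through \<open>\<pi>\<close> and multiplies by the factors \<open>c\<close>; the identity for \<open>c\<close> of a product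
is the cocycle condition. Only fixed basis vectors contribute to the trace.\<close>

lemma monomial_representation:
  fixes \<pi> :: "'a \<Rightarrow> 'i \<Rightarrow> 'i" and c :: "'a \<Rightarrow> 'i \<Rightarrow> complex"
  assumes I: "finite I" "I \<noteq> {}" and \<pi>: "\<And>g i. g \<in> carrier G \<Longrightarrow> i \<in> I \<Longrightarrow> \<pi> g i \<in> I"
    and \<pi>1: "\<And>i. i \<in> I \<Longrightarrow> \<pi> \<one> i = i"
    and \<pi>m: "\<And>g h i. g \<in> carrier G \<Longrightarrow> h \<in> carrier G \<Longrightarrow> i \<in> I \<Longrightarrow> \<pi> (g \<otimes> h) i = \<pi> g (\<pi> h i)"
    and c1: "\<And>i. i \<in> I \<Longrightarrow> c \<one> i = 1"
    and cm: "\<And>g h i. g \<in> carrier G \<Longrightarrow> h \<in> carrier G \<Longrightarrow> i \<in> I \<Longrightarrow> c (g \<otimes> h) i = c g (\<pi> h i) * c h i"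
  obtains \<rho> where "representation G (card I) \<rho>"
    "\<And>g. g \<in> carrier G \<Longrightarrow> mat_trace (\<rho> g) = (\<Sum>i | i \<in> I \<and> \<pi> g i = i. c g i)"
proof -
  define n where "n = card I"
  obtain f where f: "bij_betw f {..<n} I"
    using ex_bij_betw_nat_finite[OF I(1)] by (auto simp: n_def atLeast0LessThan)
  have fI: "f b \<in> I" if "b < n" for b using f that by (auto simp: bij_betw_def)
  have finj: "f a = f b \<longleftrightarrow> a = b" if "a < n" "b < n" for a b
    using f that by (auto simp: bij_betw_def inj_on_def)
  define \<rho> where "\<rho> g = mat n n (\<lambda>(a,b). if f a = \<pi> g (f b) then c g (f b) else 0)" for g
  have "representation G n \<rho>"
  proof (rule representationI)
    show "n > 0" using I by (simp add: n_def card_gt_0_iff)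
    show "\<rho> \<one> = 1\<^sub>m n"
      by (rule eq_matI) (auto simp: \<rho>_def \<pi>1 c1 fI finj)
    fix g h assume gh: "g \<in> carrier G" "h \<in> carrier G"
    show "\<rho> (g \<otimes> h) = \<rho> g * \<rho> h"
    proof (rule eq_matI)
      fix a b assume "a < dim_row (\<rho> g * \<rho> h)" "b < dim_col (\<rho> g * \<rho> h)"
      then have ab: "a < n" "b < n" by (auto simp: \<rho>_def)
      obtain j where j: "j < n" "f j = \<pi> h (f b)"
        using \<pi>[OF gh(2) fI[OF ab(2)]] f by (auto simp: bij_betw_def image_iff)
      have "(\<rho> g * \<rho> h) $$ (a,b) = (\<Sum>k<n. (if f a = \<pi> g (f k) then c g (f k) else 0) *
          (if k = j then c h (f b) else 0))"
        using ab by (auto simp: \<rho>_def scalar_prod_def atLeast0LessThan j(2)[symmetric] finj[OF _ j(1)] intro!: sum.cong)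
      also have "\<dots> = (if f a = \<pi> g (f j) then c g (f j) else 0) * c h (f b)"
      proof -
        have "(\<Sum>k<n. (if f a = \<pi> g (f k) then c g (f k) else 0) * (if k = j then c h (f b) else 0)) =
          (\<Sum>k<n. if k = j then (if f a = \<pi> g (f j) then c g (f j) else 0) * c h (f b) else 0)"
          by (intro sum.cong) auto
        then show ?thesis using j(1) by simp
      qed
      also have "\<dots> = \<rho> (g \<otimes> h) $$ (a,b)"
        using ab \<pi>m[OF gh fI[OF ab(2)]] cm[OF gh fI[OF ab(2)]] j(2) by (simp add: \<rho>_def)
      finally show "\<rho> (g \<otimes> h) $$ (a,b) = (\<rho> g * \<rho> h) $$ (a,b)" by simp
    qed (auto simp: \<rho>_def)
  qed (auto simp: \<rho>_def)
  moreover have "mat_trace (\<rho> g) = (\<Sum>i | i \<in> I \<and> \<pi> g i = i. c g i)" if "g \<in> carrier G" for g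
  proof -
    have "mat_trace (\<rho> g) = (\<Sum>a<n. if \<pi> g (f a) = f a then c g (f a) else 0)"
      by (auto simp: mat_trace_def \<rho>_def intro!: sum.cong)
    also have "\<dots> = (\<Sum>i\<in>I. if \<pi> g i = i then c g i else 0)"
      by (rule sum.reindex_bij_betw[OF f])
    also have "\<dots> = (\<Sum>i | i \<in> I \<and> \<pi> g i = i. c g i)"
      using I(1) by (simp add: sum.inter_filter)
    finally show ?thesis .
  qed
  ultimately show thesis using that unfolding n_def by blast
qed

lemma regular_representation:
  obtains \<rho> where "representation G (card (carrier G)) \<rho>" "inj_on \<rho> (carrier G)"
    "\<And>g. g \<in> carrier G \<Longrightarrow> mat_trace (\<rho> g) \<in> \<nat>"
proof -
  obtain \<rho> where \<rho>: "representation G (card (carrier G)) \<rho>"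
    "\<And>g. g \<in> carrier G \<Longrightarrow> mat_trace (\<rho> g) = (\<Sum>i | i \<in> carrier G \<and> g \<otimes> i = i. 1)"
    using monomial_representation[of "carrier G" "\<lambda>g i. g \<otimes> i" "\<lambda>_ _. 1"] fin one_closed m_assoc
    by auto
  have "g = h" if gh: "g \<in> carrier G" "h \<in> carrier G" "\<rho> g = \<rho> h" for g h
  proof -
    have "\<rho> (inv g \<otimes> h) = \<rho> \<one>"
      using representation_mult[OF \<rho>(1), of "inv g"] gh by (metis inv_closed l_inv)
    then have "card {i. i \<in> carrier G \<and> inv g \<otimes> h \<otimes> i = i} = card (carrier G)"
      using \<rho>(2)[of "inv g \<otimes> h"] \<rho>(2)[of \<one>] gh by (auto cong: conj_cong)
    then have "{i. i \<in> carrier G \<and> inv g \<otimes> h \<otimes> i = i} = carrier G"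
      using fin by (intro card_subset_eq) auto
    then have "inv g \<otimes> h \<otimes> \<one> = \<one>" using one_closed by blast
    then show "g = h" using gh by (metis inv_closed inv_equality inv_inv m_closed r_one)
  qed
  then show thesis using that \<rho> by (auto simp: inj_on_def)
qed

section \<open>Finite p-groups with cyclic center\<close>

lemma center_subset: "center G \<subseteq> carrier G" by (auto simp: center_def)

lemma center_commutes: "y \<in> center G \<Longrightarrow> g \<in> carrier G \<Longrightarrow> y \<otimes> g = g \<otimes> y"
  by (simp add: center_def)

lemma center_abelian_normal: "abelian_normal_subgroup (center G) G"
proof -
  have Zs: "subgroup (center G) G"
  proof (rule subgroupI)
    show "center G \<noteq> {}" by (auto simp: center_def intro!: exI[of _ \<one>])
    fix a assume a: "a \<in> center G"
    have ac: "a \<in> carrier G" using a center_subset by blast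
    have "inv a \<otimes> g = g \<otimes> inv a" if g: "g \<in> carrier G" for g
    proof -
      have "inv a \<otimes> (g \<otimes> a) \<otimes> inv a = inv a \<otimes> (a \<otimes> g) \<otimes> inv a" using center_commutes[OF a g] by simp
      moreover have "inv a \<otimes> (g \<otimes> a) \<otimes> inv a = inv a \<otimes> g" using ac g by (simp add: m_assoc)
      moreover have "inv a \<otimes> (a \<otimes> g) \<otimes> inv a = g \<otimes> inv a" using ac g by (simp add: m_assoc[symmetric])
      ultimately show ?thesis by simp
    qed
    then show "inv a \<in> center G" using ac by (simp add: center_def)
  next
    fix a b assume ab: "a \<in> center G" "b \<in> center G"
    have abc: "a \<in> carrier G" "b \<in> carrier G" using ab center_subset by auto
    have "a \<otimes> b \<otimes> g = g \<otimes> (a \<otimes> b)" if g: "g \<in> carrier G" for g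
    proof -
      have "a \<otimes> b \<otimes> g = a \<otimes> (b \<otimes> g)" by (rule m_assoc[OF abc g])
      also have "\<dots> = a \<otimes> g \<otimes> b" using center_commutes[OF ab(2) g] m_assoc[OF abc(1) g abc(2)] by simp
      also have "\<dots> = g \<otimes> (a \<otimes> b)" using center_commutes[OF ab(1) g] m_assoc[OF g abc] by simp
      finally show ?thesis .
    qed
    then show "a \<otimes> b \<in> center G" using abc by (simp add: center_def)
  qed (rule center_subset)
  have "center G \<lhd> G"
    unfolding normal_inv_iff
  proof (intro conjI ballI Zs)
    fix x a assume x: "x \<in> carrier G" and a: "a \<in> center G"
    have ac: "a \<in> carrier G" using a center_subset by blast
    have "x \<otimes> a \<otimes> inv x = a \<otimes> x \<otimes> inv x" using center_commutes[OF a x] by simp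
    also have "\<dots> = a" using x ac by (simp add: m_assoc)
    finally show "x \<otimes> a \<otimes> inv x \<in> center G" using a by simp
  qed
  moreover have "comm_group (G\<lparr>carrier := center G\<rparr>)"
    using center_commutes center_subset
    by (intro group.group_comm_groupI subgroup_imp_group[OF Zs]) auto
  ultimately show ?thesis by (simp add: abelian_normal_subgroup_def)
qed

end

locale finite_p_group = finite_group +
  fixes p m :: nat
  assumes prime: "prime p" and card_G: "card (carrier G) = p ^ m"
begin

lemma p_gt_1: "p > 1" using prime by (rule prime_gt_1_nat)

lemma p_power_of_dvd: "d dvd card (carrier G) \<Longrightarrow> \<exists>j. d = p ^ j"
  unfolding card_G using divides_primepow_nat[OF prime] by blast

text \<open>The conjugacy classes in \<open>N\<close> have \<open>p\<close>-power sizes that add up to \<open>|N|\<close>, a multiple of \<open>p\<close>. Besides the class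
of the identity there must be another class of size prime to \<open>p\<close>, hence of size \<open>1\<close>.\<close>

lemma normal_subgroup_meets_center:
  assumes N: "N \<lhd> G" "N \<noteq> {\<one>}"
  obtains y where "y \<in> N" "y \<in> center G" "y \<noteq> \<one>"
proof -
  have sN: "subgroup N G" using N(1) by (rule normal_imp_subgroup)
  have Nc: "N \<subseteq> carrier G" using subgroup.subset[OF sN] .
  define cl where "cl y = (\<lambda>g. g \<otimes> y \<otimes> inv g) ` carrier G" for y
  define St where "St y = {g \<in> carrier G. g \<otimes> y = y \<otimes> g}" for y
  have eq_iff: "g \<otimes> y \<otimes> inv g = h \<otimes> y \<otimes> inv h \<longleftrightarrow> inv g \<otimes> h \<in> St y"
    if y: "y \<in> carrier G" and gh: "g \<in> carrier G" "h \<in> carrier G" for g h y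
  proof -
    have 1: "inv g \<otimes> (g \<otimes> y \<otimes> inv g) \<otimes> h = y \<otimes> (inv g \<otimes> h)"
      using gh y by (simp add: m_assoc[symmetric])
    have 2: "inv g \<otimes> (h \<otimes> y \<otimes> inv h) \<otimes> h = inv g \<otimes> h \<otimes> y"
      using gh y by (simp add: m_assoc)
    have 3: "g \<otimes> (y \<otimes> (inv g \<otimes> h)) \<otimes> inv h = g \<otimes> y \<otimes> inv g"
      using gh y by (simp add: m_assoc)
    have 4: "g \<otimes> (inv g \<otimes> h \<otimes> y) \<otimes> inv h = h \<otimes> y \<otimes> inv h"
      using gh y by (simp add: m_assoc[symmetric])
    have "g \<otimes> y \<otimes> inv g = h \<otimes> y \<otimes> inv h \<longleftrightarrow> y \<otimes> (inv g \<otimes> h) = inv g \<otimes> h \<otimes> y"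
      using 1 2 3 4 by metis
    then show ?thesis using gh by (auto simp: St_def)
  qed
  have St: "subgroup (St y) G" if y: "y \<in> carrier G" for y
  proof (rule subgroupI)
    show "St y \<noteq> {}" using y by (auto simp: St_def intro!: exI[of _ \<one>])
    fix g assume "g \<in> St y"
    then have g: "g \<in> carrier G" "g \<otimes> y = y \<otimes> g" by (auto simp: St_def)
    have "inv g \<otimes> y = inv g \<otimes> y \<otimes> (g \<otimes> inv g)" using g y by simp
    also have "\<dots> = inv g \<otimes> (y \<otimes> g) \<otimes> inv g" using g(1) y by (simp only: m_assoc m_closed inv_closed)
    also have "\<dots> = inv g \<otimes> (g \<otimes> y) \<otimes> inv g" using g(2) by simp
    also have "\<dots> = y \<otimes> inv g" using g(1) y by (simp add: m_assoc[symmetric])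
    finally show "inv g \<in> St y" using g by (simp add: St_def)
  next
    fix g h assume "g \<in> St y" "h \<in> St y"
    then have gh: "g \<in> carrier G" "h \<in> carrier G" "g \<otimes> y = y \<otimes> g" "h \<otimes> y = y \<otimes> h" by (auto simp: St_def)
    have "g \<otimes> h \<otimes> y = g \<otimes> (h \<otimes> y)" by (rule m_assoc[OF gh(1,2) y])
    also have "\<dots> = g \<otimes> y \<otimes> h" using gh(4) m_assoc[OF gh(1) y gh(2)] by simp
    also have "\<dots> = y \<otimes> g \<otimes> h" using gh(3) by simp
    also have "\<dots> = y \<otimes> (g \<otimes> h)" by (rule m_assoc[OF y gh(1,2)])
    finally show "g \<otimes> h \<in> St y" using gh by (simp add: St_def)
  qed (auto simp: St_def)
  have cl_card: "card (cl y) * card (St y) = card (carrier G)" if "y \<in> carrier G" for y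
    unfolding cl_def using card_image_of_cosets[OF St[OF that] eq_iff[OF that]] by simp
  have self: "y \<in> cl y" if "y \<in> carrier G" for y
    using that by (auto simp: cl_def image_iff intro!: bexI[of _ \<one>])
  have sub: "cl y \<subseteq> N" if "y \<in> N" for y
    using N(1) that unfolding normal_inv_iff cl_def by auto
  have cl_eq: "cl x = cl y" if xy: "x \<in> cl y" and y: "y \<in> carrier G" for x y
  proof -
    obtain g where g: "g \<in> carrier G" "x = g \<otimes> y \<otimes> inv g" using xy by (auto simp: cl_def)
    have e: "h \<otimes> x \<otimes> inv h = (h \<otimes> g) \<otimes> y \<otimes> inv (h \<otimes> g)" if "h \<in> carrier G" for h
      using that g y by (simp add: m_assoc inv_mult_group)
    have "cl x \<subseteq> cl y" unfolding cl_def using e g(1) by auto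
    moreover have "h \<otimes> y \<otimes> inv h \<in> cl x" if "h \<in> carrier G" for h
    proof -
      have "h \<otimes> y \<otimes> inv h = (h \<otimes> inv g) \<otimes> x \<otimes> inv (h \<otimes> inv g)"
      proof -
        have "h \<otimes> inv g \<otimes> g = h" using that g(1) by (simp add: m_assoc)
        then show ?thesis using e[of "h \<otimes> inv g"] that g(1) by simp
      qed
      moreover have "h \<otimes> inv g \<in> carrier G" using that g(1) by simp
      ultimately show ?thesis unfolding cl_def by (rule image_eqI)
    qed
    then have "cl y \<subseteq> cl x" unfolding cl_def[of y] by auto
    ultimately show ?thesis by blast
  qed
  have finN: "finite N" using Nc fin finite_subset by blast
  have "\<exists>y\<in>N. y \<noteq> \<one> \<and> \<not> p dvd card (cl y)"
  proof (rule ccontr)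
    assume "\<not> ?thesis"
    then have pd: "p dvd card (cl y)" if "y \<in> N" "y \<noteq> \<one>" for y using that by blast
    have "\<Union>(cl ` (N - {\<one>})) = N - {\<one>}"
    proof (intro equalityI subsetI)
      fix x assume "x \<in> \<Union>(cl ` (N - {\<one>}))"
      then obtain y where y: "y \<in> N" "y \<noteq> \<one>" "x \<in> cl y" by auto
      have yc: "y \<in> carrier G" using y Nc by auto
      have "x \<noteq> \<one>"
      proof
        assume "x = \<one>"
        then have "y \<in> cl \<one>" using cl_eq[OF y(3) yc] self[OF yc] by simp
        then show False using y(2) by (auto simp: cl_def)
      qed
      then show "x \<in> N - {\<one>}" using sub y by blast
    next
      fix x assume "x \<in> N - {\<one>}"
      then show "x \<in> \<Union>(cl ` (N - {\<one>}))" using self Nc by blast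
    qed
    moreover have "card (\<Union>(cl ` (N - {\<one>}))) = (\<Sum>c\<in>cl ` (N - {\<one>}). card c)"
    proof (rule card_Union_disjoint)
      show "pairwise disjnt (cl ` (N - {\<one>}))"
      proof (rule pairwiseI)
        fix a b assume ab: "a \<in> cl ` (N - {\<one>})" "b \<in> cl ` (N - {\<one>})" "a \<noteq> b"
        show "disjnt a b"
        proof (rule ccontr)
          assume "\<not> disjnt a b"
          then obtain x where "x \<in> a" "x \<in> b" by (auto simp: disjnt_def)
          then show False using ab cl_eq Nc by (metis Diff_iff imageE subsetD)
        qed
      qed
    qed (use fin in \<open>auto simp: cl_def\<close>)
    moreover have "p dvd (\<Sum>c\<in>cl ` (N - {\<one>}). card c)"
      by (rule dvd_sum) (use pd in auto)
    ultimately have "p dvd card (N - {\<one>})" by simp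
    then have d1: "p dvd card N - 1" using subgroup.one_closed[OF sN] finN by simp
    have "card N dvd card (carrier G)" using lagrange[OF sN] by (metis Coset.order_def dvd_triv_right)
    then obtain j where j: "card N = p ^ j" using p_power_of_dvd by blast
    have "card N \<noteq> 1"
      using N(2) subgroup.one_closed[OF sN] by (metis card_1_singletonE singletonD)
    then have "p dvd card N" using j by (cases j) auto
    moreover have "card N = Suc (card N - 1)" using finN subgroup.one_closed[OF sN] by (metis Suc_pred' card_gt_0_iff empty_iff)
    ultimately have "p dvd 1" using d1 by (metis Suc_eq_plus1 dvd_add_right_iff)
    then show False using p_gt_1 by simp
  qed
  then obtain y where y: "y \<in> N" "y \<noteq> \<one>" "\<not> p dvd card (cl y)" by blast
  have yc: "y \<in> carrier G" using y Nc by auto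
  obtain j where "card (cl y) = p ^ j" using p_power_of_dvd cl_card[OF yc] by (metis dvd_triv_left)
  then have "card (cl y) = 1" using y(3) by (cases j) auto
  then have cly: "cl y = {y}" using self[OF yc] by (metis card_1_singletonE singletonD)
  have "y \<otimes> g = g \<otimes> y" if g: "g \<in> carrier G" for g
  proof -
    have "g \<otimes> y \<otimes> inv g = y" using cly g unfolding cl_def by blast
    then show ?thesis using g yc by (metis inv_solve_right' m_closed)
  qed
  then have "y \<in> center G" using yc by (simp add: center_def)
  then show thesis using that y by blast
qed

end

locale cyclic_center_p_group = finite_p_group +
  fixes r :: nat and z0
  assumes z0: "z0 \<in> carrier G" "center G = {z0 [^] (i::nat) |i. True}" "ord z0 = p ^ r" and r: "0 < r"
begin

text \<open>A generator of the subgroup of order \<open>p\<close> of the center, the only minimal normal subgroup of the group.\<close>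

definition z where "z = z0 [^] (p ^ (r - 1))"

lemma z0_pow_eq_1_iff: "z0 [^] (i::nat) = \<one> \<longleftrightarrow> p ^ r dvd i"
  using pow_eq_id[OF z0(1)] z0(3) by simp

lemma z_pow_eq_1_iff: "z [^] (i::nat) = \<one> \<longleftrightarrow> p dvd i"
proof -
  have "z [^] i = z0 [^] (p ^ (r - 1) * i)" using z0(1) by (simp add: z_def nat_pow_pow)
  then have "z [^] i = \<one> \<longleftrightarrow> p ^ r dvd p ^ (r - 1) * i" by (simp add: z0_pow_eq_1_iff)
  also have "p ^ r = p ^ (r - 1) * p" using r by (metis Suc_diff_1 power_Suc2)
  finally show ?thesis using p_gt_1 by simp
qed

lemma z_center: "z \<in> center G" "z \<in> carrier G"
  using z0(1,2) by (auto simp: z_def)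

lemma z_neq_one: "z \<noteq> \<one>"
  using z_pow_eq_1_iff[of 1] z_center(2) p_gt_1 by simp

lemma card_center: "card (center G) = p ^ r"
proof -
  have "center G = (\<lambda>i. z0 [^] i) ` {..<p ^ r}"
  proof (intro equalityI subsetI)
    fix y assume "y \<in> center G"
    then obtain i :: nat where i: "y = z0 [^] i" using z0(2) by auto
    have "z0 [^] i = z0 [^] (p ^ r * (i div p ^ r)) \<otimes> z0 [^] (i mod p ^ r)"
      using z0(1) by (simp add: nat_pow_mult)
    also have "z0 [^] (p ^ r * (i div p ^ r)) = \<one>" using z0_pow_eq_1_iff by simp
    finally have "z0 [^] i = z0 [^] (i mod p ^ r)" using z0(1) by simp
    moreover have "i mod p ^ r < p ^ r" using p_gt_1 by simp
    ultimately show "y \<in> (\<lambda>i. z0 [^] i) ` {..<p ^ r}" using i by auto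
  qed (use z0(2) in auto)
  moreover have "inj_on (\<lambda>i. z0 [^] i) {..<p ^ r}"
    using ord_inj[OF z0(1)] unfolding z0(3) by (rule inj_on_subset) auto
  ultimately show ?thesis by (simp add: card_image)
qed

text \<open>A nontrivial element of \<open>N\<close> in the cyclic center is \<open>z0^(p^t b)\<close> with \<open>t < r\<close> and \<open>b\<close> prime to \<open>p\<close>. A suitable
\<open>p\<close>-power of it is \<open>z^b\<close>, which generates the same subgroup as \<open>z\<close>.\<close>

lemma normal_subgroup_contains_z:
  assumes N: "N \<lhd> G" "N \<noteq> {\<one>}"
  shows "z \<in> N"
proof -
  obtain y where y: "y \<in> N" "y \<in> center G" "y \<noteq> \<one>" by (rule normal_subgroup_meets_center[OF N])
  have sN: "subgroup N G" using N(1) by (rule normal_imp_subgroup)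
  have Npow: "x [^] (i::nat) \<in> N" if "x \<in> N" for x i
    by (induction i) (use that subgroup.one_closed[OF sN] subgroup.m_closed[OF sN] in auto)
  obtain a :: nat where a: "y = z0 [^] a" using y(2) z0(2) by auto
  have na: "\<not> p ^ r dvd a" using y(3) a z0_pow_eq_1_iff by simp
  then have "a \<noteq> 0" by (metis dvd_0_right)
  define t where "t = multiplicity p a"
  obtain b where b: "a = p ^ t * b" "\<not> p dvd b"
    using multiplicity_decompose'[of a p] \<open>a \<noteq> 0\<close> p_gt_1 unfolding t_def by (metis nat_dvd_1_iff_1 nat_neq_iff)
  have tr: "t < r" using na b(1) by (metis dvd_mult2 le_imp_power_dvd not_less)
  have "y [^] (p ^ (r - 1 - t)) = z [^] b"
  proof -
    have e: "p ^ (r - 1) = p ^ t * p ^ (r - 1 - t)" using tr by (simp add: power_add[symmetric])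
    have "y [^] (p ^ (r - 1 - t)) = z0 [^] (a * p ^ (r - 1 - t))" using a z0(1) by (simp add: nat_pow_pow)
    also have "a * p ^ (r - 1 - t) = p ^ (r - 1) * b" using b(1) e by simp
    finally show ?thesis using z0(1) by (simp add: z_def nat_pow_pow)
  qed
  then have zb: "z [^] b \<in> N" using Npow[OF y(1)] by metis
  have "coprime b p" using b(2) prime by (metis coprime_commute prime_imp_coprime_nat)
  then obtain c where c: "[b * c = 1] (mod p)" using cong_solve_coprime_nat by auto
  obtain d where d: "b * c = 1 + p * d"
    using c p_gt_1 by (metis cong_def div_mult_mod_eq mod_less add.commute mult.commute)
  have "(z [^] b) [^] c = z [^] (b * c)" using z_center(2) by (simp add: nat_pow_pow)
  also have "\<dots> = z [^] (p * d) \<otimes> z" using z_center(2) d by simp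
  also have "z [^] (p * d) = \<one>" using z_pow_eq_1_iff by simp
  finally have "(z [^] b) [^] c = z" using z_center(2) by simp
  then show ?thesis using Npow[OF zb] by metis
qed

lemma faithful_if_nontrivial_on_z:
  assumes rep: "representation G n \<sigma>" and nz: "\<sigma> z \<noteq> 1\<^sub>m n"
  shows "inj_on \<sigma> (carrier G)"
proof -
  define K where "K = {g \<in> carrier G. \<sigma> g = 1\<^sub>m n}"
  note rc = representation_carrier[OF rep]
  have KN: "K \<lhd> G"
    unfolding normal_inv_iff
  proof (intro conjI ballI subgroupI)
    show "K \<subseteq> carrier G" "K \<noteq> {}" using representation_one[OF rep] by (auto simp: K_def)
    fix g assume g: "g \<in> K"
    then have gc: "g \<in> carrier G" "\<sigma> g = 1\<^sub>m n" by (auto simp: K_def)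
    have "1\<^sub>m n = \<sigma> (inv g) * \<sigma> g"
      using representation_mult[OF rep inv_closed[OF gc(1)] gc(1)] gc representation_one[OF rep] by simp
    then have "\<sigma> (inv g) = 1\<^sub>m n" using gc rc[OF inv_closed[OF gc(1)]] by simp
    then show "inv g \<in> K" using gc by (simp add: K_def)
  next
    fix g h assume "g \<in> K" "h \<in> K"
    then show "g \<otimes> h \<in> K" using representation_mult[OF rep] by (simp add: K_def)
  next
    fix x h assume x: "x \<in> carrier G" and "h \<in> K"
    then have h: "h \<in> carrier G" "\<sigma> h = 1\<^sub>m n" by (auto simp: K_def)
    have "\<sigma> (x \<otimes> h \<otimes> inv x) = \<sigma> x * 1\<^sub>m n * \<sigma> (inv x)" using x h representation_mult[OF rep] by simp
    also have "\<dots> = \<sigma> (x \<otimes> inv x)" using x rc[OF x] representation_mult[OF rep x inv_closed[OF x]] by simp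
    finally show "x \<otimes> h \<otimes> inv x \<in> K" using x h representation_one[OF rep] by (simp add: K_def)
  qed
  have "z \<notin> K" using nz by (simp add: K_def)
  then have K1: "K = {\<one>}" using normal_subgroup_contains_z[OF KN] by blast
  show ?thesis
  proof (rule inj_onI)
    fix g h assume gh: "g \<in> carrier G" "h \<in> carrier G" "\<sigma> g = \<sigma> h"
    have "\<sigma> (inv g \<otimes> h) = \<sigma> (inv g) * \<sigma> g" using representation_mult[OF rep] gh by simp
    also have "\<dots> = 1\<^sub>m n" using representation_mult[OF rep inv_closed[OF gh(1)] gh(1)] gh representation_one[OF rep] by simp
    finally have "inv g \<otimes> h \<in> K" using gh by (simp add: K_def)
    then have "inv g \<otimes> h = \<one>" using K1 by simp
    then show "g = h" using gh by (metis inv_closed inv_equality inv_inv m_closed)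
  qed
qed

end

section \<open>Linear characters of an abelian normal subgroup\<close>

locale abelian_normal = finite_group +
  fixes A
  assumes A: "abelian_normal_subgroup A G"
begin

lemmas A_facts = abelian_normal_subgroupD[OF A]

lemma A_carrier: "a \<in> A \<Longrightarrow> a \<in> carrier G" using A_facts(4) by blast

lemma A_closed: "\<one> \<in> A" "a \<in> A \<Longrightarrow> b \<in> A \<Longrightarrow> a \<otimes> b \<in> A" "a \<in> A \<Longrightarrow> inv a \<in> A"
  "a \<in> A \<Longrightarrow> a [^] (k::nat) \<in> A"
proof -
  show "\<one> \<in> A" "a \<in> A \<Longrightarrow> b \<in> A \<Longrightarrow> a \<otimes> b \<in> A" "a \<in> A \<Longrightarrow> inv a \<in> A"
    using A_facts(1) by (auto simp: subgroup.one_closed subgroup.m_closed subgroup.m_inv_closed)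
  then show "a \<in> A \<Longrightarrow> a [^] (k::nat) \<in> A"
    using subgroup.m_closed[OF A_facts(1)] by (induction k) auto
qed

lemma card_A_pos: "card A > 0" using A_facts(5) A_closed(1) by (auto simp: card_gt_0_iff)

text \<open>Linear characters of \<open>A\<close> are extended by zero, so that characters which agree on \<open>A\<close> are equal as
functions and can be counted.\<close>

definition is_char :: "('a \<Rightarrow> complex) \<Rightarrow> bool" where
  "is_char \<nu> \<longleftrightarrow> (\<forall>x. x \<notin> A \<longrightarrow> \<nu> x = 0) \<and> \<nu> \<one> = 1 \<and> (\<forall>x\<in>A. \<forall>y\<in>A. \<nu> (x \<otimes> y) = \<nu> x * \<nu> y)"

definition twist :: "'a \<Rightarrow> ('a \<Rightarrow> complex) \<Rightarrow> 'a \<Rightarrow> complex" where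
  "twist g \<nu> = (\<lambda>x. if x \<in> A then \<nu> (inv g \<otimes> x \<otimes> g) else 0)"

definition char_power :: "nat \<Rightarrow> ('a \<Rightarrow> complex) \<Rightarrow> 'a \<Rightarrow> complex" where
  "char_power s \<nu> = (\<lambda>x. \<nu> x ^ s)"

lemma char_pow: assumes "is_char \<nu>" "a \<in> A" shows "\<nu> (a [^] (k::nat)) = \<nu> a ^ k"
  using assms A_closed(4) by (induction k) (auto simp: is_char_def)

lemma char_root_of_unity:
  assumes "is_char \<nu>" "a \<in> A"
  shows "\<nu> a ^ card (carrier G) = 1"
proof -
  have "a [^] card (carrier G) = \<one>" using pow_order_eq_1[OF A_carrier[OF assms(2)]] by (simp add: Coset.order_def)
  then show ?thesis using char_pow[OF assms, of "card (carrier G)"] assms(1) by (simp add: is_char_def)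
qed

lemma char_inv:
  assumes "is_char \<nu>" "a \<in> A"
  shows "\<nu> a * \<nu> (inv a) = 1"
proof -
  have "\<nu> (a \<otimes> inv a) = \<nu> a * \<nu> (inv a)" using assms A_closed(3) by (simp add: is_char_def)
  then show ?thesis using assms A_carrier by (simp add: is_char_def)
qed

lemma char_eqI:
  assumes "is_char \<chi>" "is_char \<nu>" "\<And>a. a \<in> A \<Longrightarrow> \<chi> a = \<nu> a"
  shows "\<chi> = \<nu>"
  using assms by (intro ext) (metis is_char_def)

text \<open>If the characters differ at \<open>b\<close>, translating the summation variable by \<open>b\<close> multiplies the sum by a
factor different from \<open>1\<close>.\<close>

lemma char_orthogonality:
  assumes \<chi>: "is_char \<chi>" and \<nu>: "is_char \<nu>"
  shows "(\<Sum>a\<in>A. \<chi> a * \<nu> (inv a)) = (if \<chi> = \<nu> then of_nat (card A) else 0)"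
proof (cases "\<chi> = \<nu>")
  case True
  then show ?thesis using char_inv[OF \<nu>] by simp
next
  case False
  then obtain b where b: "b \<in> A" "\<chi> b \<noteq> \<nu> b" using char_eqI[OF \<chi> \<nu>] by blast
  have bij: "bij_betw (\<lambda>a. b \<otimes> a) A A"
  proof (rule bij_betwI[where g = "\<lambda>a. inv b \<otimes> a"])
    show "inv b \<otimes> (b \<otimes> x) = x" if "x \<in> A" for x
      using A_carrier[OF that] A_carrier[OF b(1)] by (simp add: m_assoc[symmetric])
    show "b \<otimes> (inv b \<otimes> x) = x" if "x \<in> A" for x
      using A_carrier[OF that] A_carrier[OF b(1)] by (simp add: m_assoc[symmetric])
  qed (use b A_closed in auto)
  define S where "S = (\<Sum>a\<in>A. \<chi> a * \<nu> (inv a))"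
  have "S = (\<Sum>a\<in>A. \<chi> (b \<otimes> a) * \<nu> (inv (b \<otimes> a)))"
    unfolding S_def by (rule sum.reindex_bij_betw[OF bij, symmetric])
  also have "\<dots> = (\<Sum>a\<in>A. (\<chi> b * \<nu> (inv b)) * (\<chi> a * \<nu> (inv a)))"
  proof (intro sum.cong refl)
    fix a assume a: "a \<in> A"
    have "inv (b \<otimes> a) = inv b \<otimes> inv a"
      using A_facts(3)[OF b(1) a] A_carrier[OF a] A_carrier[OF b(1)] by (simp add: inv_mult_group)
    then show "\<chi> (b \<otimes> a) * \<nu> (inv (b \<otimes> a)) = (\<chi> b * \<nu> (inv b)) * (\<chi> a * \<nu> (inv a))"
      using \<chi> \<nu> a b(1) A_closed(3) by (simp add: is_char_def)
  qed
  also have "\<dots> = \<chi> b * \<nu> (inv b) * S" by (simp add: S_def sum_distrib_left)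
  finally have "(\<chi> b * \<nu> (inv b) - 1) * S = 0" by (simp add: algebra_simps)
  moreover have "\<chi> b * \<nu> (inv b) \<noteq> 1"
  proof
    assume "\<chi> b * \<nu> (inv b) = 1"
    then have "\<chi> b * \<nu> (inv b) = \<nu> b * \<nu> (inv b)" using char_inv[OF \<nu> b(1)] by simp
    moreover have "\<nu> (inv b) \<noteq> 0" using char_inv[OF \<nu> b(1)] by auto
    ultimately show False using b(2) by simp
  qed
  ultimately show ?thesis using False by (simp add: S_def)
qed

lemma conj_in_A: "g \<in> carrier G \<Longrightarrow> a \<in> A \<Longrightarrow> inv g \<otimes> a \<otimes> g \<in> A"
  using A_facts(6) by blast

lemma twist_char:
  assumes "g \<in> carrier G" "is_char \<nu>"
  shows "is_char (twist g \<nu>)"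
  unfolding is_char_def
proof (intro conjI ballI allI impI)
  show "twist g \<nu> \<one> = 1" using assms A_closed(1) by (simp add: twist_def is_char_def)
  fix x y assume xy: "x \<in> A" "y \<in> A"
  then show "twist g \<nu> (x \<otimes> y) = twist g \<nu> x * twist g \<nu> y"
    using assms A_closed(2) conj_in_A conjugation_identity[OF assms(1) A_carrier A_carrier]
    by (simp add: twist_def is_char_def)
qed (simp add: twist_def)

lemma char_power_char:
  assumes "is_char \<nu>" "s > 0"
  shows "is_char (char_power s \<nu>)"
  using assms by (auto simp: is_char_def char_power_def power_mult_distrib)

lemma twist_twist:
  assumes "g \<in> carrier G" "h \<in> carrier G"
  shows "twist (g \<otimes> h) \<nu> = twist g (twist h \<nu>)"
proof
  fix x
  show "twist (g \<otimes> h) \<nu> x = twist g (twist h \<nu>) x"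
  proof (cases "x \<in> A")
    case True
    then have "inv (g \<otimes> h) \<otimes> x \<otimes> (g \<otimes> h) = inv h \<otimes> (inv g \<otimes> x \<otimes> g) \<otimes> h"
      using assms A_carrier by (simp add: inv_mult_group m_assoc)
    then show ?thesis using True conj_in_A[OF assms(1)] by (simp add: twist_def)
  qed (simp add: twist_def)
qed

lemma twist_one: "is_char \<nu> \<Longrightarrow> twist \<one> \<nu> = \<nu>"
  using A_carrier by (auto simp: twist_def is_char_def fun_eq_iff)

lemma twist_inv:
  assumes "g \<in> carrier G" "is_char \<nu>"
  shows "twist (inv g) (twist g \<nu>) = \<nu>" "twist g (twist (inv g) \<nu>) = \<nu>"
  using twist_twist[of "inv g" g \<nu>] twist_twist[of g "inv g" \<nu>] assms by (simp_all add: twist_one)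

lemma twist_A:
  assumes "g \<in> A" "is_char \<nu>"
  shows "twist g \<nu> = \<nu>"
proof
  fix x
  show "twist g \<nu> x = \<nu> x"
  proof (cases "x \<in> A")
    case True
    have "inv g \<otimes> x \<otimes> g = inv g \<otimes> (g \<otimes> x)"
      using A_facts(3)[OF True assms(1)] A_carrier[OF True] A_carrier[OF assms(1)] by (simp add: m_assoc)
    also have "\<dots> = x" using A_carrier[OF True] A_carrier[OF assms(1)] by (simp add: m_assoc[symmetric])
    finally show ?thesis using True by (simp add: twist_def)
  qed (use assms in \<open>simp add: twist_def is_char_def\<close>)
qed

lemma char_power_twist:
  assumes "s > 0"
  shows "char_power s (twist g \<nu>) = twist g (char_power s \<nu>)"
  using assms by (auto simp: char_power_def twist_def fun_eq_iff)

lemma char_power_power: "char_power s (char_power t \<nu>) = char_power (t * s) \<nu>"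
  by (auto simp: char_power_def fun_eq_iff power_mult)

lemma restriction_decomposition:
  assumes rep: "representation G n \<rho>"
  obtains \<chi> :: "nat \<Rightarrow> 'a \<Rightarrow> complex" where "\<forall>i<n. is_char (\<chi> i)"
    "\<forall>a\<in>A. mat_trace (\<rho> a) = (\<Sum>i<n. \<chi> i a)"
    "\<forall>i<n. \<exists>u. u \<in> carrier_vec n \<and> u \<noteq> 0\<^sub>v n \<and> (\<forall>a\<in>A. \<rho> a *\<^sub>v u = \<chi> i a \<cdot>\<^sub>v u)"
    "\<forall>a\<in>A. (\<forall>i<n. \<chi> i a = 1) \<longrightarrow> \<rho> a = 1\<^sub>m n"
proof -
  note rc = representation_carrier[OF rep A_carrier]
  obtain P e where P: "P \<in> carrier_mat n n" "injective_mat P"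
    and e: "\<forall>b\<in>A. \<forall>j<n. \<rho> b *\<^sub>v col P j = e b j \<cdot>\<^sub>v col P j"
    by (rule abelian_simultaneous_eigenbasis[OF rep A_facts(1,3)])
  define \<chi> where "\<chi> i = (\<lambda>a. if a \<in> A then e a i else 0)" for i :: nat
  have ev: "\<rho> a *\<^sub>v col P i = \<chi> i a \<cdot>\<^sub>v col P i" if "a \<in> A" "i < n" for a i
    using e that by (simp add: \<chi>_def)
  have unique: "c = d" if cd: "c \<cdot>\<^sub>v col P i = d \<cdot>\<^sub>v col P i" and i: "i < n" for c d i
  proof -
    obtain k where k: "k < n" "col P i $ k \<noteq> 0"
      using injective_mat_col_nonzero[OF P i] P(1)
      by (metis carrier_matD(1) dim_col eq_vecI index_zero_vec(1) index_zero_vec(2))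
    have "(c \<cdot>\<^sub>v col P i) $ k = (d \<cdot>\<^sub>v col P i) $ k" using cd by simp
    then show ?thesis using k P(1) i by simp
  qed
  have colc: "col P i \<in> carrier_vec n" for i using P(1) by (metis carrier_matD(1) col_dim)
  have c1: "is_char (\<chi> i)" if i: "i < n" for i
    unfolding is_char_def
  proof (intro conjI ballI allI impI)
    show "\<chi> i \<one> = 1"
    proof (rule unique[OF _ i])
      show "\<chi> i \<one> \<cdot>\<^sub>v col P i = 1 \<cdot>\<^sub>v col P i"
        using ev[OF A_closed(1) i] representation_one[OF rep] colc by simp
    qed
    fix x y assume xy: "x \<in> A" "y \<in> A"
    show "\<chi> i (x \<otimes> y) = \<chi> i x * \<chi> i y"
    proof (rule unique[OF _ i])
      have "\<chi> i (x \<otimes> y) \<cdot>\<^sub>v col P i = \<rho> (x \<otimes> y) *\<^sub>v col P i" using ev[OF A_closed(2)[OF xy] i] by simp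
      also have "\<dots> = \<rho> x *\<^sub>v (\<rho> y *\<^sub>v col P i)"
        using representation_mult[OF rep A_carrier A_carrier, OF xy] rc[OF xy(1)] rc[OF xy(2)] colc
        by (metis assoc_mult_mat_vec)
      also have "\<dots> = \<chi> i y \<cdot>\<^sub>v (\<rho> x *\<^sub>v col P i)"
        using ev[OF xy(2) i] mult_mat_vec[OF rc[OF xy(1)] colc] by metis
      also have "\<dots> = (\<chi> i x * \<chi> i y) \<cdot>\<^sub>v col P i"
        using ev[OF xy(1) i] by (simp add: smult_smult_assoc mult.commute)
      finally show "\<chi> i (x \<otimes> y) \<cdot>\<^sub>v col P i = (\<chi> i x * \<chi> i y) \<cdot>\<^sub>v col P i" .
    qed
  qed (simp add: \<chi>_def)
  have c2: "mat_trace (\<rho> a) = (\<Sum>i<n. \<chi> i a)" if "a \<in> A" for a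
    by (rule mat_trace_eigenbasis[OF rc[OF that] P ev[OF that]])
  have c3: "\<exists>u. u \<in> carrier_vec n \<and> u \<noteq> 0\<^sub>v n \<and> (\<forall>a\<in>A. \<rho> a *\<^sub>v u = \<chi> i a \<cdot>\<^sub>v u)" if "i < n" for i
    using colc injective_mat_col_nonzero[OF P that] ev[OF _ that] by (intro exI[of _ "col P i"] conjI ballI)
  have c4: "\<rho> a = 1\<^sub>m n" if a: "a \<in> A" "\<forall>i<n. \<chi> i a = 1" for a
  proof (rule finite_order_trace_eq_degree[OF rc[OF a(1)] representation_finite_order[OF rep A_carrier[OF a(1)]] card_carrier_pos])
    show "mat_trace (\<rho> a) = of_nat n" using c2[OF a(1)] a(2) by simp
  qed
  show thesis
    by (rule that[of \<chi>]) (use c1 c2 c3 c4 in auto)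
qed

text \<open>The multiplicity of \<open>\<nu>\<close> in \<open>\<theta>\<close> is expressed by the values of \<open>\<theta>\<close> alone, so symmetries of \<open>\<theta>\<close> become symmetries
of the multiplicities.\<close>

lemma multiplicity_formula:
  fixes n :: nat
  assumes \<chi>: "\<forall>i<n. is_char (\<chi> i)" and tr: "\<forall>a\<in>A. \<theta> a = (\<Sum>i<n. \<chi> i a)" and \<nu>: "is_char \<nu>"
  shows "of_nat (card {i. i < n \<and> \<chi> i = \<nu>} * card A) = (\<Sum>a\<in>A. \<theta> a * \<nu> (inv a))"
proof -
  have "(\<Sum>a\<in>A. \<theta> a * \<nu> (inv a)) = (\<Sum>a\<in>A. \<Sum>i<n. \<chi> i a * \<nu> (inv a))"
    using tr by (simp add: sum_distrib_right)
  also have "\<dots> = (\<Sum>i<n. \<Sum>a\<in>A. \<chi> i a * \<nu> (inv a))" by (rule sum.swap)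
  also have "\<dots> = (\<Sum>i<n. if \<chi> i = \<nu> then of_nat (card A) else 0)"
    using \<chi> \<nu> by (intro sum.cong refl char_orthogonality) auto
  also have "\<dots> = (\<Sum>i\<in>{i\<in>{..<n}. \<chi> i = \<nu>}. of_nat (card A))" by (rule sum.inter_filter[symmetric]) simp
  also have "\<dots> = of_nat (card {i. i < n \<and> \<chi> i = \<nu>} * card A)" by simp
  finally show ?thesis by simp
qed

lemma multiplicity_twist:
  fixes n :: nat
  assumes \<chi>: "\<forall>i<n. is_char (\<chi> i)" and tr: "\<forall>a\<in>A. \<theta> a = (\<Sum>i<n. \<chi> i a)" and \<nu>: "is_char \<nu>"
    and g: "g \<in> carrier G" and inva: "\<And>a. a \<in> A \<Longrightarrow> \<theta> (inv g \<otimes> a \<otimes> g) = \<theta> a"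
  shows "card {i. i < n \<and> \<chi> i = twist g \<nu>} = card {i. i < n \<and> \<chi> i = \<nu>}"
proof -
  have bij: "bij_betw (\<lambda>a. inv g \<otimes> a \<otimes> g) A A"
  proof (rule bij_betwI[where g = "\<lambda>a. g \<otimes> a \<otimes> inv g"])
    show "(\<lambda>a. g \<otimes> a \<otimes> inv g) \<in> A \<rightarrow> A" using conj_in_A[OF inv_closed[OF g]] g by auto
    show "g \<otimes> (inv g \<otimes> a \<otimes> g) \<otimes> inv g = a" if "a \<in> A" for a
      using A_carrier[OF that] g by (simp add: m_assoc[symmetric]) (simp add: m_assoc)
    show "inv g \<otimes> (g \<otimes> a \<otimes> inv g) \<otimes> g = a" if "a \<in> A" for a
      using A_carrier[OF that] g by (simp add: m_assoc[symmetric]) (simp add: m_assoc)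
  qed (use conj_in_A[OF g] in auto)
  have "(\<Sum>a\<in>A. \<theta> a * twist g \<nu> (inv a)) = (\<Sum>a\<in>A. \<theta> (inv g \<otimes> a \<otimes> g) * \<nu> (inv (inv g \<otimes> a \<otimes> g)))"
  proof (intro sum.cong refl)
    fix a assume a: "a \<in> A"
    have "inv (inv g \<otimes> a \<otimes> g) = inv g \<otimes> inv a \<otimes> g"
      using A_carrier[OF a] g by (simp add: inv_mult_group m_assoc)
    then show "\<theta> a * twist g \<nu> (inv a) = \<theta> (inv g \<otimes> a \<otimes> g) * \<nu> (inv (inv g \<otimes> a \<otimes> g))"
      using inva[OF a] A_closed(3)[OF a] by (simp add: twist_def)
  qed
  also have "\<dots> = (\<Sum>a\<in>A. \<theta> a * \<nu> (inv a))" by (rule sum.reindex_bij_betw[OF bij])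
  finally have "(of_nat (card {i. i < n \<and> \<chi> i = twist g \<nu>} * card A) :: complex) =
      of_nat (card {i. i < n \<and> \<chi> i = \<nu>} * card A)"
    unfolding multiplicity_formula[OF \<chi> tr \<nu>] multiplicity_formula[OF \<chi> tr twist_char[OF g \<nu>]] .
  then show ?thesis using card_A_pos by (simp only: of_nat_eq_iff) simp
qed

text \<open>The map \<open>a \<mapsto> a^s\<close> permutes \<open>A\<close>, and \<open>\<theta>\<close> is invariant under it because its values are integral sums of roots
of unity.\<close>

lemma multiplicity_char_power:
  fixes n :: nat
  assumes \<chi>: "\<forall>i<n. is_char (\<chi> i)" and tr: "\<forall>a\<in>A. \<theta> a = (\<Sum>i<n. \<chi> i a)" and \<nu>: "is_char \<nu>"
    and nat: "\<And>a. a \<in> A \<Longrightarrow> \<theta> a \<in> \<nat>" and s: "coprime s (card (carrier G))" "s > 0"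
  shows "card {i. i < n \<and> \<chi> i = char_power s \<nu>} = card {i. i < n \<and> \<chi> i = \<nu>}"
proof -
  have Npow: "a [^] (k * card (carrier G) + 1) = a" if "a \<in> A" for a and k :: nat
  proof -
    have ac: "a \<in> carrier G" using A_carrier that .
    have "a [^] (k * card (carrier G) + 1) = (a [^] card (carrier G)) [^] k \<otimes> a"
      using ac by (simp add: nat_pow_pow nat_pow_mult[symmetric] mult.commute)
    also have "a [^] card (carrier G) = \<one>" using pow_order_eq_1[OF ac] by (simp add: Coset.order_def)
    finally show ?thesis using ac by simp
  qed
  obtain c where c: "[s * c = 1] (mod card (carrier G))" using cong_solve_coprime_nat[OF s(1)] by auto
  have inj: "inj_on (\<lambda>a. a [^] s) A"
  proof (cases "card (carrier G) = 1")
    case True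
    then have "carrier G = {\<one>}" using one_closed by (metis card_1_singletonE singletonD)
    then show ?thesis using A_facts(4) by (auto simp: inj_on_def)
  next
    case False
    then have "1 mod card (carrier G) = 1" using card_carrier_pos by simp
    then obtain k where k: "s * c = k * card (carrier G) + 1"
      using c unfolding cong_def by (metis div_mult_mod_eq)
    show ?thesis
    proof (rule inj_on_inverseI[where g = "\<lambda>a. a [^] c"])
      fix a assume a: "a \<in> A"
      have "(a [^] s) [^] c = a [^] (s * c)" using A_carrier[OF a] by (simp add: nat_pow_pow)
      then show "(a [^] s) [^] c = a" using Npow[OF a] k by simp
    qed
  qed
  have bij: "bij_betw (\<lambda>a. a [^] s) A A"
    unfolding bij_betw_def using inj A_closed(4) A_facts(5) by (simp add: endo_inj_surj image_subset_iff)
  have gal: "\<theta> (a [^] s) = \<theta> a" if a: "a \<in> A" for a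
  proof -
    have "(\<Sum>i<n. \<chi> i a ^ j) = \<theta> (a [^] j)" for j
      using tr \<chi> A_closed(4)[OF a] char_pow[OF _ a] by simp
    then have pn: "(\<Sum>i<n. \<chi> i a ^ j) \<in> \<nat>" for j using nat A_closed(4)[OF a] by simp
    have "\<theta> (a [^] s) = (\<Sum>i<n. \<chi> i a ^ s)" using tr \<chi> A_closed(4)[OF a] char_pow[OF _ a] by simp
    also have "\<dots> = (\<Sum>i<n. \<chi> i a)"
      using pn \<chi> char_root_of_unity[OF _ a]
      by (intro integral_power_sums_coprime[OF _ card_carrier_pos _ _ s(1)]) auto
    finally show ?thesis using tr a by simp
  qed
  have "(\<Sum>a\<in>A. \<theta> a * \<nu> (inv a)) = (\<Sum>a\<in>A. \<theta> (a [^] s) * \<nu> (inv (a [^] s)))"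
    by (rule sum.reindex_bij_betw[OF bij, symmetric])
  also have "\<dots> = (\<Sum>a\<in>A. \<theta> a * char_power s \<nu> (inv a))"
  proof (intro sum.cong refl)
    fix a assume a: "a \<in> A"
    have "inv (a [^] s) = inv a [^] s" using A_carrier[OF a] by (simp add: nat_pow_inv)
    then show "\<theta> (a [^] s) * \<nu> (inv (a [^] s)) = \<theta> a * char_power s \<nu> (inv a)"
      using gal[OF a] char_pow[OF \<nu> A_closed(3)[OF a]] by (simp add: char_power_def)
  qed
  finally have "(of_nat (card {i. i < n \<and> \<chi> i = char_power s \<nu>} * card A) :: complex) =
      of_nat (card {i. i < n \<and> \<chi> i = \<nu>} * card A)"
    unfolding multiplicity_formula[OF \<chi> tr \<nu>] multiplicity_formula[OF \<chi> tr char_power_char[OF \<nu> s(2)]] by (rule sym)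
  then show ?thesis using card_A_pos by (simp only: of_nat_eq_iff) simp
qed

end

section \<open>The orbit of a linear character under conjugation and Galois action\<close>

text \<open>The order of \<open>\<mu>\<close> is \<open>p^f\<close>, and \<open>a0\<close> is an element at which \<open>\<mu>\<close> has a value of exactly this order. The last
assumption says that only elements of \<open>A\<close> fix a power of \<open>\<mu>\<close> with exponent prime to \<open>p\<close>.\<close>

locale char_orbit = cyclic_center_p_group + abelian_normal +
  fixes \<mu> f a0
  assumes \<mu>: "is_char \<mu>" and z0A: "z0 \<in> A" and \<mu>z: "\<mu> z \<noteq> 1"
    and f: "0 < f" "\<And>a. a \<in> A \<Longrightarrow> \<mu> a ^ (p ^ f) = 1" and a0: "a0 \<in> A" "\<mu> a0 ^ (p ^ (f - 1)) \<noteq> 1"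
    and free: "\<And>t s. t \<in> carrier G \<Longrightarrow> coprime s p \<Longrightarrow> twist t (char_power s \<mu>) = char_power s \<mu> \<Longrightarrow> t \<in> A"
begin

text \<open>The orbit of \<open>\<mu>\<close> under conjugation by \<open>G\<close> and the Galois action \<open>\<nu> \<mapsto> \<nu>^s\<close>. The power classes are the orbits
of the Galois action alone.\<close>

definition orb where "orb = {twist g (char_power s \<mu>) |g s. g \<in> carrier G \<and> coprime s p}"

definition power_class where "power_class \<nu> = {char_power s \<nu> |s. coprime s p}"

definition num_classes where "num_classes = card (power_class ` orb)"

lemma coprime_pos: "coprime s p \<Longrightarrow> s > 0"
  using p_gt_1 by (cases s) auto

lemma orb_char: "\<nu> \<in> orb \<Longrightarrow> is_char \<nu>"
  using \<mu> coprime_pos by (auto simp: orb_def intro!: twist_char char_power_char)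

lemma orb_memI: "g \<in> carrier G \<Longrightarrow> coprime s p \<Longrightarrow> twist g (char_power s \<mu>) \<in> orb"
  by (auto simp: orb_def)

lemma orb_twist: "g \<in> carrier G \<Longrightarrow> \<nu> \<in> orb \<Longrightarrow> twist g \<nu> \<in> orb"
  unfolding orb_def by clarify (metis m_closed twist_twist)

lemma orb_power: "coprime s p \<Longrightarrow> \<nu> \<in> orb \<Longrightarrow> char_power s \<nu> \<in> orb"
proof -
  assume s: "coprime s p" and "\<nu> \<in> orb"
  then obtain g t where gt: "g \<in> carrier G" "coprime t p" "\<nu> = twist g (char_power t \<mu>)" by (auto simp: orb_def)
  have "char_power s \<nu> = twist g (char_power (t * s) \<mu>)"
    using gt char_power_twist[OF coprime_pos[OF s]] char_power_power by simp
  moreover have "coprime (t * s) p" using gt s by simp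
  ultimately show ?thesis using gt(1) orb_memI by simp
qed

lemma orb_order: assumes "\<nu> \<in> orb" "a \<in> A" shows "\<nu> a ^ (p ^ f) = 1"
proof -
  obtain g s where g: "g \<in> carrier G" "\<nu> = twist g (char_power s \<mu>)" using assms by (auto simp: orb_def)
  have "\<nu> a ^ (p ^ f) = (\<mu> (inv g \<otimes> a \<otimes> g) ^ (p ^ f)) ^ s"
    using assms(2) g by (simp add: twist_def char_power_def power_mult[symmetric] mult.commute)
  then show ?thesis using f(2)[OF conj_in_A[OF g(1) assms(2)]] by simp
qed

lemma orb_primitive: assumes "\<nu> \<in> orb" obtains a where "a \<in> A" "\<nu> a ^ (p ^ (f - 1)) \<noteq> 1"
proof -
  obtain g s where g: "g \<in> carrier G" "\<nu> = twist g (char_power s \<mu>)" "coprime s p" using assms by (auto simp: orb_def)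
  define a where "a = inv (inv g) \<otimes> a0 \<otimes> inv g"
  have a: "a \<in> A" unfolding a_def using conj_in_A[OF inv_closed[OF g(1)] a0(1)] .
  have "inv g \<otimes> a \<otimes> g = a0"
    using g(1) A_carrier[OF a0(1)] unfolding a_def by (simp add: m_assoc[symmetric]) (simp add: m_assoc)
  then have "\<nu> a ^ (p ^ (f - 1)) = (\<mu> a0 ^ (p ^ (f - 1))) ^ s"
    using a g(2) by (simp add: twist_def char_power_def power_mult[symmetric] mult.commute)
  moreover have "(\<mu> a0 ^ (p ^ (f - 1))) ^ p = 1"
    using f(2)[OF a0(1)] f(1) by (simp only: power_mult[symmetric] power_Suc2[symmetric] Suc_diff_1)
  ultimately have "\<nu> a ^ (p ^ (f - 1)) \<noteq> 1" using power_eq_1_coprime g(3) a0(2) by metis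
  then show thesis using that a by blast
qed

lemma char_power_mod: assumes "\<nu> \<in> orb" "[s = t] (mod p ^ f)" "s > 0" "t > 0" shows "char_power s \<nu> = char_power t \<nu>"
proof
  fix x
  show "char_power s \<nu> x = char_power t \<nu> x"
  proof (cases "x \<in> A")
    case True
    have pm: "\<nu> x ^ (k mod p ^ f) = \<nu> x ^ k" for k
      by (rule root_of_unity_power_mod[OF orb_order[OF assms(1) True]])
    show ?thesis using pm[of s] pm[of t] assms(2) by (simp add: char_power_def cong_def)
  next
    case False
    then show ?thesis using orb_char[OF assms(1)] assms(3,4) by (simp add: char_power_def is_char_def zero_power)
  qed
qed

lemma power_class_eq_image: assumes "\<nu> \<in> orb" shows "power_class \<nu> = (\<lambda>s. char_power s \<nu>) ` prime_power_units p f"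
proof (intro equalityI subsetI)
  fix x assume "x \<in> power_class \<nu>"
  then obtain s where s: "coprime s p" "x = char_power s \<nu>" by (auto simp: power_class_def)
  have c: "coprime (s mod p ^ f) p"
    using s(1) f(1) by (metis coprime_commute coprime_mod_right_iff coprime_power_right_iff p_gt_1 power_eq_0_iff not_less_zero)
  moreover have "s mod p ^ f < p ^ f" using p_gt_1 by simp
  moreover have "char_power (s mod p ^ f) \<nu> = char_power s \<nu>"
    using coprime_pos c s(1) by (intro char_power_mod[OF assms]) (auto simp: cong_def)
  ultimately show "x \<in> (\<lambda>s. char_power s \<nu>) ` prime_power_units p f"
    using s(2) by (auto simp: prime_power_units_def image_iff)
qed (auto simp: power_class_def prime_power_units_def)

lemma char_power_inj: assumes "\<nu> \<in> orb" shows "inj_on (\<lambda>s. char_power s \<nu>) (prime_power_units p f)"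
proof -
  obtain a where a: "a \<in> A" "\<nu> a ^ (p ^ (f - 1)) \<noteq> 1" by (rule orb_primitive[OF assms])
  have "inj_on (\<lambda>s. \<nu> a ^ s) {..<p ^ f}"
    by (rule primitive_prime_power_root_inj[OF prime f(1) orb_order[OF assms a(1)] a(2)])
  then show ?thesis
    unfolding inj_on_def prime_power_units_def by (auto simp: char_power_def dest!: fun_cong[of _ _ a])
qed

lemma card_power_class: assumes "\<nu> \<in> orb" shows "card (power_class \<nu>) = p ^ (f - 1) * (p - 1)" "finite (power_class \<nu>)"
  unfolding power_class_eq_image[OF assms] card_image[OF char_power_inj[OF assms]]
  using card_prime_power_units[OF prime f(1)] by auto

lemma self_power_class: "\<nu> \<in> power_class \<nu>"
  unfolding power_class_def by (auto intro!: exI[of _ 1] simp: char_power_def)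

lemma power_class_eq: assumes "\<nu> \<in> orb" "\<nu>' \<in> power_class \<nu>" shows "power_class \<nu>' = power_class \<nu>"
proof -
  obtain s where s: "coprime s p" "\<nu>' = char_power s \<nu>" using assms by (auto simp: power_class_def)
  have "coprime s (p ^ f)" using s(1) by simp
  then obtain c where c: "[s * c = 1] (mod p ^ f)" using cong_solve_coprime_nat[OF \<open>coprime s (p ^ f)\<close>] by auto
  have "coprime (s * c) (p ^ f)" using c by (metis cong_imp_coprime cong_sym coprime_1_left)
  then have cp: "coprime c p" using f(1) by simp
  have undo: "char_power c \<nu>' = \<nu>"
  proof -
    have "char_power c \<nu>' = char_power (s * c) \<nu>" using s(2) by (simp add: char_power_power)
    also have "\<dots> = char_power 1 \<nu>"
      using c coprime_pos[OF s(1)] coprime_pos[OF cp] by (intro char_power_mod[OF assms(1)]) auto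
    finally show ?thesis by (simp add: char_power_def)
  qed
  show ?thesis
  proof (intro equalityI subsetI)
    fix x assume "x \<in> power_class \<nu>'"
    then obtain t where "coprime t p" "x = char_power t \<nu>'" by (auto simp: power_class_def)
    then show "x \<in> power_class \<nu>" using s by (auto simp: power_class_def char_power_power intro!: exI[of _ "s * t"])
  next
    fix x assume "x \<in> power_class \<nu>"
    then obtain t where t: "coprime t p" "x = char_power t \<nu>" by (auto simp: power_class_def)
    then have "x = char_power (c * t) \<nu>'" using undo by (metis char_power_power)
    then show "x \<in> power_class \<nu>'" using t cp by (auto simp: power_class_def)
  qed
qed

lemma orb_eq_image: "orb = (\<lambda>(g,s). twist g (char_power s \<mu>)) ` (carrier G \<times> prime_power_units p f)"
proof (intro equalityI subsetI)
  fix \<nu> assume "\<nu> \<in> orb"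
  then obtain g s where g: "g \<in> carrier G" "coprime s p" "\<nu> = twist g (char_power s \<mu>)" by (auto simp: orb_def)
  have \<mu>o: "\<mu> \<in> orb" using orb_memI[of \<one> 1] \<mu> by (simp add: char_power_def twist_one)
  have "char_power s \<mu> \<in> power_class \<mu>" using g by (auto simp: power_class_def)
  then obtain t where "t \<in> prime_power_units p f" "char_power s \<mu> = char_power t \<mu>"
    using power_class_eq_image[OF \<mu>o] by auto
  then show "\<nu> \<in> (\<lambda>(g,s). twist g (char_power s \<mu>)) ` (carrier G \<times> prime_power_units p f)"
    using g by (auto simp: image_iff)
qed (auto simp: orb_def prime_power_units_def)

lemma finite_orb: "finite orb"
  unfolding orb_eq_image using fin card_prime_power_units(2)[OF prime f(1)] by simp

lemma mu_in_orb: "\<mu> \<in> orb"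
  using orb_memI[of \<one> 1] \<mu> by (simp add: char_power_def twist_one)

lemma Union_power_class: "\<Union>(power_class ` orb) = orb"
  using orb_power self_power_class by (auto simp: power_class_def)

lemma power_class_disjoint: "\<forall>C\<in>power_class ` orb. \<forall>D\<in>power_class ` orb. C \<noteq> D \<longrightarrow> C \<inter> D = {}"
  using power_class_eq by blast

lemma card_orb: "card orb = num_classes * (p ^ (f - 1) * (p - 1))"
proof -
  have "card (\<Union>(power_class ` orb)) = (\<Sum>C\<in>power_class ` orb. card C)"
    using power_class_disjoint card_power_class(2) by (intro card_Union_disjoint) (auto simp: pairwise_def disjnt_def)
  also have "\<dots> = (\<Sum>C\<in>power_class ` orb. p ^ (f - 1) * (p - 1))"
    using card_power_class(1) by (intro sum.cong) auto
  finally show ?thesis by (simp add: Union_power_class num_classes_def)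
qed

lemma power_class_sum:
  assumes "\<nu> \<in> orb" "a \<in> A"
  shows "\<exists>k::int. (\<Sum>\<nu>'\<in>power_class \<nu>. \<nu>' a) = of_int k \<and> - int (p ^ (f - 1)) \<le> k"
proof -
  have "(\<Sum>\<nu>'\<in>power_class \<nu>. \<nu>' a) = (\<Sum>s\<in>prime_power_units p f. \<nu> a ^ s)"
    unfolding power_class_eq_image[OF assms(1)] sum.reindex[OF char_power_inj[OF assms(1)]] by (simp add: char_power_def)
  also have "\<dots> = (if \<nu> a = 1 then of_nat (p ^ f) else 0) - (if \<nu> a ^ p = 1 then of_nat (p ^ (f - 1)) else 0)"
    by (rule ramanujan_sum_prime_power[OF prime f(1) orb_order[OF assms]])
  also have "\<dots> = of_int ((if \<nu> a = 1 then int (p ^ f) else 0) - (if \<nu> a ^ p = 1 then int (p ^ (f - 1)) else 0))"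
    by simp
  finally show ?thesis by (intro exI[of _ "(if \<nu> a = 1 then int (p ^ f) else 0) - (if \<nu> a ^ p = 1 then int (p ^ (f - 1)) else 0)"]) auto
qed

text \<open>Each power class contributes a Ramanujan sum, whose only negative value is \<open>-p^(f-1)\<close>.\<close>

lemma orb_sum:
  assumes "a \<in> A"
  shows "\<exists>k::int. (\<Sum>\<nu>\<in>orb. \<nu> a) = of_int k \<and> - int (num_classes * p ^ (f - 1)) \<le> k"
proof -
  have "\<forall>C\<in>power_class ` orb. \<exists>k::int. (\<Sum>\<nu>\<in>C. \<nu> a) = of_int k \<and> - int (p ^ (f - 1)) \<le> k"
    using power_class_sum[OF _ assms] by auto
  then obtain k :: "('a \<Rightarrow> complex) set \<Rightarrow> int"
    where k: "\<And>C. C \<in> power_class ` orb \<Longrightarrow> (\<Sum>\<nu>\<in>C. \<nu> a) = of_int (k C)" "\<And>C. C \<in> power_class ` orb \<Longrightarrow> - int (p ^ (f - 1)) \<le> k C"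
    by metis
  have "(\<Sum>\<nu>\<in>orb. \<nu> a) = (\<Sum>C\<in>power_class ` orb. \<Sum>\<nu>\<in>C. \<nu> a)"
    using sum.Union_disjoint[of "power_class ` orb" "\<lambda>\<nu>. \<nu> a"] power_class_disjoint card_power_class(2) by (simp add: Union_power_class)
  also have "\<dots> = of_int (\<Sum>C\<in>power_class ` orb. k C)" using k(1) by simp
  finally have "(\<Sum>\<nu>\<in>orb. \<nu> a) = of_int (\<Sum>C\<in>power_class ` orb. k C)" .
  moreover have "(\<Sum>C\<in>power_class ` orb. - int (p ^ (f - 1))) \<le> (\<Sum>C\<in>power_class ` orb. k C)"
    using k(2) by (intro sum_mono) auto
  ultimately show ?thesis by (intro exI[of _ "\<Sum>C\<in>power_class ` orb. k C"]) (simp add: num_classes_def)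
qed

text \<open>The Galois action commutes with conjugation, so \<open>G\<close> permutes the power classes transitively. The stabilizer
\<open>M\<close> of the class of \<open>\<mu>\<close> contains \<open>A\<close>, since \<open>A\<close> is abelian.\<close>

lemma num_classes_times_index: "\<exists>q. num_classes * (q * card A) = card (carrier G)"
proof -
  define M where "M = {g \<in> carrier G. \<exists>s. coprime s p \<and> twist g \<mu> = char_power s \<mu>}"
  define F where "F g = power_class (twist g \<mu>)" for g
  have tw: "twist g \<mu> \<in> orb" if "g \<in> carrier G" for g using orb_twist[OF that mu_in_orb] .
  have img: "power_class ` orb = F ` carrier G"
  proof (intro equalityI subsetI)
    fix C assume "C \<in> power_class ` orb"
    then obtain g s where g: "g \<in> carrier G" "coprime s p" "C = power_class (twist g (char_power s \<mu>))" by (auto simp: orb_def)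
    have "twist g (char_power s \<mu>) \<in> power_class (twist g \<mu>)"
      using g char_power_twist[OF coprime_pos[OF g(2)], of g \<mu>] by (auto simp: power_class_def) metis
    then have "C = F g" using power_class_eq[OF tw[OF g(1)]] g(3) by (simp add: F_def)
    then show "C \<in> F ` carrier G" using g(1) by blast
  qed (use tw in \<open>auto simp: F_def\<close>)
  have F_iff: "F g = F k \<longleftrightarrow> inv g \<otimes> k \<in> M" if gk: "g \<in> carrier G" "k \<in> carrier G" for g k
  proof -
    have "F g = F k \<longleftrightarrow> twist k \<mu> \<in> power_class (twist g \<mu>)"
      unfolding F_def using power_class_eq[OF tw[OF gk(1)]] self_power_class by metis
    also have "\<dots> \<longleftrightarrow> (\<exists>s. coprime s p \<and> twist k \<mu> = twist g (char_power s \<mu>))"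
      unfolding power_class_def using char_power_twist[OF coprime_pos] by (auto) metis+
    also have "\<dots> \<longleftrightarrow> (\<exists>s. coprime s p \<and> twist (inv g \<otimes> k) \<mu> = char_power s \<mu>)"
    proof -
      have "twist k \<mu> = twist g (char_power s \<mu>) \<longleftrightarrow> twist (inv g \<otimes> k) \<mu> = char_power s \<mu>" if "coprime s p" for s
        using twist_twist[of "inv g" k \<mu>] twist_inv[OF gk(1)] gk twist_char[OF gk(2) \<mu>]
          char_power_char[OF \<mu> coprime_pos[OF that]] by (metis inv_closed)
      then show ?thesis by blast
    qed
    also have "\<dots> \<longleftrightarrow> inv g \<otimes> k \<in> M" using gk by (simp add: M_def)
    finally show ?thesis .
  qed
  have AM: "A \<subseteq> M" unfolding M_def using A_carrier twist_A[OF _ \<mu>]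
    by (auto intro!: exI[of _ 1] simp: char_power_def)
  have Fone: "g \<in> M \<longleftrightarrow> g \<in> carrier G \<and> F \<one> = F g" for g
    using F_iff[of \<one> g] by (auto simp: M_def)
  have M: "subgroup M G"
  proof (rule subgroupI)
    show "M \<subseteq> carrier G" by (auto simp: M_def)
    show "M \<noteq> {}" using AM A_closed(1) by blast
    fix g assume g: "g \<in> M"
    then have "F g = F \<one>" "g \<in> carrier G" using Fone by auto
    then show "inv g \<in> M" using F_iff[of g \<one>] by simp
  next
    fix g k assume g: "g \<in> M" and k: "k \<in> M"
    then have gk: "g \<in> carrier G" "k \<in> carrier G" by (auto simp: M_def)
    have "inv g \<in> M" using g F_iff[of g \<one>] Fone gk by auto
    then have "F (inv g) = F \<one>" using Fone gk by auto
    also have "F \<one> = F k" using k Fone by auto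
    finally have "inv (inv g) \<otimes> k \<in> M" using F_iff gk by blast
    then show "g \<otimes> k \<in> M" using gk by simp
  qed
  have 1: "num_classes * card M = card (carrier G)"
    unfolding num_classes_def img by (rule card_image_of_cosets[OF M F_iff])
  interpret M: group "G\<lparr>carrier := M\<rparr>" by (rule subgroup_imp_group[OF M])
  have "subgroup A (G\<lparr>carrier := M\<rparr>)" using subgroup_incl[OF A_facts(1) M AM] .
  then have "card A dvd card M" using M.lagrange[of A] by (auto simp: Coset.order_def dvd_def mult.commute) (metis mult.commute)
  then obtain q where "card M = q * card A" by (metis dvd_def mult.commute)
  then show ?thesis using 1 by metis
qed

text \<open>At the central element \<open>z0\<close> all conjugates of \<open>\<mu>^s\<close> have the same value \<open>\<mu>(z0)^s\<close>, and \<open>\<mu>(z0)\<close> is a primitive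
\<open>p^r\<close>-th root of unity. So the \<open>G\<close>-orbits of \<open>\<mu>^s\<close>, with \<open>s\<close> a unit modulo \<open>p^r\<close>, are disjoint, and each of
them has \<open>|G:A|\<close> elements.\<close>

lemma card_orb_ge: "p ^ (r - 1) * (p - 1) * card (carrier G) \<le> card orb * card A"
proof -
  define O' where "O' s = (\<lambda>g. twist g (char_power s \<mu>)) ` carrier G" for s
  have card_O: "card (O' s) * card A = card (carrier G)" if s: "coprime s p" for s
    unfolding O'_def
  proof (rule card_image_of_cosets[OF A_facts(1)])
    fix g k assume gk: "g \<in> carrier G" "k \<in> carrier G"
    have c: "is_char (char_power s \<mu>)" using char_power_char[OF \<mu> coprime_pos[OF s]] .
    have "twist g (char_power s \<mu>) = twist k (char_power s \<mu>) \<longleftrightarrow> twist (inv g \<otimes> k) (char_power s \<mu>) = char_power s \<mu>"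
      using twist_twist[of "inv g" k] twist_inv[OF gk(1)] gk twist_char[OF gk(2) c] c by (metis inv_closed)
    also have "\<dots> \<longleftrightarrow> inv g \<otimes> k \<in> A" using free[OF _ s] twist_A[OF _ c] gk by auto
    finally show "twist g (char_power s \<mu>) = twist k (char_power s \<mu>) \<longleftrightarrow> inv g \<otimes> k \<in> A" .
  qed
  have val: "\<nu> z0 = \<mu> z0 ^ s" if "\<nu> \<in> O' s" for \<nu> s
  proof -
    obtain g where g: "g \<in> carrier G" "\<nu> = twist g (char_power s \<mu>)" using \<open>\<nu> \<in> O' s\<close> by (auto simp: O'_def)
    have "z0 \<in> center G" using z0(1) unfolding z0(2) by (auto intro!: exI[of _ "1::nat"])
    then have "inv g \<otimes> z0 \<otimes> g = inv g \<otimes> (g \<otimes> z0)" using g(1) z0(1) center_commutes by (simp add: m_assoc)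
    also have "\<dots> = z0" using g(1) z0(1) by (simp add: m_assoc[symmetric])
    finally show ?thesis using g z0A by (simp add: twist_def char_power_def)
  qed
  have w: "\<mu> z0 ^ (p ^ r) = 1" "\<mu> z0 ^ (p ^ (r - 1)) \<noteq> 1"
  proof -
    have "z0 [^] (p ^ r) = \<one>" using z0_pow_eq_1_iff by simp
    then show "\<mu> z0 ^ (p ^ r) = 1" using char_pow[OF \<mu> z0A, of "p ^ r"] \<mu> by (simp add: is_char_def)
    show "\<mu> z0 ^ (p ^ (r - 1)) \<noteq> 1" using char_pow[OF \<mu> z0A, of "p ^ (r - 1)"] \<mu>z by (simp add: z_def)
  qed
  have inj: "inj_on (\<lambda>s. \<mu> z0 ^ s) {..<p ^ r}" by (rule primitive_prime_power_root_inj[OF prime r w])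
  have disj: "O' s \<inter> O' t = {}" if "s \<in> prime_power_units p r" "t \<in> prime_power_units p r" "s \<noteq> t" for s t
  proof (rule ccontr)
    assume "O' s \<inter> O' t \<noteq> {}"
    then obtain \<nu> where "\<nu> \<in> O' s" "\<nu> \<in> O' t" by blast
    then have "\<mu> z0 ^ s = \<mu> z0 ^ t" using val by metis
    then show False using inj that by (auto simp: inj_on_def prime_power_units_def)
  qed
  have "(\<Sum>s\<in>prime_power_units p r. card (O' s)) = card (\<Union>s\<in>prime_power_units p r. O' s)"
    using disj card_prime_power_units(2)[OF prime r] fin
    by (intro card_UN_disjoint[symmetric]) (auto simp: O'_def)
  also have "\<dots> \<le> card orb"
    by (intro card_mono finite_orb) (auto simp: O'_def orb_def prime_power_units_def)
  finally have "(\<Sum>s\<in>prime_power_units p r. card (O' s)) * card A \<le> card orb * card A" by simp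
  moreover have "(\<Sum>s\<in>prime_power_units p r. card (O' s)) * card A = (\<Sum>s\<in>prime_power_units p r. card (carrier G))"
    unfolding sum_distrib_right by (intro sum.cong refl card_O) (auto simp: prime_power_units_def)
  ultimately show ?thesis using card_prime_power_units(1)[OF prime r] by simp
qed

lemma order_dvd_ord: "p ^ f dvd ord a0"
proof -
  have ac: "a0 \<in> carrier G" using A_carrier a0(1) .
  have "a0 [^] ord a0 = \<one>" using ac by simp
  then have "\<mu> a0 ^ ord a0 = 1" using char_pow[OF \<mu> a0(1), of "ord a0"] \<mu> by (simp add: is_char_def)
  then show ?thesis using primitive_prime_power_root[OF prime f(1) f(2)[OF a0(1)] a0(2)] by simp
qed

lemma z_in_A: "z \<in> A" using A_closed(4)[OF z0A] by (simp add: z_def)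

lemma orb_free: assumes "\<nu> \<in> orb" "t \<in> carrier G" "twist t \<nu> = \<nu>" shows "t \<in> A"
proof -
  obtain g s where g: "g \<in> carrier G" "coprime s p" "\<nu> = twist g (char_power s \<mu>)" using assms by (auto simp: orb_def)
  have c: "is_char (char_power s \<mu>)" using char_power_char[OF \<mu> coprime_pos[OF g(2)]] .
  have "twist (inv g \<otimes> (t \<otimes> g)) (char_power s \<mu>) = twist (inv g) (twist t \<nu>)"
    using g assms(2) twist_twist[of "inv g" "t \<otimes> g"] twist_twist[of t g] by simp
  also have "\<dots> = char_power s \<mu>" using assms(3) g twist_inv(1)[OF g(1) c] by simp
  finally have "inv g \<otimes> (t \<otimes> g) \<in> A" using free[OF _ g(2)] g(1) assms(2) by simp
  then have "inv (inv g) \<otimes> (inv g \<otimes> (t \<otimes> g)) \<otimes> inv g \<in> A" using conj_in_A[OF inv_closed[OF g(1)]] by blast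
  moreover have "inv (inv g) \<otimes> (inv g \<otimes> (t \<otimes> g)) \<otimes> inv g = t"
    using g(1) assms(2) by (simp add: m_assoc[symmetric]) (simp add: m_assoc)
  ultimately show ?thesis by simp
qed

lemma orb_z: assumes "\<nu> \<in> orb" shows "\<nu> z \<noteq> 1"
proof -
  obtain g s where g: "g \<in> carrier G" "coprime s p" "\<nu> = twist g (char_power s \<mu>)" using assms by (auto simp: orb_def)
  have "inv g \<otimes> z \<otimes> g = inv g \<otimes> (g \<otimes> z)" using g(1) z_center center_commutes by (simp add: m_assoc)
  also have "\<dots> = z" using g(1) z_center by (simp add: m_assoc[symmetric])
  finally have "\<nu> z = \<mu> z ^ s" using g z_in_A by (simp add: twist_def char_power_def)
  moreover have "\<mu> z ^ p = 1"
    using char_pow[OF \<mu> z_in_A, of p] z_pow_eq_1_iff[of p] \<mu> by (simp add: is_char_def)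
  ultimately show ?thesis using power_eq_1_coprime g(2) \<mu>z by metis
qed

text \<open>Up to the trivial summands this is the direct sum of the representations induced from representatives of
the \<open>G\<close>-orbits in \<open>orb\<close>, written as monomial matrices. In each \<open>G\<close>-orbit a base point \<open>b\<close> is chosen, and \<open>x \<nu>\<close>
carries it to \<open>\<nu>\<close>. The element \<open>(x (g\<nu>))\<^sup>-\<^sup>1 g (x \<nu>)\<close> fixes the base point, hence lies in \<open>A\<close>, and the base point
evaluated there is the factor with which \<open>g\<close> maps the basis vector of \<open>\<nu>\<close> to that of \<open>g\<nu>\<close>.\<close>

lemma orbit_representation:
  obtains \<rho> where "representation G (card orb + q) \<rho>"
    "\<forall>g\<in>carrier G. mat_trace (\<rho> g) = (if g \<in> A then (\<Sum>\<nu>\<in>orb. \<nu> g) else 0) + of_nat q"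
proof -
  define Gorb where "Gorb \<nu> = (\<lambda>g. twist g \<nu>) ` carrier G" for \<nu>
  define b where "b \<nu> = (SOME \<beta>. \<beta> \<in> Gorb \<nu>)" for \<nu>
  define x where "x \<nu> = (SOME g. g \<in> carrier G \<and> twist g (b \<nu>) = \<nu>)" for \<nu>
  have Gorb_twist: "Gorb (twist g \<nu>) = Gorb \<nu>" if g: "g \<in> carrier G" and \<nu>: "\<nu> \<in> orb" for g \<nu>
  proof (intro equalityI subsetI)
    fix y assume "y \<in> Gorb (twist g \<nu>)"
    then obtain k where "k \<in> carrier G" "y = twist k (twist g \<nu>)" by (auto simp: Gorb_def)
    then show "y \<in> Gorb \<nu>" using g by (auto simp: Gorb_def twist_twist[symmetric])
  next
    fix y assume "y \<in> Gorb \<nu>"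
    then obtain k where k: "k \<in> carrier G" "y = twist k \<nu>" by (auto simp: Gorb_def)
    then have "y = twist (k \<otimes> inv g) (twist g \<nu>)"
      using g twist_inv(1)[OF g orb_char[OF \<nu>]] by (simp add: twist_twist)
    then show "y \<in> Gorb (twist g \<nu>)" using g k by (auto simp: Gorb_def)
  qed
  have b_twist: "b (twist g \<nu>) = b \<nu>" if "g \<in> carrier G" "\<nu> \<in> orb" for g \<nu>
    using Gorb_twist[OF that] by (simp add: b_def)
  have b_in: "\<exists>g\<in>carrier G. b \<nu> = twist g \<nu>" for \<nu>
  proof -
    have "twist \<one> \<nu> \<in> Gorb \<nu>" by (auto simp: Gorb_def)
    then have "b \<nu> \<in> Gorb \<nu>" unfolding b_def by (rule someI[of "\<lambda>\<beta>. \<beta> \<in> Gorb \<nu>"])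
    then show ?thesis by (auto simp: Gorb_def)
  qed
  have b_orb: "b \<nu> \<in> orb" if "\<nu> \<in> orb" for \<nu> using b_in[of \<nu>] orb_twist that by auto
  have x: "x \<nu> \<in> carrier G" "twist (x \<nu>) (b \<nu>) = \<nu>" if \<nu>: "\<nu> \<in> orb" for \<nu>
  proof -
    obtain g where g: "g \<in> carrier G" "b \<nu> = twist g \<nu>" using b_in[of \<nu>] by auto
    then have "inv g \<in> carrier G \<and> twist (inv g) (b \<nu>) = \<nu>" using twist_inv(1)[OF g(1) orb_char[OF \<nu>]] by simp
    then have "x \<nu> \<in> carrier G \<and> twist (x \<nu>) (b \<nu>) = \<nu>" unfolding x_def by (rule someI)
    then show "x \<nu> \<in> carrier G" "twist (x \<nu>) (b \<nu>) = \<nu>" by auto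
  qed
  have inA: "inv (x (twist g \<nu>)) \<otimes> g \<otimes> x \<nu> \<in> A" if g: "g \<in> carrier G" and \<nu>: "\<nu> \<in> orb" for g \<nu>
  proof (rule orb_free[OF b_orb[OF \<nu>]])
    have gv: "twist g \<nu> \<in> orb" using orb_twist[OF g \<nu>] .
    note xs = x[OF \<nu>] x[OF gv]
    show "inv (x (twist g \<nu>)) \<otimes> g \<otimes> x \<nu> \<in> carrier G" using g xs by simp
    have "twist (inv (x (twist g \<nu>)) \<otimes> g \<otimes> x \<nu>) (b \<nu>) = twist (inv (x (twist g \<nu>))) (twist g \<nu>)"
      using g xs by (simp add: twist_twist)
    also have "\<dots> = twist (inv (x (twist g \<nu>))) (twist (x (twist g \<nu>)) (b \<nu>))"
      using xs(4) b_twist[OF g \<nu>] by simp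
    also have "\<dots> = b \<nu>" using twist_inv(1)[OF xs(3) orb_char[OF b_orb[OF \<nu>]]] .
    finally show "twist (inv (x (twist g \<nu>)) \<otimes> g \<otimes> x \<nu>) (b \<nu>) = b \<nu>" .
  qed
  define I where "I = orb <+> {..<q}"
  define \<pi> where "\<pi> g i = (case i of Inl \<nu> \<Rightarrow> Inl (twist g \<nu>) | Inr j \<Rightarrow> Inr j)" for g and i :: "('a \<Rightarrow> complex) + nat"
  define c where "c g i = (case i of Inl \<nu> \<Rightarrow> b \<nu> (inv (x (twist g \<nu>)) \<otimes> g \<otimes> x \<nu>) | Inr j \<Rightarrow> 1)"
    for g and i :: "('a \<Rightarrow> complex) + nat"
  obtain \<rho> where \<rho>: "representation G (card I) \<rho>"
    "\<And>g. g \<in> carrier G \<Longrightarrow> mat_trace (\<rho> g) = (\<Sum>i | i \<in> I \<and> \<pi> g i = i. c g i)"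
  proof (rule monomial_representation[of I \<pi> c])
    show "finite I" using finite_orb by (simp add: I_def)
    show "I \<noteq> {}" using mu_in_orb by (auto simp: I_def)
    show "\<pi> g i \<in> I" if "g \<in> carrier G" "i \<in> I" for g i
      using that orb_twist by (auto simp: I_def \<pi>_def)
    show "\<pi> \<one> i = i" if "i \<in> I" for i
      using that orb_char by (auto simp: I_def \<pi>_def twist_one)
    show "\<pi> (g \<otimes> k) i = \<pi> g (\<pi> k i)" if "g \<in> carrier G" "k \<in> carrier G" "i \<in> I" for g k i
      using that by (auto simp: I_def \<pi>_def twist_twist)
    show "c \<one> i = 1" if "i \<in> I" for i
      using that orb_char x b_orb by (auto simp: I_def c_def twist_one is_char_def)
    show "c (g \<otimes> k) i = c g (\<pi> k i) * c k i" if gk: "g \<in> carrier G" "k \<in> carrier G" and i: "i \<in> I" for g k i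
    proof (cases i)
      case (Inl \<nu>)
      then have \<nu>: "\<nu> \<in> orb" using i by (auto simp: I_def)
      have kv: "twist k \<nu> \<in> orb" and gkv: "twist g (twist k \<nu>) \<in> orb"
        using orb_twist gk \<nu> by auto
      note xs = x(1)[OF \<nu>] x(1)[OF kv] x(1)[OF gkv]
      have "inv (x (twist g (twist k \<nu>))) \<otimes> (g \<otimes> k) \<otimes> x \<nu> =
        inv (x (twist g (twist k \<nu>))) \<otimes> g \<otimes> (x (twist k \<nu>) \<otimes> inv (x (twist k \<nu>))) \<otimes> k \<otimes> x \<nu>"
        using gk xs by (simp add: m_assoc)
      also have "\<dots> = (inv (x (twist g (twist k \<nu>))) \<otimes> g \<otimes> x (twist k \<nu>)) \<otimes> (inv (x (twist k \<nu>)) \<otimes> k \<otimes> x \<nu>)"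
        using gk xs by (simp only: m_assoc m_closed inv_closed)
      finally have "b \<nu> (inv (x (twist g (twist k \<nu>))) \<otimes> (g \<otimes> k) \<otimes> x \<nu>) =
        b \<nu> (inv (x (twist g (twist k \<nu>))) \<otimes> g \<otimes> x (twist k \<nu>)) * b \<nu> (inv (x (twist k \<nu>)) \<otimes> k \<otimes> x \<nu>)"
        using orb_char[OF b_orb[OF \<nu>]] inA[OF gk(1) kv] inA[OF gk(2) \<nu>] by (simp add: is_char_def)
      then show ?thesis using Inl b_twist[OF gk(2) \<nu>] gk by (simp add: c_def \<pi>_def twist_twist)
    qed (simp add: c_def \<pi>_def)
  qed blast
  have "mat_trace (\<rho> g) = (if g \<in> A then (\<Sum>\<nu>\<in>orb. \<nu> g) else 0) + of_nat q" if g: "g \<in> carrier G" for g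
  proof -
    have fixI: "{i. i \<in> I \<and> \<pi> g i = i} = (if g \<in> A then orb else {}) <+> {..<q}"
      using orb_free[OF _ g] twist_A orb_char by (auto simp: I_def \<pi>_def)
    have "mat_trace (\<rho> g) = (\<Sum>i\<in>(if g \<in> A then orb else {}) <+> {..<q}. c g i)"
      using \<rho>(2)[OF g] fixI by simp
    also have "\<dots> = (\<Sum>\<nu>\<in>(if g \<in> A then orb else {}). c g (Inl \<nu>)) + (\<Sum>j<q. c g (Inr j))"
      using finite_orb by (subst sum.Plus) auto
    also have "(\<Sum>\<nu>\<in>(if g \<in> A then orb else {}). c g (Inl \<nu>)) = (if g \<in> A then (\<Sum>\<nu>\<in>orb. \<nu> g) else 0)"
    proof (cases "g \<in> A")
      case True
      have "c g (Inl \<nu>) = \<nu> g" if \<nu>: "\<nu> \<in> orb" for \<nu>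
      proof -
        have "\<nu> g = twist (x \<nu>) (b \<nu>) g" using x(2)[OF \<nu>] by simp
        then show ?thesis using True twist_A[OF True orb_char[OF \<nu>]] by (simp add: c_def twist_def)
      qed
      then show ?thesis using True by simp
    qed simp
    finally show ?thesis by (simp add: c_def)
  qed
  moreover have "card I = card orb + q" using finite_orb by (simp add: I_def card_Plus)
  ultimately show thesis using that[of \<rho>] \<rho>(1) by simp
qed

lemma orbit_quasi_permutation_representation:
  obtains \<rho> where "representation G (num_classes * p ^ f) \<rho>" "inj_on \<rho> (carrier G)"
    "\<forall>g\<in>carrier G. mat_trace (\<rho> g) \<in> \<nat>"
proof -
  obtain \<rho> where \<rho>: "representation G (card orb + num_classes * p ^ (f - 1)) \<rho>"
    "\<forall>g\<in>carrier G. mat_trace (\<rho> g) = (if g \<in> A then (\<Sum>\<nu>\<in>orb. \<nu> g) else 0) + of_nat (num_classes * p ^ (f - 1))"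
    by (rule orbit_representation)
  have "card orb + num_classes * p ^ (f - 1) = num_classes * (p ^ (f - 1) * (p - 1) + p ^ (f - 1))"
    by (simp add: card_orb algebra_simps)
  also have "p ^ (f - 1) * (p - 1) + p ^ (f - 1) = p ^ (f - 1) * p"
    using p_gt_1 by (metis Suc_diff_1 mult_Suc_right add.commute prime prime_gt_0_nat)
  also have "p ^ (f - 1) * p = p ^ f" using f(1) by (metis Suc_diff_1 power_Suc2)
  finally have deg: "card orb + num_classes * p ^ (f - 1) = num_classes * p ^ f" .
  have nat: "mat_trace (\<rho> g) \<in> \<nat>" if g: "g \<in> carrier G" for g
  proof (cases "g \<in> A")
    case True
    obtain k :: int where k: "(\<Sum>\<nu>\<in>orb. \<nu> g) = of_int k" "- int (num_classes * p ^ (f - 1)) \<le> k"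
      using orb_sum[OF True] by blast
    have "mat_trace (\<rho> g) = of_int (k + int (num_classes * p ^ (f - 1)))" using \<rho>(2) g True k(1) by simp
    also have "\<dots> = of_nat (nat (k + int (num_classes * p ^ (f - 1))))" using k(2) by simp
    finally show ?thesis by simp
  next
    case False
    then have "mat_trace (\<rho> g) = of_nat (num_classes * p ^ (f - 1))" using \<rho>(2) g by simp
    then show ?thesis by (simp only: of_nat_in_Nats)
  qed
  have "\<rho> z \<noteq> 1\<^sub>m (card orb + num_classes * p ^ (f - 1))"
  proof
    assume "\<rho> z = 1\<^sub>m (card orb + num_classes * p ^ (f - 1))"
    then have "mat_trace (\<rho> z) = of_nat (card orb + num_classes * p ^ (f - 1))" by (simp add: mat_trace_def)
    then have s: "(\<Sum>\<nu>\<in>orb. \<nu> z) = of_nat (card orb)" using \<rho>(2) z_center(2) z_in_A by simp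
    have "\<mu> z = 1"
      by (rule sum_unit_complex_eq_card[where e = "\<lambda>\<nu>. \<nu> z", OF finite_orb _ s mu_in_orb])
        (use char_root_of_unity[OF orb_char z_in_A] card_carrier_pos root_of_unity_norm in blast)
    then show False using \<mu>z by simp
  qed
  then have "inj_on \<rho> (carrier G)" by (rule faithful_if_nontrivial_on_z[OF \<rho>(1)])
  then show thesis using that \<rho>(1) nat deg by simp
qed

end

section \<open>Normally monomial p-groups\<close>

lemma prime_power_le_imp_dvd:
  fixes a b :: nat
  assumes "prime p" "a dvd p ^ i" "b dvd p ^ j" "a \<le> b"
  shows "a dvd b"
proof -
  obtain k l where kl: "a = p ^ k" "b = p ^ l"
    using assms(2,3) divides_primepow_nat[OF assms(1)] by blast
  then have "k \<le> l" using assms(4) prime_gt_1_nat[OF assms(1)] by (metis power_le_imp_le_exp)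
  then show ?thesis using kl by (simp add: le_imp_power_dvd)
qed

locale normally_monomial_p_group = cyclic_center_p_group + abelian_normal +
  assumes nm: "normally_monomial G"
    and A_max: "\<And>B. abelian_normal_subgroup B G \<Longrightarrow> card B \<le> card A"
begin

text \<open>The normal subgroup from which \<open>\<sigma>\<close> is induced is abelian, so its index is at least that of \<open>A\<close>. The
opposite inequality holds for all irreducible representations.\<close>

lemma irreducible_degree:
  assumes irr: "irreducible_representation G n \<sigma>" and nz: "\<sigma> z \<noteq> 1\<^sub>m n"
  shows "n * card A = card (carrier G)"
proof -
  have rep: "representation G n \<sigma>" using irr by (simp add: irreducible_representation_def)
  obtain N where N: "abelian_normal_subgroup N G" "n * card N = card (carrier G)"
    by (rule normally_monomial_faithful_degree[OF nm irr faithful_if_nontrivial_on_z[OF rep nz]])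
  have "card (carrier G) \<le> n * card A" using N A_max[OF N(1)] by (metis mult_le_mono2)
  then show ?thesis using irreducible_degree_le_index[OF irr A] by simp
qed

text \<open>Below a line on which \<open>z\<close> acts nontrivially there is an irreducible representation nontrivial at \<open>z\<close>. Its
degree \<open>|G:A|\<close> is at most the index of the stabilizer of the line.\<close>

lemma eigenline_irreducible:
  assumes rep: "representation G n \<rho>" and u: "u \<in> carrier_vec n" "u \<noteq> 0\<^sub>v n"
    and uz: "\<rho> z *\<^sub>v u = c \<cdot>\<^sub>v u" "c \<noteq> 1"
  shows "card (line_stabilizer \<rho> u) \<le> card A"
    and "\<exists>k \<sigma>. irreducible_representation G k \<sigma> \<and> k * card A = card (carrier G)"
proof -
  obtain k C \<sigma> where k: "irreducible_representation G k \<sigma>"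
    "k * card (line_stabilizer \<rho> u) \<le> card (carrier G)"
    "C \<in> carrier_mat n k" "injective_mat C" "\<forall>g\<in>carrier G. \<rho> g * C = C * \<sigma> g"
    "\<forall>z c. z \<in> center G \<longrightarrow> \<rho> z *\<^sub>v u = c \<cdot>\<^sub>v u \<longrightarrow> \<sigma> z = c \<cdot>\<^sub>m 1\<^sub>m k"
    by (rule irreducible_below_line_stabilizer[OF rep u])
  have k0: "k > 0" using k(1) by (simp add: irreducible_representation_def representation_def)
  have "\<sigma> z = c \<cdot>\<^sub>m 1\<^sub>m k" using k(6) z_center(1) uz(1) by blast
  then have "\<sigma> z $$ (0,0) = c" using k0 by simp
  then have "\<sigma> z \<noteq> 1\<^sub>m k" using uz(2) k0 by auto
  then have deg: "k * card A = card (carrier G)" by (rule irreducible_degree[OF k(1)])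
  then show "\<exists>k \<sigma>. irreducible_representation G k \<sigma> \<and> k * card A = card (carrier G)" using k(1) by blast
  have "k * card (line_stabilizer \<rho> u) \<le> k * card A"
    using k(2) by (simp only: deg)
  then show "card (line_stabilizer \<rho> u) \<le> card A"
    using k0 by (simp only: mult_le_cancel1)
qed

lemma line_stabilizer_subset:
  assumes rep: "representation G n \<rho>" and u: "u \<in> carrier_vec n" "u \<noteq> 0\<^sub>v n"
    and uz: "\<rho> z *\<^sub>v u = c \<cdot>\<^sub>v u" "c \<noteq> 1"
    and uA: "\<forall>a\<in>A. \<exists>c. \<rho> a *\<^sub>v u = c \<cdot>\<^sub>v u" and t: "t \<in> carrier G" "\<rho> t *\<^sub>v u = d \<cdot>\<^sub>v u"
  shows "t \<in> A"
proof -
  let ?H = "line_stabilizer \<rho> u"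
  have sub: "A \<subseteq> ?H" using uA A_carrier by blast
  have finH: "finite ?H" using fin by simp
  have "card A = card ?H"
    using card_mono[OF finH sub] eigenline_irreducible(1)[OF rep u uz] by (rule antisym)
  then have "A = ?H" by (rule card_subset_eq[OF finH sub])
  then show ?thesis using t by blast
qed

lemma z_in_abelian: "z \<in> A"
proof -
  have "card (center G) \<le> card A" by (rule A_max[OF center_abelian_normal])
  then have "1 < card A" using card_center r p_gt_1 by (metis less_le_trans one_less_power)
  then have "A \<noteq> {\<one>}" by auto
  then show ?thesis by (rule normal_subgroup_contains_z[OF A_facts(2)])
qed

text \<open>If \<open>t\<close> fixes \<open>\<nu>\<close>, it acts on the \<open>\<nu>\<close>-eigenspace of \<open>A\<close> and has an eigenvector there. The line through that
vector is stabilized by \<open>A\<close> and by \<open>t\<close>, while no stabilizer of such a line is larger than \<open>A\<close>.\<close>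

lemma stabilizer_of_eigencharacter:
  assumes rep: "representation G n \<rho>" and \<nu>: "is_char \<nu>" "\<nu> z \<noteq> 1"
    and u: "u \<in> carrier_vec n" "u \<noteq> 0\<^sub>v n" "\<forall>a\<in>A. \<rho> a *\<^sub>v u = \<nu> a \<cdot>\<^sub>v u"
    and t: "t \<in> carrier G" "twist t \<nu> = \<nu>"
  shows "t \<in> A"
proof -
  note rc = representation_carrier[OF rep]
  define V where "V = {v \<in> carrier_vec n. \<forall>a\<in>A. \<rho> a *\<^sub>v v = \<nu> a \<cdot>\<^sub>v v}"
  have V: "linear_subspace n V"
    unfolding linear_subspace_def
  proof (intro conjI ballI allI)
    show "0\<^sub>v n \<in> V"
    proof -
      have "\<rho> a *\<^sub>v 0\<^sub>v n = \<nu> a \<cdot>\<^sub>v 0\<^sub>v n" if "a \<in> A" for a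
        using rc[OF A_carrier[OF that]] by (intro eq_vecI) auto
      then show ?thesis by (simp add: V_def)
    qed
  next
    fix x y assume "x \<in> V" "y \<in> V"
    then show "x + y \<in> V"
      using rc[OF A_carrier] by (auto simp: V_def mult_add_distrib_mat_vec[of _ n n] smult_add_distrib_vec[of _ n])
  next
    fix c x assume "x \<in> V"
    then show "c \<cdot>\<^sub>v x \<in> V"
      using rc[OF A_carrier] by (auto simp: V_def mult_mat_vec[of _ n n] smult_smult_assoc mult.commute)
  qed (auto simp: V_def)
  have tV: "\<rho> t *\<^sub>v v \<in> V" if v: "v \<in> V" for v
    unfolding V_def
  proof (intro CollectI conjI ballI)
    have vn: "v \<in> carrier_vec n" using v by (simp add: V_def)
    then show "\<rho> t *\<^sub>v v \<in> carrier_vec n" using rc[OF t(1)] by simp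
    fix a assume a: "a \<in> A"
    have ac: "a \<in> carrier G" using A_carrier a .
    define a' where "a' = inv t \<otimes> a \<otimes> t"
    have a': "a' \<in> A" "a' \<in> carrier G" using conj_in_A[OF t(1) a] A_carrier by (auto simp: a'_def)
    have "\<nu> a' = twist t \<nu> a" using a by (simp add: twist_def a'_def)
    then have \<nu>a': "\<nu> a' = \<nu> a" using t(2) by simp
    have "t \<otimes> a' = a \<otimes> t" using t(1) ac by (simp add: a'_def m_assoc[symmetric])
    then have "\<rho> a * \<rho> t = \<rho> t * \<rho> a'"
      using representation_mult[OF rep ac t(1)] representation_mult[OF rep t(1) a'(2)] by simp
    then have "\<rho> a *\<^sub>v (\<rho> t *\<^sub>v v) = \<rho> t *\<^sub>v (\<rho> a' *\<^sub>v v)"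
      using rc[OF ac] rc[OF t(1)] rc[OF a'(2)] vn by (metis assoc_mult_mat_vec)
    also have "\<rho> a' *\<^sub>v v = \<nu> a \<cdot>\<^sub>v v" using v a'(1) \<nu>a' by (simp add: V_def)
    finally show "\<rho> a *\<^sub>v (\<rho> t *\<^sub>v v) = \<nu> a \<cdot>\<^sub>v (\<rho> t *\<^sub>v v)" using mult_mat_vec[OF rc[OF t(1)] vn] by simp
  qed
  have uV: "u \<in> V" using u by (simp add: V_def)
  obtain w :: "nat \<Rightarrow> complex vec" where w: "\<And>j. w j \<in> V" "\<And>j. \<exists>c. \<rho> t *\<^sub>v w j = c \<cdot>\<^sub>v w j"
    "u = vec n (\<lambda>i. \<Sum>j<card (carrier G). w j $ i)"
    using finite_order_eigenvector_decomposition[OF rc[OF t(1)] representation_finite_order[OF rep t(1)]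
        card_carrier_pos V tV uV] by blast
  have "\<exists>j. w j \<noteq> 0\<^sub>v n"
  proof (rule ccontr)
    assume "\<nexists>j. w j \<noteq> 0\<^sub>v n"
    then have "u = 0\<^sub>v n" unfolding w(3) by (intro eq_vecI) auto
    then show False using u(2) by simp
  qed
  then obtain j where j: "w j \<noteq> 0\<^sub>v n" by blast
  obtain d where d: "\<rho> t *\<^sub>v w j = d \<cdot>\<^sub>v w j" using w(2) by blast
  have wj: "w j \<in> carrier_vec n" "\<forall>a\<in>A. \<rho> a *\<^sub>v w j = \<nu> a \<cdot>\<^sub>v w j" using w(1)[of j] by (auto simp: V_def)
  show ?thesis
    by (rule line_stabilizer_subset[OF rep wj(1) j _ \<nu>(2) _ t(1) d]) (use wj(2) z_in_abelian in auto)
qed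

text \<open>Averaging the trace over the powers of \<open>z\<close> counts the constituents of \<open>\<rho>\<close> on \<open>A\<close> that are trivial at \<open>z\<close>.
As the traces are non-negative, this number is at least \<open>n / p\<close>; so at most \<open>n (p - 1) / p\<close> constituents are
nontrivial at \<open>z\<close>, and all members of \<open>orb\<close> are among them.\<close>

lemma quasi_permutation_constituent:
  assumes rep: "representation G n \<rho>" and inj: "inj_on \<rho> (carrier G)"
    and nat: "\<forall>g\<in>carrier G. mat_trace (\<rho> g) \<in> \<nat>"
  obtains \<mu> f a0 where "char_orbit G p m r z0 A \<mu> f a0" "char_orbit.num_classes G p A \<mu> * p ^ f \<le> n"
    "\<exists>k \<sigma>. irreducible_representation G k \<sigma> \<and> k * card A = card (carrier G)"
proof -
  note rc = representation_carrier[OF rep]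
  obtain \<chi> :: "nat \<Rightarrow> 'a \<Rightarrow> complex" where \<chi>: "\<forall>i<n. is_char (\<chi> i)"
    and tr: "\<forall>a\<in>A. mat_trace (\<rho> a) = (\<Sum>i<n. \<chi> i a)"
    and ev: "\<forall>i<n. \<exists>u. u \<in> carrier_vec n \<and> u \<noteq> 0\<^sub>v n \<and> (\<forall>a\<in>A. \<rho> a *\<^sub>v u = \<chi> i a \<cdot>\<^sub>v u)"
    and triv: "\<forall>a\<in>A. (\<forall>i<n. \<chi> i a = 1) \<longrightarrow> \<rho> a = 1\<^sub>m n"
    by (rule restriction_decomposition[OF rep])
  have "\<rho> z \<noteq> 1\<^sub>m n"
  proof
    assume "\<rho> z = 1\<^sub>m n"
    then have "\<rho> z = \<rho> \<one>" using representation_one[OF rep] by simp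
    then show False using inj z_center(2) z_neq_one by (auto dest: inj_onD)
  qed
  then obtain i0 where i0: "i0 < n" "\<chi> i0 z \<noteq> 1" using triv z_in_abelian by blast
  define \<mu> where "\<mu> = \<chi> i0"
  have \<mu>: "is_char \<mu>" "\<mu> z \<noteq> 1" using \<chi> i0 by (auto simp: \<mu>_def)
  have stab: "t \<in> A" if "i < n" "\<chi> i z \<noteq> 1" "t \<in> carrier G" "twist t (\<chi> i) = \<chi> i" for i t
    using stabilizer_of_eigencharacter[OF rep] ev \<chi> that by blast
  have tr_conj: "mat_trace (\<rho> (inv g \<otimes> a \<otimes> g)) = mat_trace (\<rho> a)" if g: "g \<in> carrier G" and a: "a \<in> carrier G" for g a
  proof -
    note rg = rc[OF g] rc[OF a] rc[OF inv_closed[OF g]] rc[OF m_closed[OF inv_closed[OF g] a]]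
    have "mat_trace (\<rho> (inv g \<otimes> a \<otimes> g)) = mat_trace (\<rho> (inv g \<otimes> a) * \<rho> g)"
      using representation_mult[OF rep] g a by simp
    also have "\<dots> = mat_trace (\<rho> g * \<rho> (inv g \<otimes> a))" by (rule mat_trace_mult_comm[OF rg(4,1)])
    also have "\<rho> g * \<rho> (inv g \<otimes> a) = \<rho> (g \<otimes> (inv g \<otimes> a))" using representation_mult[OF rep] g a by simp
    also have "g \<otimes> (inv g \<otimes> a) = a" using g a by (simp add: m_assoc[symmetric])
    finally show ?thesis .
  qed
  have occ: "\<exists>i<n. \<chi> i = twist g (char_power s \<nu>)"
    if \<nu>: "is_char \<nu>" and occ\<nu>: "\<exists>i<n. \<chi> i = \<nu>" and g: "g \<in> carrier G" and s: "coprime s p" for \<nu> g s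
  proof -
    have s0: "s > 0" using s p_gt_1 by (cases s) auto
    have sG: "coprime s (card (carrier G))" using s by (simp add: card_G)
    have "card {i. i < n \<and> \<chi> i = twist g (char_power s \<nu>)} = card {i. i < n \<and> \<chi> i = char_power s \<nu>}"
      by (rule multiplicity_twist[OF \<chi> tr char_power_char[OF \<nu> s0] g]) (use tr_conj[OF g] A_carrier in blast)
    also have "\<dots> = card {i. i < n \<and> \<chi> i = \<nu>}"
      by (rule multiplicity_char_power[OF \<chi> tr \<nu> _ sG s0]) (use nat A_carrier in blast)
    finally have "card {i. i < n \<and> \<chi> i = twist g (char_power s \<nu>)} \<noteq> 0" using occ\<nu> by auto
    then show ?thesis by (metis (mono_tags, lifting) card.empty empty_Collect_eq)
  qed
  obtain u where u: "u \<in> carrier_vec n" "u \<noteq> 0\<^sub>v n" "\<forall>a\<in>A. \<rho> a *\<^sub>v u = \<mu> a \<cdot>\<^sub>v u"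
    using ev i0(1) by (auto simp: \<mu>_def)
  have irr: "\<exists>k \<sigma>. irreducible_representation G k \<sigma> \<and> k * card A = card (carrier G)"
    using eigenline_irreducible(2)[OF rep u(1,2) _ \<mu>(2)] u(3) z_in_abelian by blast
  have z0A: "z0 \<in> A"
  proof (rule stab[OF i0 z0(1)])
    have z0c: "z0 \<in> center G" using z0(1) unfolding z0(2) by (auto intro!: exI[of _ "1::nat"])
    have "inv z0 \<otimes> x \<otimes> z0 = x" if "x \<in> A" for x
    proof -
      have "inv z0 \<otimes> x \<otimes> z0 = inv z0 \<otimes> (z0 \<otimes> x)"
        using center_commutes[OF z0c A_carrier[OF that]] A_carrier[OF that] z0(1) by (simp add: m_assoc)
      also have "\<dots> = x" using A_carrier[OF that] z0(1) by (simp add: m_assoc[symmetric])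
      finally show ?thesis .
    qed
    then show "twist z0 (\<chi> i0) = \<chi> i0" using \<mu>(1) by (auto simp: twist_def is_char_def \<mu>_def fun_eq_iff)
  qed
  define f where "f = (LEAST f. \<forall>a\<in>A. \<mu> a ^ (p ^ f) = 1)"
  have fm: "\<forall>a\<in>A. \<mu> a ^ (p ^ m) = 1" using char_root_of_unity[OF \<mu>(1)] by (simp add: card_G)
  have f1: "\<forall>a\<in>A. \<mu> a ^ (p ^ f) = 1" unfolding f_def by (rule LeastI[of _ m]) (rule fm)
  have f0: "0 < f" using f1 \<mu>(2) z_in_abelian by (cases f) auto
  have "\<not> (\<forall>a\<in>A. \<mu> a ^ (p ^ (f - 1)) = 1)"
    using not_less_Least[of "f - 1" "\<lambda>f. \<forall>a\<in>A. \<mu> a ^ (p ^ f) = 1"] f0 by (simp add: f_def)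
  then obtain a0 where a0: "a0 \<in> A" "\<mu> a0 ^ (p ^ (f - 1)) \<noteq> 1" by blast
  have \<mu>occ: "\<exists>i<n. \<chi> i = \<mu>" using i0(1) by (auto simp: \<mu>_def)
  have \<mu>zp: "\<mu> z ^ p = 1"
    using char_pow[OF \<mu>(1) z_in_abelian, of p] z_pow_eq_1_iff[of p] \<mu>(1) by (simp add: is_char_def)
  have orbit: "char_orbit G p m r z0 A \<mu> f a0"
  proof unfold_locales
    fix t s assume t: "t \<in> carrier G" and s: "coprime s p" and fx: "twist t (char_power s \<mu>) = char_power s \<mu>"
    have s0: "s > 0" using s p_gt_1 by (cases s) auto
    obtain i where i: "i < n" "\<chi> i = char_power s \<mu>"
      using occ[OF \<mu>(1) \<mu>occ one_closed s] twist_one[OF char_power_char[OF \<mu>(1) s0]] by auto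
    have "\<chi> i z \<noteq> 1" using i(2) power_eq_1_coprime[OF \<mu>zp _ s] \<mu>(2) by (auto simp: char_power_def)
    then show "t \<in> A" using stab[OF i(1) _ t] fx i(2) by simp
  qed (use \<mu> z0A f0 f1 a0 in auto)
  interpret O: char_orbit G p m r z0 A \<mu> f a0 by (rule orbit)
  have orb_sub: "O.orb \<subseteq> \<chi> ` {i. i < n \<and> \<chi> i z \<noteq> 1}"
  proof
    fix \<nu> assume \<nu>: "\<nu> \<in> O.orb"
    then obtain i where "i < n" "\<chi> i = \<nu>" unfolding O.orb_def using occ[OF \<mu>(1) \<mu>occ] by blast
    then show "\<nu> \<in> \<chi> ` {i. i < n \<and> \<chi> i z \<noteq> 1}" using O.orb_z[OF \<nu>] by blast
  qed
  define X where "X = {i. i < n \<and> \<chi> i z \<noteq> 1}"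
  have finX: "finite X" by (simp add: X_def)
  have oX: "card O.orb \<le> card X"
    using surj_card_le[OF finX orb_sub[folded X_def]] .
  have "(\<Sum>j<p. mat_trace (\<rho> (z [^] j))) = (\<Sum>j<p. \<Sum>i<n. \<chi> i z ^ j)"
  proof (intro sum.cong refl)
    fix j :: nat
    have "mat_trace (\<rho> (z [^] j)) = (\<Sum>i<n. \<chi> i (z [^] j))" using tr A_closed(4)[OF z_in_abelian] by simp
    also have "\<dots> = (\<Sum>i<n. \<chi> i z ^ j)" using \<chi> char_pow[OF _ z_in_abelian] by simp
    finally show "mat_trace (\<rho> (z [^] j)) = (\<Sum>i<n. \<chi> i z ^ j)" .
  qed
  also have "\<dots> = (\<Sum>i<n. \<Sum>j<p. \<chi> i z ^ j)" by (rule sum.swap)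
  also have "\<dots> = (\<Sum>i<n. if \<chi> i z = 1 then of_nat p else 0)"
  proof (intro sum.cong refl root_of_unity_power_sum)
    fix i assume i: "i \<in> {..<n}"
    show "\<chi> i z ^ p = 1"
      using char_pow[of "\<chi> i", OF _ z_in_abelian, of p] z_pow_eq_1_iff[of p] \<chi> i by (simp add: is_char_def)
  qed
  also have "\<dots> = (\<Sum>i\<in>{i\<in>{..<n}. \<chi> i z = 1}. of_nat p)" by (rule sum.inter_filter[symmetric]) simp
  also have "{i\<in>{..<n}. \<chi> i z = 1} = {..<n} - X" by (auto simp: X_def)
  also have "(\<Sum>i\<in>{..<n} - X. (of_nat p :: complex)) = of_nat ((n - card X) * p)"
    using finX by (simp add: card_Diff_subset X_def subset_iff)
  finally have sum_z: "(\<Sum>j<p. mat_trace (\<rho> (z [^] j))) = of_nat ((n - card X) * p)" .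
  have "\<forall>j. \<exists>k::nat. mat_trace (\<rho> (z [^] (j::nat))) = of_nat k"
    using nat z_center(2) by (meson Nats_cases nat_pow_closed)
  then obtain k :: "nat \<Rightarrow> nat" where k: "\<And>j. mat_trace (\<rho> (z [^] j)) = of_nat (k j)" by metis
  \<comment> \<open>The term of the identity alone bounds the sum over the powers of \<open>z\<close> from below.\<close>
  have "k 0 = n" using k[of 0] representation_one[OF rep] by (simp add: mat_trace_def)
  moreover have "k 0 \<le> (\<Sum>j<p. k j)" using p_gt_1 by (intro member_le_sum) auto
  moreover have "(\<Sum>j<p. k j) = (n - card X) * p"
    using sum_z unfolding k of_nat_sum[symmetric] of_nat_eq_iff .
  ultimately have le: "n \<le> (n - card X) * p" by simp
  have Xn: "card X \<le> n" using card_mono[of "{..<n}" X] by (auto simp: X_def)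
  have "card X * p \<le> n * (p - 1)"
  proof -
    have "(n - card X) * p + card X * p = n * p" using Xn by (simp add: add_mult_distrib[symmetric])
    moreover have "n * p = n * (p - 1) + n" using p_gt_1 by (simp add: diff_mult_distrib2)
    ultimately show ?thesis using le by linarith
  qed
  then have "card O.orb * p \<le> n * (p - 1)" using oX by (meson le_trans mult_le_mono1)
  then have "O.num_classes * (p ^ (f - 1) * p) * (p - 1) \<le> n * (p - 1)" by (simp add: O.card_orb ac_simps)
  then have "O.num_classes * (p ^ (f - 1) * p) \<le> n" using p_gt_1 by simp
  moreover have "p ^ (f - 1) * p = p ^ f" using f0 by (metis Suc_diff_1 power_Suc2)
  ultimately have "O.num_classes * p ^ f \<le> n" by simp
  then show thesis using that[OF orbit _ irr] by blast
qed

lemma quasi_perm_degree_bounds: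
  "Max (cd G) * card (center G) dvd quasi_perm_degree G"
  "quasi_perm_degree G dvd Max (cd G) * group_exponent (G\<lparr>carrier := A\<rparr>)"
proof -
  define P where "P n \<longleftrightarrow> (\<exists>\<rho>. representation G n \<rho> \<and> inj_on \<rho> (carrier G) \<and>
     (\<forall>g\<in>carrier G. quasi_permutation_matrix n (\<rho> g)))" for n
  have PI: "P n" if "representation G n \<rho>" "inj_on \<rho> (carrier G)" "\<forall>g\<in>carrier G. mat_trace (\<rho> g) \<in> \<nat>" for n \<rho>
    unfolding P_def quasi_permutation_matrix_def using that representation_carrier[OF that(1)] by blast
  obtain \<rho>0 where "representation G (card (carrier G)) \<rho>0" "inj_on \<rho>0 (carrier G)"
    "\<And>g. g \<in> carrier G \<Longrightarrow> mat_trace (\<rho>0 g) \<in> \<nat>" by (rule regular_representation) blast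
  then have "P (card (carrier G))" using PI by blast
  define n where "n = quasi_perm_degree G"
  have nL: "n = (LEAST n. P n)" by (simp add: n_def quasi_perm_degree_def P_def)
  have "P n" unfolding nL by (rule LeastI) fact
  then obtain \<rho> where \<rho>: "representation G n \<rho>" "inj_on \<rho> (carrier G)" "\<forall>g\<in>carrier G. mat_trace (\<rho> g) \<in> \<nat>"
    unfolding P_def quasi_permutation_matrix_def by blast
  obtain \<mu> f a0 where orbit: "char_orbit G p m r z0 A \<mu> f a0" and le: "char_orbit.num_classes G p A \<mu> * p ^ f \<le> n"
    and irr: "\<exists>k \<sigma>. irreducible_representation G k \<sigma> \<and> k * card A = card (carrier G)"
    by (rule quasi_permutation_constituent[OF \<rho>])
  interpret O: char_orbit G p m r z0 A \<mu> f a0 by (rule orbit)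
  obtain \<rho>1 where "representation G (O.num_classes * p ^ f) \<rho>1" "inj_on \<rho>1 (carrier G)" "\<forall>g\<in>carrier G. mat_trace (\<rho>1 g) \<in> \<nat>"
    by (rule O.orbit_quasi_permutation_representation)
  then have "P (O.num_classes * p ^ f)" by (rule PI)
  then have "n \<le> O.num_classes * p ^ f" unfolding nL by (rule Least_le)
  with le have n: "n = O.num_classes * p ^ f" by simp
  obtain d \<sigma> where d: "irreducible_representation G d \<sigma>" "d * card A = card (carrier G)" using irr by blast
  have cdI: "k \<in> cd G" if "irreducible_representation G k \<tau>" for k \<tau>
  proof -
    have rep: "representation G k \<tau>" using that by (simp add: irreducible_representation_def)
    have "character G \<tau> \<in> Irr G" using that by (auto simp: Irr_def)
    moreover have "character G \<tau> \<one> = of_nat k" using representation_one[OF rep] by (simp add: character_def mat_trace_def)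
    ultimately show ?thesis unfolding cd_def by blast
  qed
  have cd_le: "k \<le> d" if "k \<in> cd G" for k
  proof -
    obtain j \<tau> where j: "irreducible_representation G j \<tau>" "character G \<tau> \<one> = of_nat k"
      using \<open>k \<in> cd G\<close> by (auto simp: cd_def Irr_def)
    have rep: "representation G j \<tau>" using j(1) by (simp add: irreducible_representation_def)
    have "character G \<tau> \<one> = of_nat j" using representation_one[OF rep] by (simp add: character_def mat_trace_def)
    then have "j = k" using j(2) by simp
    then have "k * card A \<le> d * card A" using irreducible_degree_le_index[OF j(1) A] d(2) by simp
    then show ?thesis using card_A_pos by simp
  qed
  have "finite (cd G)" using cd_le by (meson finite_nat_set_iff_bounded_le)
  then have Max: "Max (cd G) = d" using cd_le cdI[OF d(1)] by (intro Max_eqI) auto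
  obtain q where q: "O.num_classes * (q * card A) = card (carrier G)" using O.num_classes_times_index by blast
  have nd: "O.num_classes * q = d" using q d(2) card_A_pos by (metis mult.assoc mult_right_cancel not_gr_zero)
  have lower: "d * p ^ r \<le> O.num_classes * p ^ f"
  proof -
    have "p ^ (r - 1) * (p - 1) * (d * card A) \<le> O.num_classes * (p ^ (f - 1) * (p - 1)) * card A"
      using O.card_orb_ge O.card_orb d(2) by simp
    then have "(d * p ^ (r - 1)) * ((p - 1) * card A) \<le> (O.num_classes * p ^ (f - 1)) * ((p - 1) * card A)"
      by (simp add: ac_simps)
    then have "d * p ^ (r - 1) \<le> O.num_classes * p ^ (f - 1)" using p_gt_1 card_A_pos by simp
    then have "d * (p ^ (r - 1) * p) \<le> O.num_classes * (p ^ (f - 1) * p)" using mult_le_mono1[of _ _ p] by (simp only: mult.assoc[symmetric])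
    moreover have "p ^ (r - 1) * p = p ^ r" using r by (metis Suc_diff_1 power_Suc2)
    moreover have "p ^ (f - 1) * p = p ^ f" using O.f(1) by (metis Suc_diff_1 power_Suc2)
    ultimately show ?thesis by (simp only:)
  qed
  have "d * p ^ r dvd O.num_classes * p ^ f"
  proof (rule prime_power_le_imp_dvd[OF prime _ _ lower])
    have "d dvd p ^ m" using d(2) card_G by (metis dvd_triv_left)
    then show "d * p ^ r dvd p ^ (m + r)" by (simp add: power_add mult_dvd_mono)
    have "O.num_classes dvd p ^ m" using q card_G by (metis dvd_triv_left)
    then show "O.num_classes * p ^ f dvd p ^ (m + f)" by (simp add: power_add mult_dvd_mono)
  qed
  then show "Max (cd G) * card (center G) dvd quasi_perm_degree G"
    using Max card_center n by (simp add: n_def)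
  interpret GA: group "G\<lparr>carrier := A\<rparr>" by (rule subgroup_imp_group[OF A_facts(1)])
  have a0A: "a0 \<in> carrier (G\<lparr>carrier := A\<rparr>)" using O.a0(1) by simp
  have "GA.ord a0 dvd group_exponent (G\<lparr>carrier := A\<rparr>)"
    unfolding group_exponent_def using a0A by (intro dvd_Lcm) blast
  moreover have "ord a0 dvd GA.ord a0"
  proof -
    have "a0 [^]\<^bsub>G\<lparr>carrier := A\<rparr>\<^esub> GA.ord a0 = \<one>" using GA.pow_ord_eq_1[OF a0A] by simp
    then have "a0 [^] GA.ord a0 = \<one>" using nat_pow_consistent by metis
    then show ?thesis using pow_eq_id[OF A_carrier[OF O.a0(1)]] by blast
  qed
  ultimately have "p ^ f dvd group_exponent (G\<lparr>carrier := A\<rparr>)" using O.order_dvd_ord by (meson dvd_trans)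
  moreover have "O.num_classes dvd d" using nd by (metis dvd_triv_left)
  ultimately have "O.num_classes * p ^ f dvd d * group_exponent (G\<lparr>carrier := A\<rparr>)" by (rule mult_dvd_mono[rotated])
  then show "quasi_perm_degree G dvd Max (cd G) * group_exponent (G\<lparr>carrier := A\<rparr>)"
    using Max n by (simp add: n_def)
qed

end

lemma (in finite_group) trivial_group_case:
  assumes "carrier G = {\<one>}"
  shows "Max (cd G) = 1" "card (center G) = 1" "quasi_perm_degree G = 1"
proof -
  have c: "center G = {\<one>}" using assms by (auto simp: center_def)
  then show "card (center G) = 1" by simp
  have rep: "representation G 1 (\<lambda>_. 1\<^sub>m 1)" by (rule representationI) auto
  have an: "abelian_normal_subgroup {\<one>} G"
    unfolding abelian_normal_subgroup_def normal_inv_iff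
    using assms triv_subgroup subgroup_imp_group[OF triv_subgroup]
    by (auto intro!: group.group_comm_groupI)
  have le1: "k \<le> 1" if "irreducible_representation G k \<tau>" for k \<tau>
    using irreducible_degree_le_index[OF that an] assms by simp
  obtain k C \<sigma> where k: "k \<le> 1" "C \<in> carrier_mat 1 k" "injective_mat C" "irreducible_representation G k \<sigma>"
    "\<forall>g\<in>carrier G. 1\<^sub>m 1 * C = C * \<sigma> g"
    by (rule irreducible_constituent[OF rep])
  have repk: "representation G k \<sigma>" using k(4) by (simp add: irreducible_representation_def)
  then have k1: "k = 1" using k(1) by (simp add: representation_def)
  have val: "character G \<tau> \<one> = of_nat j" if "irreducible_representation G j \<tau>" for j \<tau>
    using representation_one[of j \<tau>] that by (simp add: irreducible_representation_def character_def mat_trace_def)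
  have "cd G = {1}"
  proof (intro equalityI subsetI)
    fix j assume "j \<in> cd G"
    then obtain i \<tau> where i: "irreducible_representation G i \<tau>" "character G \<tau> \<one> = of_nat j"
      by (auto simp: cd_def Irr_def)
    then have "i = j" using val[OF i(1)] by simp
    moreover have "0 < i" using i(1) by (simp add: irreducible_representation_def representation_def)
    ultimately show "j \<in> {1}" using le1[OF i(1)] by simp
  next
    fix j :: nat assume "j \<in> {1}"
    then have "j = k" using k1 by simp
    moreover have "character G \<sigma> \<in> Irr G" using k(4) by (auto simp: Irr_def)
    ultimately show "j \<in> cd G" unfolding cd_def using val[OF k(4)] by blast
  qed
  then show "Max (cd G) = 1" by simp
  show "quasi_perm_degree G = 1"
    unfolding quasi_perm_degree_def
  proof (rule Least_equality)
    have "\<forall>g\<in>carrier G. quasi_permutation_matrix 1 ((\<lambda>_. 1\<^sub>m 1 :: complex mat) g)"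
      by (simp add: quasi_permutation_matrix_def mat_trace_def)
    then show "\<exists>\<rho>. representation G 1 \<rho> \<and> inj_on \<rho> (carrier G) \<and> (\<forall>g\<in>carrier G. quasi_permutation_matrix 1 (\<rho> g))"
      using rep assms by (intro exI[of _ "\<lambda>_. 1\<^sub>m 1"]) simp
  qed (auto simp: representation_def)
qed

theorem theorem7:
  fixes G :: "('a, 'b) monoid_scheme" and p :: nat and A :: "'a set"
  assumes "prime p"
    and "group G" and "finite (carrier G)" and "\<exists>k. Coset.order G = p ^ k"
    and "normally_monomial G"
    and "cyclic_group (G\<lparr>carrier := center G\<rparr>)"
    and "abelian_normal_subgroup A G"
    and "\<And>B. abelian_normal_subgroup B G \<Longrightarrow> card B \<le> card A"
  shows "Max (cd G) * card (center G) dvd quasi_perm_degree G \<and>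
         quasi_perm_degree G dvd Max (cd G) * group_exponent (G\<lparr>carrier := A\<rparr>)"
proof -
  interpret finite_group G using assms(2,3) by (simp add: finite_group_def finite_group_axioms_def)
  obtain m where m: "card (carrier G) = p ^ m" using assms(4) by (auto simp: Coset.order_def)
  show ?thesis
  proof (cases "carrier G = {\<one>\<^bsub>G\<^esub>}")
    case True
    then show ?thesis using trivial_group_case by simp
  next
    case False
    have cp: "finite_p_group G p m"
      using assms(1) m finite_group_axioms by (simp add: finite_p_group_def finite_p_group_axioms_def)
    interpret finite_p_group G p m by (rule cp)
    have Zs: "subgroup (center G) G" using abelian_normal_subgroupD(1)[OF center_abelian_normal] .
    interpret Z: group "G\<lparr>carrier := center G\<rparr>" by (rule subgroup_imp_group[OF Zs])
    obtain z0 where z0: "z0 \<in> center G" "center G = range (\<lambda>n::int. z0 [^]\<^bsub>G\<lparr>carrier := center G\<rparr>\<^esub> n)"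
      using assms(6) unfolding Z.cyclic_group by auto
    have z0G: "z0 \<in> carrier G" using z0(1) center_subset by blast
    have rng: "center G = range (\<lambda>n::int. z0 [^]\<^bsub>G\<^esub> n)"
      using z0(2) int_pow_consistent[OF Zs z0(1)] by simp
    have red: "z0 [^]\<^bsub>G\<^esub> (n::int) = z0 [^]\<^bsub>G\<^esub> (nat (n mod int (ord z0)))" for n
    proof -
      have "0 < ord z0" using ord_ge_1[OF fin z0G] by simp
      then have "int (nat (n mod int (ord z0))) = n mod int (ord z0)" by simp
      moreover have "z0 [^]\<^bsub>G\<^esub> n = z0 [^]\<^bsub>G\<^esub> (n mod int (ord z0))"
        using int_pow_eq[OF z0G] by (simp add: mod_eq_dvd_iff[symmetric])
      ultimately show ?thesis by (metis int_pow_int)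
    qed
    have Zpow: "center G = {z0 [^]\<^bsub>G\<^esub> (i::nat) |i. True}"
    proof (intro equalityI subsetI)
      fix y assume "y \<in> center G"
      then obtain n :: int where "y = z0 [^]\<^bsub>G\<^esub> n" using rng by blast
      then show "y \<in> {z0 [^]\<^bsub>G\<^esub> (i::nat) |i. True}" using red by blast
    next
      fix y assume "y \<in> {z0 [^]\<^bsub>G\<^esub> (i::nat) |i. True}"
      then obtain i :: nat where "y = z0 [^]\<^bsub>G\<^esub> int i" by (auto simp: int_pow_int)
      then show "y \<in> center G" using rng by blast
    qed
    have "ord z0 dvd card (carrier G)" using ord_dvd_group_order[OF z0G] by (simp add: Coset.order_def)
    then obtain r where r: "ord z0 = p ^ r" using p_power_of_dvd by blast
    have "r \<noteq> 0"
    proof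
      assume "r = 0"
      then have "z0 = \<one>\<^bsub>G\<^esub>" using r pow_ord_eq_1[OF z0G] z0G by simp
      then have "center G = {\<one>\<^bsub>G\<^esub>}" using Zpow by auto
      moreover have "carrier G \<lhd> G" by (rule normal_self)
      ultimately show False using normal_subgroup_meets_center[OF _ False] by blast
    qed
    then interpret normally_monomial_p_group G p m r z0 A
      using z0G Zpow r assms(5,7,8) by unfold_locales auto
    show ?thesis using quasi_perm_degree_bounds by blast
  qed
qed

end
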